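(* Let $X_k=\sum_{i=0}^{\infty}a_i\varepsilon_{k-i}$ be the linear process described in the context. Let $0<p<1$ and assume that $\sup_x[f_\varepsilon(x)+|f_\varepsilon'(x)|]<\infty$, $f(\xi_p)>0$, and $\mathbb{E}(|\varepsilon_k|^{\alpha})<\infty$ for some $\alpha>0$. (a) If for some $q>2$ $$\sum_{i=n}^{\infty}|a_i|^{\min(\alpha/q,1)}=O(\log^{-1/q}n),$$ then: (i) there exists $C>0$ such that $\delta_{n,q}=C\,\ell_q(n)/[f(\xi_p)\sqrt n]$ satisfies $$F_n(\xi_p+\delta_{n,q})\ge p\ge F_n(\xi_p-\delta_{n,q})\quad\text{almost surely},$$ and $|\xi_{n,p}-\xi_p|\le\delta_{n,q}$ almost surely (i.e. with probability one these inequalities hold for all sufficiently large $n$); (ii) the Bahadur representation holds: $$\xi_{n,p}=\xi_p+\frac{p-F_n(\xi_p)}{f(\xi_p)}+O_{\mathrm{a.s.}}\bigl[n^{-3/4}(\log\log n)^{1/2}\ell_q^{1/2}(n)\bigr].$$ (b) If $$\sum_{i=1}^{\infty}|a_i|^{\min(\alpha/2,1)}<\infty,$$ then the conclusions (i) and (ii) of part (a) hold with $q=2$.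
   Context: $(\varepsilon_k)_{k\in\mathbb{Z}}$ are i.i.d. real random variables with distribution function $F_\varepsilon$ and (differentiable) density $f_\varepsilon$; $(a_i)_{i\ge0}$ are real coefficients with $a_0=1$ such that $X_k=\sum_{i=0}^\infty a_i\varepsilon_{k-i}$ exists almost surely. $F$ and $f$ are the distribution function and density of $X_k$; $\xi_p=\inf\{x:F(x)\ge p\}$. Given $X_1,\dots,X_n$, $F_n(x)=\frac1n\sum_{i=1}^n\mathbf 1_{X_i\le x}$ and $\xi_{n,p}=\inf\{x:F_n(x)\ge p\}$ is the $p$th sample quantile. Define $\ell_q(n)=(\log\log n)^{1/2}$ if $q>2$ and $\ell_2(n)=(\log n)^{3/2}(\log\log n)$. A sequence of random variables $Z_n$ is $O_{\mathrm{a.s.}}(r_n)$ if $Z_n/r_n$ is almost surely bounded. *)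

theory Defs
  imports "HOL-Probability.Probability" "HOL-Library.Landau_Symbols"
begin

definition lin_proc :: "(nat \<Rightarrow> real) \<Rightarrow> (int \<Rightarrow> 'w \<Rightarrow> real) \<Rightarrow> int \<Rightarrow> 'w \<Rightarrow> real" where
  "lin_proc a \<epsilon> k \<omega> = (\<Sum>i. a i * \<epsilon> (k - int i) \<omega>)"

definition dist_fun :: "'w measure \<Rightarrow> ('w \<Rightarrow> real) \<Rightarrow> real \<Rightarrow> real" where
  "dist_fun M Y = cdf (distr M borel Y)"

text \<open>Densities are determined only up to null sets. Since the value of the density at a
  single point matters below, the continuous version is chosen; there is at most one.\<close>

definition cont_density :: "'w measure \<Rightarrow> ('w \<Rightarrow> real) \<Rightarrow> real \<Rightarrow> real" where
  "cont_density M Y = (THE f. (\<forall>x. 0 \<le> f x) \<and> continuous_on UNIV f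
      \<and> distributed M lborel Y (\<lambda>x. ennreal (f x)))"

definition quantile :: "(real \<Rightarrow> real) \<Rightarrow> real \<Rightarrow> real" where
  "quantile G p = Inf {x. p \<le> G x}"

definition emp_cdf :: "(int \<Rightarrow> 'w \<Rightarrow> real) \<Rightarrow> nat \<Rightarrow> 'w \<Rightarrow> real \<Rightarrow> real" where
  "emp_cdf X n \<omega> x = (\<Sum>i = 1..n. if X (int i) \<omega> \<le> x then 1 else 0) / real n"

text \<open>Only \<open>q \<ge> 2\<close> is relevant; the second branch is the case \<open>q = 2\<close>.\<close>

definition ell :: "real \<Rightarrow> nat \<Rightarrow> real" where
  "ell q n = (if q > 2 then sqrt (ln (ln (real n)))
              else ln (real n) powr (3/2) * ln (ln (real n)))"

text \<open>The bounding constant may depend on the sample point. Landau's symbol ignores the finitely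
  many \<open>n\<close> for which \<open>ln (ln n)\<close> is not a positive real.\<close>

definition bigo_as :: "'w measure \<Rightarrow> (nat \<Rightarrow> 'w \<Rightarrow> real) \<Rightarrow> (nat \<Rightarrow> real) \<Rightarrow> bool" where
  "bigo_as M Z r \<longleftrightarrow> (AE \<omega> in M. (\<lambda>n. Z n \<omega>) \<in> O(r))"

text \<open>The law of \<open>X\<close> is read off at time \<open>0\<close>; the predicates are meant for stationary \<open>X\<close>.
  The constant \<open>C\<close> is deterministic.\<close>

definition quantile_as_bounds ::
    "'w measure \<Rightarrow> (int \<Rightarrow> 'w \<Rightarrow> real) \<Rightarrow> real \<Rightarrow> real \<Rightarrow> bool" where
  "quantile_as_bounds M X p q \<longleftrightarrow>
    (let \<xi> = quantile (dist_fun M (X 0)) p; f = cont_density M (X 0) in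
     \<exists>C>0. let \<delta> = (\<lambda>n. C * ell q n / (f \<xi> * sqrt (real n))) in
       AE \<omega> in M. \<forall>\<^sub>F n in sequentially.
         emp_cdf X n \<omega> (\<xi> + \<delta> n) \<ge> p \<and> p \<ge> emp_cdf X n \<omega> (\<xi> - \<delta> n) \<and>
         \<bar>quantile (emp_cdf X n \<omega>) p - \<xi>\<bar> \<le> \<delta> n)"

definition bahadur_representation ::
    "'w measure \<Rightarrow> (int \<Rightarrow> 'w \<Rightarrow> real) \<Rightarrow> real \<Rightarrow> real \<Rightarrow> bool" where
  "bahadur_representation M X p q \<longleftrightarrow>
    (let \<xi> = quantile (dist_fun M (X 0)) p; f = cont_density M (X 0) in
     bigo_as M
       (\<lambda>n \<omega>. quantile (emp_cdf X n \<omega>) p - (\<xi> + (p - emp_cdf X n \<omega> \<xi>) / f \<xi>))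
       (\<lambda>n. real n powr (- 3/4) * sqrt (ln (ln (real n))) * sqrt (ell q n)))"

end

theory Submission
  imports Defs "HOL-Real_Asymp.Real_Asymp"
begin

text \<open>
  With \<open>Y\<^sub>i = X\<^sub>i - \<epsilon>\<^sub>i\<close>, the error \<open>n (F\<^sub>n x - F x)\<close> is the martingale
  \<open>\<Sum> (1{X\<^sub>i \<le> x} - F\<epsilon> (x - Y\<^sub>i))\<close> plus the smooth part \<open>\<Sum> (F\<epsilon> (x - Y\<^sub>i) - F x)\<close>.
  The increments of the martingale in \<open>x\<close> have conditional variances that are bounded
  deterministically, because \<open>f\<epsilon>\<close> is bounded; an exponential maximal inequality and dyadic
  chaining over \<open>x\<close> then control its oscillation near \<open>\<xi>\<close>. The smooth part is expanded to second
  order at \<open>\<xi>\<close>, so only \<open>\<Sum> g (Y\<^sub>i)\<close> for the two bounded Lipschitz functions \<open>F\<epsilon> (\<xi> - \<cdot>)\<close> and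
  \<open>f\<epsilon> (\<xi> - \<cdot>)\<close> matters. Such a sum is decomposed into martingales according to the lag of the
  innovation that is integrated out. Large lags are estimated in \<open>L\<^sup>q\<close>, where the lag \<open>j\<close> contributes
  \<open>\<bar>a\<^sub>j\<bar> powr min (\<alpha>/q) 1\<close>, with a maximal inequality by chaining over dyadic blocks of indices; for
  \<open>q > 2\<close> the lags up to a small power of \<open>n\<close> are collected in one martingale with bounded conditional
  variances, to which the exponential inequality applies. Borel--Cantelli along \<open>n = 2\<^sup>k\<close> gives the
  almost sure rates, and inverting \<open>F\<^sub>n\<close> near \<open>\<xi>\<close> gives both conclusions.
\<close>

section \<open>Elementary inequalities and chaining\<close>

text \<open>The innovations may have only a moment of tiny order \<open>\<alpha>\<close>, so
  boundedness of the functionals is traded for moments: an increment \<open>z\<close> costs at most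
  a constant times \<open>\<bar>z\<bar> powr \<beta>\<close>, and
  \<open>\<beta> * q \<le> \<alpha>\<close> makes the q-th power of this integrable. For
  \<open>q > 2\<close>, Markov's inequality at the level \<open>sqrt (2 ^ k * ln k)\<close> gives
  only \<open>\<Theta> J powr q / ln k powr (q/2)\<close> per block, which is not summable for fixed
  \<open>J\<close>. Letting \<open>J\<close> grow with the block supplies the missing factor
  \<open>1 / k\<close>; the early lags then need an exponential bound, whose range
  \<open>t * b \<le> 1\<close> keeps \<open>J\<close> a small power of the block length. For
  \<open>q = 2\<close> all dyadic levels contribute equally. The maximal inequality loses
  \<open>k ^ 2\<close>, and convergence of the series asks for a further
  \<open>k * (ln k) ^ 2\<close>; the root of the product is the rate
  \<open>ln n powr (3/2) * ln (ln n)\<close>. The final error rate reflects the window: over a width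
  \<open>ell q n / sqrt n\<close> the martingale part has variance of order
  \<open>sqrt n * ell q n\<close>, and \<open>ln (ln n)\<close> under the root is the price of
  Borel-Cantelli along dyadic blocks.\<close>

lemma exp_le_quadratic:
  fixes x :: real
  assumes "x \<le> 1"
  shows "exp x \<le> 1 + x + x\<^sup>2"
proof (cases "x \<ge> 0")
  case True
  then show ?thesis using exp_bound assms by auto
next
  case False
  define y where "y = - x"
  have y: "y > 0" using False by (simp add: y_def)
  have "exp x = 1 / exp y" by (simp add: y_def exp_minus field_simps)
  also have "\<dots> \<le> 1 / (1 + y)"
    using y exp_ge_add_one_self[of y] by (intro divide_left_mono) auto
  also have "\<dots> \<le> 1 - y + y\<^sup>2"
  proof -
    have "(1 - y + y\<^sup>2) * (1 + y) = 1 + y ^ 3" by (simp add: algebra_simps power2_eq_square power3_eq_cube)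
    then have "1 \<le> (1 - y + y\<^sup>2) * (1 + y)" using y by simp
    then show ?thesis using y by (simp add: divide_simps)
  qed
  finally show ?thesis by (simp add: y_def)
qed

text \<open>Three ranges: for \<open>u \<le> -1\<close> the modulus of \<open>1 + u\<close> is at
  most that of \<open>u\<close>; for \<open>q * u \<le> 1\<close> the estimate
  \<open>ln (1 + u) \<le> u\<close> reduces the claim to \<open>exp_le_quadratic\<close>; beyond
  that \<open>1 + u \<le> (q + 1) * u\<close>, the origin of the constant
  \<open>(q + 1) powr q\<close>.\<close>

lemma powr_one_plus_le:
  fixes q u :: real
  assumes "q \<ge> 2"
  shows "\<bar>1 + u\<bar> powr q \<le> 1 + q * u + ((q + 1) powr q + q\<^sup>2) * (u\<^sup>2 + \<bar>u\<bar> powr q)"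
proof -
  let ?D = "(q + 1) powr q"
  have D: "?D \<ge> 1" using assms by (simp add: ge_one_powr_ge_zero)
  have r: "(?D + q\<^sup>2) * (u\<^sup>2 + \<bar>u\<bar> powr q) = ?D * u\<^sup>2 + ?D * \<bar>u\<bar> powr q + (q * u)\<^sup>2 + q\<^sup>2 * \<bar>u\<bar> powr q"
    by (simp add: algebra_simps power_mult_distrib)
  have nn: "?D * u\<^sup>2 \<ge> 0" "?D * \<bar>u\<bar> powr q \<ge> 0" "q\<^sup>2 * \<bar>u\<bar> powr q \<ge> 0" by auto
  consider "u \<le> -1" | "u > -1" "q * u \<le> 1" | "q * u > 1" by linarith
  then show ?thesis
  proof cases
    case 1
    have "\<bar>1 + u\<bar> powr q \<le> \<bar>u\<bar> powr q" using 1 assms by (intro powr_mono2) auto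
    also have "\<dots> \<le> ?D * \<bar>u\<bar> powr q" using D by (simp add: mult_le_cancel_right1)
    finally have a: "\<bar>1 + u\<bar> powr q \<le> ?D * \<bar>u\<bar> powr q" .
    have "0 \<le> (q*u + 1/2)\<^sup>2" by simp
    then have "1 + q * u + (q * u)\<^sup>2 \<ge> 0" by (simp add: power2_eq_square algebra_simps)
    then show ?thesis using a r nn by linarith
  next
    case 2
    have "\<bar>1 + u\<bar> powr q = exp (q * ln (1 + u))" using 2 by (simp add: powr_def)
    also have "\<dots> \<le> exp (q * u)" using 2 assms ln_add_one_self_le_self2[of u] by simp
    also have "\<dots> \<le> 1 + q * u + (q * u)\<^sup>2" using 2 exp_le_quadratic by blast
    finally show ?thesis using r nn by linarith
  next
    case 3
    have u: "u > 0" using 3 assms by (smt (verit) mult_nonneg_nonpos)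
    have "\<bar>1 + u\<bar> powr q \<le> ((q + 1) * u) powr q" using 3 assms u by (intro powr_mono2) (auto simp: algebra_simps)
    also have "\<dots> = ?D * \<bar>u\<bar> powr q" using u assms by (simp add: powr_mult)
    finally show ?thesis using r nn 3 zero_le_power2[of "q*u"] by linarith
  qed
qed

text \<open>Homogeneous form of \<open>powr_one_plus_le\<close>, applied to \<open>d / x\<close>.
  The term linear in \<open>d\<close> is kept exactly, because it integrates to zero when
  \<open>d\<close> is a centred increment.\<close>

lemma powr_add_le:
  fixes q x d :: real
  assumes q: "q \<ge> 2"
  shows "\<bar>x + d\<bar> powr q \<le> \<bar>x\<bar> powr q + q * sgn x * \<bar>x\<bar> powr (q - 1) * d
    + ((q + 1) powr q + q\<^sup>2) * (\<bar>x\<bar> powr (q - 2) * d\<^sup>2 + \<bar>d\<bar> powr q)"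
proof (cases "x = 0")
  case True
  have "(q + 1) powr q \<ge> 1" using q by (simp add: ge_one_powr_ge_zero)
  then have "1 * \<bar>d\<bar> powr q \<le> ((q + 1) powr q + q\<^sup>2) * \<bar>d\<bar> powr q"
    by (intro mult_right_mono) (auto intro: add_increasing2)
  then show ?thesis using True by simp
next
  case False
  let ?u = "d / x" let ?X = "\<bar>x\<bar> powr q"
  have "x + d = x * (1 + ?u)" using False by (simp add: field_simps)
  then have 1: "\<bar>x + d\<bar> powr q = ?X * \<bar>1 + ?u\<bar> powr q"
    by (metis abs_ge_zero abs_mult powr_mult)
  have x1: "\<bar>x\<bar> powr (q - 1) = ?X / \<bar>x\<bar>" using False by (simp add: powr_diff)
  have x2: "\<bar>x\<bar> powr (q - 2) = ?X / x\<^sup>2" using False by (simp add: powr_diff)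
  have 2: "?X * (q * ?u) = q * sgn x * \<bar>x\<bar> powr (q - 1) * d"
    unfolding x1 using False by (simp add: sgn_if field_simps)
  have 3: "?X * ?u\<^sup>2 = \<bar>x\<bar> powr (q - 2) * d\<^sup>2" unfolding x2 by (simp add: power_divide)
  have 4: "?X * \<bar>?u\<bar> powr q = \<bar>d\<bar> powr q" using False by (simp add: powr_divide)
  have "?X * \<bar>1 + ?u\<bar> powr q \<le> ?X * (1 + q * ?u + ((q + 1) powr q + q\<^sup>2) * (?u\<^sup>2 + \<bar>?u\<bar> powr q))"
    by (rule mult_left_mono[OF powr_one_plus_le[OF q]]) auto
  also have "\<dots> = ?X + ?X * (q * ?u) + ((q + 1) powr q + q\<^sup>2) * (?X * ?u\<^sup>2 + ?X * \<bar>?u\<bar> powr q)"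
    by (simp add: algebra_simps)
  finally show ?thesis unfolding 1 2 3 4 .
qed

text \<open>Jensen's inequality for the normalized weights \<open>\<theta>\<close>, standing in for
  Minkowski's inequality: if the q-th moment of each \<open>x j\<close> is at most
  \<open>c * \<theta> j powr q\<close>, the mean of the right side is at most \<open>c\<close> times
  the q-th power of the sum of the weights. It is applied to lags and to dyadic levels.\<close>

lemma powr_sum_le_weighted:
  fixes x \<theta> :: "'a \<Rightarrow> real"
  assumes "finite A" and q: "q \<ge> 1" and \<theta>: "\<And>j. j \<in> A \<Longrightarrow> 0 \<le> \<theta> j"
    and x0: "\<And>j. j \<in> A \<Longrightarrow> \<theta> j = 0 \<Longrightarrow> x j = 0"
  shows "\<bar>\<Sum>j\<in>A. x j\<bar> powr q \<le> (\<Sum>j\<in>A. \<theta> j) powr (q - 1) * (\<Sum>j\<in>A. \<theta> j * (\<bar>x j\<bar> / \<theta> j) powr q)"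
proof -
  \<comment> \<open>Convexity of the power is used on the open half line, so vanishing terms are
    dropped; by \<open>x0\<close> the remaining weights are positive.\<close>
  define B where "B = {j \<in> A. x j \<noteq> 0}"
  have B: "finite B" "B \<subseteq> A" using assms by (auto simp: B_def)
  have pos: "\<theta> j > 0" if "j \<in> B" for j using that \<theta>[of j] x0[of j] by (force simp: B_def less_le)
  let ?T = "\<Sum>j\<in>B. \<theta> j"
  have R0: "(\<Sum>j\<in>A. \<theta> j) powr (q - 1) * (\<Sum>j\<in>A. \<theta> j * (\<bar>x j\<bar> / \<theta> j) powr q) \<ge> 0"
    using \<theta> by (intro mult_nonneg_nonneg sum_nonneg) auto
  have eq: "(\<Sum>j\<in>A. x j) = (\<Sum>j\<in>B. x j)" using assms(1) by (intro sum.mono_neutral_right) (auto simp: B_def)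
  show ?thesis
  proof (cases "B = {}")
    case True then show ?thesis using eq R0 q by simp
  next
    case False
    have T: "?T > 0" using B False pos by (intro sum_pos) auto
    have "\<bar>\<Sum>j\<in>B. x j\<bar> \<le> (\<Sum>j\<in>B. \<bar>x j\<bar>)" by (rule sum_abs)
    also have "\<dots> = ?T * (\<Sum>j\<in>B. (\<theta> j / ?T) *\<^sub>R (\<bar>x j\<bar> / \<theta> j))"
      unfolding sum_distrib_left using T pos by (intro sum.cong) (auto simp: field_simps, metis less_irrefl pos)
    finally have le: "\<bar>\<Sum>j\<in>B. x j\<bar> \<le> ?T * (\<Sum>j\<in>B. (\<theta> j / ?T) *\<^sub>R (\<bar>x j\<bar> / \<theta> j))" .
    have s0: "(\<Sum>j\<in>B. (\<theta> j / ?T) *\<^sub>R (\<bar>x j\<bar> / \<theta> j)) \<ge> 0"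
      using T pos by (intro sum_nonneg) (auto intro!: mult_nonneg_nonneg divide_nonneg_nonneg simp: less_imp_le)
    have cv: "(\<Sum>j\<in>B. (\<theta> j / ?T) *\<^sub>R (\<bar>x j\<bar> / \<theta> j)) powr q \<le> (\<Sum>j\<in>B. (\<theta> j / ?T) * (\<bar>x j\<bar> / \<theta> j) powr q)"
    proof (rule convex_on_sum[OF B(1) False powr_convex[OF q]])
      show "(\<Sum>i\<in>B. \<theta> i / ?T) = 1" using T by (simp flip: sum_divide_distrib)
      show "\<And>i. i \<in> B \<Longrightarrow> 0 \<le> \<theta> i / ?T" using T pos by (simp add: less_imp_le)
      show "\<And>i. i \<in> B \<Longrightarrow> \<bar>x i\<bar> / \<theta> i \<in> {0<..}" using pos by (auto simp: B_def)
    qed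
    have "\<bar>\<Sum>j\<in>B. x j\<bar> powr q \<le> (?T * (\<Sum>j\<in>B. (\<theta> j / ?T) *\<^sub>R (\<bar>x j\<bar> / \<theta> j))) powr q"
      using le q by (intro powr_mono2) auto
    also have "\<dots> = ?T powr q * (\<Sum>j\<in>B. (\<theta> j / ?T) *\<^sub>R (\<bar>x j\<bar> / \<theta> j)) powr q"
      using T s0 by (subst powr_mult) auto
    also have "\<dots> \<le> ?T powr q * (\<Sum>j\<in>B. (\<theta> j / ?T) * (\<bar>x j\<bar> / \<theta> j) powr q)"
      using cv by (intro mult_left_mono) auto
    also have "\<dots> = ?T powr (q - 1) * (\<Sum>j\<in>B. \<theta> j * (\<bar>x j\<bar> / \<theta> j) powr q)"
      using T by (simp add: powr_diff sum_distrib_left field_simps)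
    also have "\<dots> \<le> (\<Sum>j\<in>A. \<theta> j) powr (q - 1) * (\<Sum>j\<in>A. \<theta> j * (\<bar>x j\<bar> / \<theta> j) powr q)"
      using assms(1) B \<theta> q T pos
      by (intro mult_mono powr_mono2 sum_mono2 sum_nonneg mult_nonneg_nonneg) (auto simp: less_imp_le)
    finally show ?thesis unfolding eq .
  qed
qed

lemma lipschitz_imp_continuous:
  fixes f :: "real \<Rightarrow> real"
  assumes lip: "\<And>x y. \<bar>f x - f y\<bar> \<le> L * \<bar>x - y\<bar>"
  shows "continuous_on UNIV f"
proof (rule lipschitz_on_continuous_on[of L])
  have "0 \<le> L" using order_trans[OF abs_ge_zero lip[of 0 1]] by simp
  then show "L-lipschitz_on UNIV f" using lip by (auto simp: lipschitz_on_def dist_real_def)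
qed

lemma lipschitz_imp_borel_measurable:
  fixes f :: "real \<Rightarrow> real"
  assumes "\<And>x y. \<bar>f x - f y\<bar> \<le> L * \<bar>x - y\<bar>"
  shows "f \<in> borel_measurable borel"
  by (rule borel_measurable_continuous_onI[OF lipschitz_imp_continuous[OF assms]])

text \<open>A point of level \<open>J\<close> coincides with its parent \<open>m div 2\<close> or is
  its right neighbour on level \<open>J\<close>, so each level costs a single increment. It is used
  both for sample indices and for real arguments.\<close>

lemma dyadic_chaining:
  fixes g :: "nat \<Rightarrow> nat \<Rightarrow> real"
  assumes refine: "\<And>j m. j < J \<Longrightarrow> g (Suc j) (2 * m) = g j m"
    and step: "\<And>j m. j \<le> J \<Longrightarrow> m < 2 ^ j \<Longrightarrow> \<bar>g j (Suc m) - g j m\<bar> \<le> c j"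
    and "m \<le> 2 ^ J"
  shows "\<bar>g J m - g 0 0\<bar> \<le> (\<Sum>j\<le>J. c j)"
  using assms
proof (induction J arbitrary: m)
  case 0
  then have "m = 0 \<or> m = 1" by auto
  moreover have "\<bar>g 0 (Suc 0) - g 0 0\<bar> \<le> c 0" using "0.prems"(2)[of 0 0] by simp
  ultimately show ?case by auto
next
  case (Suc J)
  have IH: "\<bar>g J (m div 2) - g 0 0\<bar> \<le> (\<Sum>j\<le>J. c j)"
    using Suc.prems by (intro Suc.IH) auto
  have c: "\<bar>g (Suc J) (Suc 0) - g (Suc J) 0\<bar> \<le> c (Suc J)" using Suc.prems(2)[of "Suc J" 0] by simp
  have r: "g (Suc J) (2 * (m div 2)) = g J (m div 2)" by (rule Suc.prems) simp
  have "\<bar>g (Suc J) m - g (Suc J) (2 * (m div 2))\<bar> \<le> c (Suc J)"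
  proof (cases "even m")
    case True
    then show ?thesis using c by simp
  next
    case False
    then have m: "m = Suc (2 * (m div 2))" by presburger
    have "2 * (m div 2) < 2 ^ Suc J" using m Suc.prems(3) by linarith
    then show ?thesis using Suc.prems(2)[of "Suc J" "2 * (m div 2)"] m by simp
  qed
  then show ?case using IH r by simp
qed

section \<open>Martingale inequalities for independent innovations\<close>

locale innovations = prob_space M for M :: "'w measure" +
  fixes \<epsilon> :: "int \<Rightarrow> 'w \<Rightarrow> real" and \<mu> :: "real measure"
  assumes indep: "indep_vars (\<lambda>_. borel) \<epsilon> UNIV"
    and law: "\<And>k. distr M borel (\<epsilon> k) = \<mu>"
begin

section \<open>The filtration of the innovations and integration over the current innovation\<close>

definition past :: "int \<Rightarrow> 'w measure" where
  "past k = sigma (space M) (\<Union>l\<in>{..<k}. {\<epsilon> l -` A \<inter> space M | A. A \<in> sets borel})"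

lemma measurable_innovation [measurable]: "\<epsilon> k \<in> borel_measurable M"
  using indep by (auto simp: indep_vars_def2)

lemma space_past [simp]: "space (past k) = space M"
  by (simp add: past_def space_measure_of_conv)

lemma sets_past: "sets (past k) = sigma_sets (space M) (\<Union>l\<in>{..<k}. {\<epsilon> l -` A \<inter> space M | A. A \<in> sets borel})"
  unfolding past_def by (intro sets_measure_of) auto

lemma measurable_innovation_past: "l < k \<Longrightarrow> \<epsilon> l \<in> borel_measurable (past k)"
  by (rule measurableI) (auto simp: sets_past intro!: sigma_sets.Basic)

lemma sets_past_subset: "sets (past k) \<subseteq> sets M"
  unfolding sets_past by (intro sets.sigma_sets_subset) auto

lemma measurable_past_imp: "f \<in> measurable (past k) N \<Longrightarrow> f \<in> measurable M N"
  using sets_past_subset by (auto simp: measurable_def)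

lemma measurable_past_mono:
  assumes "k \<le> l" "f \<in> measurable (past k) N"
  shows "f \<in> measurable (past l) N"
proof -
  have "sets (past k) \<subseteq> sets (past l)"
    unfolding sets_past using assms(1) by (intro sigma_sets_mono' UN_mono) auto
  then show ?thesis using assms(2) by (auto simp: measurable_def)
qed

lemma indep_innovation_past: "indep_set {\<epsilon> k -` A \<inter> space M | A. A \<in> sets borel} (sets (past k))"
proof -
  let ?E = "\<lambda>l. {\<epsilon> l -` A \<inter> space M | A. A \<in> sets borel}"
  let ?I = "\<lambda>b. if b then {k} else {..<k}"
  have "indep_sets ?E UNIV" using indep by (simp add: indep_vars_def2)
  then have "indep_sets ?E (\<Union>b\<in>UNIV. ?I b)" by (rule indep_sets_mono) auto
  then have "indep_sets (\<lambda>b. sigma_sets (space M) (\<Union>l\<in>?I b. ?E l)) UNIV"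
  proof (rule indep_sets_collect_sigma)
    show "Int_stable (?E l)" for l
      unfolding Int_stable_def
    proof safe
      fix A B :: "real set" assume "A \<in> sets borel" "B \<in> sets borel"
      then show "\<exists>C. \<epsilon> l -` A \<inter> space M \<inter> (\<epsilon> l -` B \<inter> space M) = \<epsilon> l -` C \<inter> space M \<and> C \<in> sets borel"
        by (intro exI[of _ "A \<inter> B"]) auto
    qed
  qed (auto simp: disjoint_family_on_def)
  then show ?thesis
    unfolding indep_set_def sets_past by (rule indep_sets_mono_sets) (auto split: bool.splits)
qed

lemma prob_space_law: "prob_space \<mu>"
  using prob_space_distr[OF measurable_innovation] law by metis

sublocale law: prob_space \<mu>
  by (rule prob_space_law)

lemma sets_law [measurable_cong, simp]: "sets \<mu> = sets borel"
  by (metis law sets_distr)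

lemma space_law [simp]: "space \<mu> = UNIV"
  using sets_eq_imp_space_eq[OF sets_law] by simp

text \<open>\<open>M\<close> restricted to the sigma-algebra of \<open>past k\<close>, written as an
  image under the identity so that the rules for \<open>distr\<close> apply.\<close>

definition pastM :: "int \<Rightarrow> 'w measure" where
  "pastM k = distr M (past k) (\<lambda>\<omega>. \<omega>)"

lemma measurable_id_past [measurable]: "(\<lambda>\<omega>. \<omega>) \<in> measurable M (past k)"
  by (rule measurable_past_imp[of _ k]) simp

lemma sets_pastM [measurable_cong, simp]: "sets (pastM k) = sets (past k)"
  by (simp add: pastM_def)

lemma prob_space_pastM: "prob_space (pastM k)"
  unfolding pastM_def by (rule prob_space_distr) simp

lemma measurable_joint: "(\<lambda>\<omega>. (\<epsilon> k \<omega>, \<omega>)) \<in> measurable M (borel \<Otimes>\<^sub>M past k)"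
  by measurable

text \<open>Independence of \<open>\<epsilon> k\<close> and \<open>past k\<close> gives equality on
  rectangles, which suffices. The second coordinate is the sample point itself, so that any
  functional of the past, infinite series included, can be inserted there.\<close>

lemma joint_law: "distr M (borel \<Otimes>\<^sub>M past k) (\<lambda>\<omega>. (\<epsilon> k \<omega>, \<omega>)) = \<mu> \<Otimes>\<^sub>M pastM k"
proof (rule sym, rule pair_measure_eqI)
  interpret P: prob_space "pastM k" by (rule prob_space_pastM)
  show "sigma_finite_measure \<mu>" "sigma_finite_measure (pastM k)" by unfold_locales
  show "sets (\<mu> \<Otimes>\<^sub>M pastM k) = sets (distr M (borel \<Otimes>\<^sub>M past k) (\<lambda>\<omega>. (\<epsilon> k \<omega>, \<omega>)))"
    by (simp cong: sets_pair_measure_cong)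
next
  fix A B assume A: "A \<in> sets \<mu>" and B: "B \<in> sets (pastM k)"
  have B': "B \<subseteq> space M" "B \<in> sets (past k)" using B sets.sets_into_space[of B "past k"] by auto
  have "emeasure \<mu> A = emeasure M (\<epsilon> k -` A \<inter> space M)"
    using A by (subst law[symmetric, of k]) (simp add: emeasure_distr)
  moreover have "emeasure (pastM k) B = emeasure M B"
    using B' by (simp add: pastM_def emeasure_distr Int_absorb2)
  moreover have "emeasure (distr M (borel \<Otimes>\<^sub>M past k) (\<lambda>\<omega>. (\<epsilon> k \<omega>, \<omega>))) (A \<times> B)
      = emeasure M ((\<lambda>\<omega>. (\<epsilon> k \<omega>, \<omega>)) -` (A \<times> B) \<inter> space M)"
    using A B' by (intro emeasure_distr) auto
  moreover have "(\<lambda>\<omega>. (\<epsilon> k \<omega>, \<omega>)) -` (A \<times> B) \<inter> space M = (\<epsilon> k -` A \<inter> space M) \<inter> B" using B' by auto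
  moreover have "prob ((\<epsilon> k -` A \<inter> space M) \<inter> B) = prob (\<epsilon> k -` A \<inter> space M) * prob B"
    using A B' by (intro indep_setD[OF indep_innovation_past[of k]]) auto
  ultimately show "emeasure \<mu> A * emeasure (pastM k) B = emeasure (distr M (borel \<Otimes>\<^sub>M past k) (\<lambda>\<omega>. (\<epsilon> k \<omega>, \<omega>))) (A \<times> B)"
    by (simp add: emeasure_eq_measure ennreal_mult)
qed

text \<open>This replaces conditional expectations given the past: the current innovation may be integrated
  out separately.\<close>

lemma nn_integral_decouple:
  assumes [measurable]: "\<phi> \<in> borel_measurable (borel \<Otimes>\<^sub>M past k)"
  shows "(\<integral>\<^sup>+\<omega>. \<phi> (\<epsilon> k \<omega>, \<omega>) \<partial>M) = (\<integral>\<^sup>+\<omega>. \<integral>\<^sup>+e. \<phi> (e, \<omega>) \<partial>\<mu> \<partial>M)"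
proof -
  interpret P: prob_space "pastM k" by (rule prob_space_pastM)
  interpret pair_sigma_finite \<mu> "pastM k" ..
  have m: "\<phi> \<in> borel_measurable (\<mu> \<Otimes>\<^sub>M pastM k)" by measurable
  have "(\<integral>\<^sup>+\<omega>. \<phi> (\<epsilon> k \<omega>, \<omega>) \<partial>M) = integral\<^sup>N (distr M (borel \<Otimes>\<^sub>M past k) (\<lambda>\<omega>. (\<epsilon> k \<omega>, \<omega>))) \<phi>"
    by (subst nn_integral_distr) (auto intro: measurable_joint)
  also have "\<dots> = (\<integral>\<^sup>+\<omega>. \<integral>\<^sup>+e. \<phi> (e, \<omega>) \<partial>\<mu> \<partial>pastM k)"
    unfolding joint_law by (rule nn_integral_snd[OF m, symmetric])
  also have "\<dots> = (\<integral>\<^sup>+\<omega>. \<integral>\<^sup>+e. \<phi> (e, \<omega>) \<partial>\<mu> \<partial>M)"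
    unfolding pastM_def by (rule nn_integral_distr) measurable
  finally show ?thesis .
qed

lemma integral_decouple:
  fixes \<phi> :: "real \<times> 'w \<Rightarrow> real"
  assumes [measurable]: "\<phi> \<in> borel_measurable (borel \<Otimes>\<^sub>M past k)"
    and bdd: "\<And>e \<omega>. \<omega> \<in> space M \<Longrightarrow> \<bar>\<phi> (e, \<omega>)\<bar> \<le> c"
  shows "(\<integral>\<omega>. \<phi> (\<epsilon> k \<omega>, \<omega>) \<partial>M) = (\<integral>\<omega>. \<integral>e. \<phi> (e, \<omega>) \<partial>\<mu> \<partial>M)"
proof -
  interpret P: prob_space "pastM k" by (rule prob_space_pastM)
  interpret pair_sigma_finite \<mu> "pastM k" ..
  interpret PP: prob_space "\<mu> \<Otimes>\<^sub>M pastM k"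
    by (rule prob_space_pair) (auto intro: law.prob_space_axioms P.prob_space_axioms)
  have sp: "space (pastM k) = space M" by (simp add: pastM_def)
  have int: "integrable (\<mu> \<Otimes>\<^sub>M pastM k) (\<lambda>(e, \<omega>). \<phi> (e, \<omega>))"
    by (rule PP.integrable_const_bound[where B=c]) (auto simp: space_pair_measure sp bdd)
  have "(\<integral>\<omega>. \<phi> (\<epsilon> k \<omega>, \<omega>) \<partial>M) = integral\<^sup>L (distr M (borel \<Otimes>\<^sub>M past k) (\<lambda>\<omega>. (\<epsilon> k \<omega>, \<omega>))) \<phi>"
    by (subst integral_distr) (auto intro: measurable_joint)
  also have "\<dots> = (\<integral>\<omega>. \<integral>e. \<phi> (e, \<omega>) \<partial>\<mu> \<partial>pastM k)"
    unfolding joint_law using integral_snd[OF int] by simp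
  also have "\<dots> = (\<integral>\<omega>. \<integral>e. \<phi> (e, \<omega>) \<partial>\<mu> \<partial>M)"
    unfolding pastM_def by (rule integral_distr) measurable
  finally show ?thesis .
qed

text \<open>The bound \<open>b\<close> only limits the range of \<open>t\<close>; the exponent
  contains the variance bound \<open>v\<close>. Small variances therefore give small deviations,
  which the oscillation estimate exploits.\<close>

lemma mgf_le:
  fixes X :: "real \<Rightarrow> real"
  assumes [measurable]: "X \<in> borel_measurable borel" and b: "\<And>e. \<bar>X e\<bar> \<le> b"
    and 0: "(\<integral>e. X e \<partial>\<mu>) = 0" and v: "(\<integral>e. (X e)\<^sup>2 \<partial>\<mu>) \<le> v" and t: "0 \<le> t" "t * b \<le> 1"
  shows "(\<integral>\<^sup>+e. ennreal (exp (t * X e)) \<partial>\<mu>) \<le> ennreal (exp (t\<^sup>2 * v))"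
proof -
  have I1: "integrable \<mu> X" by (rule law.integrable_const_bound[where B=b]) (auto simp: b)
  have I2: "integrable \<mu> (\<lambda>e. (X e)\<^sup>2)"
    by (rule law.integrable_const_bound[where B="b\<^sup>2"]) (auto intro!: AE_I2, metis abs_ge_zero b power2_abs power_mono)
  have tX: "t * X e \<le> 1" for e
    using mult_left_mono[OF b[of e] t(1)] t(2) abs_ge_self[of "t * X e"] t(1) by (simp add: abs_mult)
  have nn: "0 \<le> 1 + t * X e + (t * X e)\<^sup>2" for e
    by (rule order_trans[OF _ exp_le_quadratic[OF tX]]) simp
  have "(\<integral>\<^sup>+e. ennreal (exp (t * X e)) \<partial>\<mu>) \<le> (\<integral>\<^sup>+e. ennreal (1 + t * X e + (t * X e)\<^sup>2) \<partial>\<mu>)"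
    using exp_le_quadratic[OF tX] by (intro nn_integral_mono ennreal_leI)
  also have "\<dots> = ennreal (\<integral>e. 1 + t * X e + (t * X e)\<^sup>2 \<partial>\<mu>)"
    using I1 I2 nn by (intro nn_integral_eq_integral) (auto simp: power_mult_distrib)
  also have "(\<integral>e. 1 + t * X e + (t * X e)\<^sup>2 \<partial>\<mu>) = 1 + t\<^sup>2 * (\<integral>e. (X e)\<^sup>2 \<partial>\<mu>)"
    using I1 I2 0 law.prob_space by (simp add: power_mult_distrib)
  also have "\<dots> \<le> 1 + t\<^sup>2 * v" using v by (simp add: mult_left_mono)
  also have "\<dots> \<le> exp (t\<^sup>2 * v)" by (rule exp_ge_add_one_self)
  finally show ?thesis by (simp add: ennreal_leI)
qed

lemma measurable_section:
  "(\<lambda>(e, \<omega>). h e \<omega>) \<in> borel_measurable (borel \<Otimes>\<^sub>M past k) \<Longrightarrow> \<omega> \<in> space M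
    \<Longrightarrow> (\<lambda>e. h e \<omega>) \<in> borel_measurable borel"
  using measurable_compose[OF measurable_Pair2', of \<omega> "past k" "\<lambda>(e, \<omega>). h e \<omega>" borel borel]
  by simp

text \<open>The partial sums are frozen once they exceed \<open>l\<close>; the frozen sums have the same
  exponential moment bound, which turns the bound at time \<open>N\<close> into a maximal inequality.\<close>

lemma exponential_maximal_inequality:
  fixes h :: "nat \<Rightarrow> real \<Rightarrow> 'w \<Rightarrow> real"
  assumes meas: "\<And>s. (\<lambda>(e, \<omega>). h s e \<omega>) \<in> borel_measurable (borel \<Otimes>\<^sub>M past (k + int s))"
    and b: "\<And>s e \<omega>. \<omega> \<in> space M \<Longrightarrow> \<bar>h s e \<omega>\<bar> \<le> b"
    and centred: "\<And>s \<omega>. \<omega> \<in> space M \<Longrightarrow> (\<integral>e. h s e \<omega> \<partial>\<mu>) = 0"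
    and v: "\<And>s \<omega>. \<omega> \<in> space M \<Longrightarrow> (\<integral>e. (h s e \<omega>)\<^sup>2 \<partial>\<mu>) \<le> v"
    and t: "0 < t" "t * b \<le> 1"
  shows "prob {\<omega> \<in> space M. \<exists>n\<le>N. l \<le> (\<Sum>s<n. h s (\<epsilon> (k + int s) \<omega>) \<omega>)} \<le> exp (t\<^sup>2 * v * real N - t * l)"
proof -
  define S where "S n \<omega> = (\<Sum>s<n. h s (\<epsilon> (k + int s) \<omega>) \<omega>)" for n \<omega>
  define T where "T = rec_nat (\<lambda>\<omega>::'w. 0::real) (\<lambda>n Tn \<omega>. if Tn \<omega> \<ge> l then Tn \<omega> else Tn \<omega> + h n (\<epsilon> (k + int n) \<omega>) \<omega>)"
  have T0: "T 0 = (\<lambda>\<omega>. 0)" and TS: "T (Suc n) = (\<lambda>\<omega>. if T n \<omega> \<ge> l then T n \<omega> else T n \<omega> + h n (\<epsilon> (k + int n) \<omega>) \<omega>)" for n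
    unfolding T_def by simp_all
  have hm: "(\<lambda>\<omega>. h s (\<epsilon> (k + int s) \<omega>) \<omega>) \<in> borel_measurable (past (k + int (Suc s)))" for s
  proof -
    have id: "(\<lambda>\<omega>. \<omega>) \<in> measurable (past (k + int (Suc s))) (past (k + int s))"
      by (rule measurable_past_mono[where k="k + int s"]) auto
    have "(\<lambda>\<omega>. (\<epsilon> (k + int s) \<omega>, \<omega>)) \<in> measurable (past (k + int (Suc s))) (borel \<Otimes>\<^sub>M past (k + int s))"
      using id by (intro measurable_Pair measurable_innovation_past) auto
    from measurable_compose[OF this meas[of s]] show ?thesis by simp
  qed
  have Tm: "T n \<in> borel_measurable (past (k + int n))" for n
  proof (induction n)
    case (Suc n)
    have [measurable]: "T n \<in> borel_measurable (past (k + int (Suc n)))"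
      by (rule measurable_past_mono[OF _ Suc]) simp
    note hm[measurable]
    show ?case unfolding TS by measurable
  qed (simp add: T0)
  have Sm [measurable]: "S n \<in> borel_measurable M" for n
    unfolding S_def using measurable_past_imp[OF hm] by (intro borel_measurable_sum)
  \<comment> \<open>Both claims share one induction, as \<open>sub\<close> at the first passage
    needs \<open>eq\<close> just before it.\<close>
  have sub: "(\<exists>m\<le>n. l \<le> S m \<omega>) \<Longrightarrow> l \<le> T n \<omega>" and eq: "\<not> (\<exists>m\<le>n. l \<le> S m \<omega>) \<Longrightarrow> T n \<omega> = S n \<omega>" for n \<omega>
  proof (induction n)
    case 0
    { case 1 then show ?case by (simp add: S_def T0) }
    { case 2 then show ?case by (simp add: S_def T0) }
  next
    case (Suc n)
    { case 1
      show ?case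
      proof (cases "\<exists>m\<le>n. l \<le> S m \<omega>")
        case True then show ?thesis using Suc by (simp add: TS)
      next
        case False
        then have "l \<le> S (Suc n) \<omega>" using 1 le_Suc_eq by auto
        moreover have "T n \<omega> = S n \<omega>" "\<not> l \<le> S n \<omega>" using False Suc by auto
        ultimately show ?thesis by (simp add: TS S_def)
      qed }
    { case 2
      then have "T n \<omega> = S n \<omega>" "\<not> l \<le> S n \<omega>" using Suc by (auto simp: le_Suc_eq)
      then show ?case by (simp add: TS S_def) }
  qed
  have v0: "0 \<le> v"
  proof -
    obtain \<omega> where "\<omega> \<in> space M" using not_empty by auto
    have "0 \<le> (\<integral>e. (h 0 e \<omega>)\<^sup>2 \<partial>\<mu>)" by simp
    also have "\<dots> \<le> v" by (rule v) fact
    finally show ?thesis .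
  qed
  have bnd: "(\<integral>\<^sup>+\<omega>. ennreal (exp (t * T n \<omega>)) \<partial>M) \<le> ennreal (exp (t\<^sup>2 * v * real n))" for n
  proof (induction n)
    case 0 then show ?case by (simp add: T0 emeasure_space_1)
  next
    case (Suc n)
    let ?\<phi> = "\<lambda>(e, \<omega>). ennreal (exp (t * (if T n \<omega> \<ge> l then T n \<omega> else T n \<omega> + h n e \<omega>)))"
    have [measurable]: "T n \<in> borel_measurable (past (k + int n))" by (rule Tm)
    have [measurable]: "(\<lambda>x. h n (fst x) (snd x)) \<in> borel_measurable (borel \<Otimes>\<^sub>M past (k + int n))"
      using meas[of n] by (simp add: case_prod_beta')
    have \<phi>: "?\<phi> \<in> borel_measurable (borel \<Otimes>\<^sub>M past (k + int n))"
      unfolding case_prod_beta' by measurable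
    have inner: "(\<integral>\<^sup>+e. ?\<phi> (e, \<omega>) \<partial>\<mu>) \<le> ennreal (exp (t\<^sup>2 * v)) * ennreal (exp (t * T n \<omega>))" if \<omega>: "\<omega> \<in> space M" for \<omega>
    proof (cases "T n \<omega> \<ge> l")
      case True
      \<comment> \<open>A frozen sum does not move; its factor 1 is enlarged to
        \<open>exp (t\<^sup>2 * v)\<close>, by \<open>v \<ge> 0\<close>.\<close>
      have "1 * ennreal (exp (t * T n \<omega>)) \<le> ennreal (exp (t\<^sup>2 * v)) * ennreal (exp (t * T n \<omega>))"
        using v0 by (intro mult_right_mono) (auto simp flip: ennreal_1 intro!: ennreal_leI)
      then show ?thesis using True law.emeasure_space_1 by simp
    next
      case False
      have [measurable]: "(\<lambda>e. h n e \<omega>) \<in> borel_measurable borel"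
        using measurable_section[OF meas \<omega>] .
      have "(\<integral>\<^sup>+e. ?\<phi> (e, \<omega>) \<partial>\<mu>) = (\<integral>\<^sup>+e. ennreal (exp (t * h n e \<omega>)) * ennreal (exp (t * T n \<omega>)) \<partial>\<mu>)"
        using False by (simp add: distrib_left exp_add ennreal_mult mult.commute)
      also have "\<dots> = (\<integral>\<^sup>+e. ennreal (exp (t * h n e \<omega>)) \<partial>\<mu>) * ennreal (exp (t * T n \<omega>))"
        by (rule nn_integral_multc) measurable
      also have "\<dots> \<le> ennreal (exp (t\<^sup>2 * v)) * ennreal (exp (t * T n \<omega>))"
        by (intro mult_right_mono mgf_le[where b=b] b centred v) (use \<omega> t in auto)
      finally show ?thesis .
    qed
    have "(\<integral>\<^sup>+\<omega>. ennreal (exp (t * T (Suc n) \<omega>)) \<partial>M) = (\<integral>\<^sup>+\<omega>. ?\<phi> (\<epsilon> (k + int n) \<omega>, \<omega>) \<partial>M)"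
      by (simp add: TS)
    also have "\<dots> = (\<integral>\<^sup>+\<omega>. \<integral>\<^sup>+e. ?\<phi> (e, \<omega>) \<partial>\<mu> \<partial>M)" by (rule nn_integral_decouple[OF \<phi>])
    also have "\<dots> \<le> (\<integral>\<^sup>+\<omega>. ennreal (exp (t\<^sup>2 * v)) * ennreal (exp (t * T n \<omega>)) \<partial>M)"
      by (intro nn_integral_mono inner)
    also have "\<dots> = ennreal (exp (t\<^sup>2 * v)) * (\<integral>\<^sup>+\<omega>. ennreal (exp (t * T n \<omega>)) \<partial>M)"
      using measurable_past_imp[OF Tm[of n]] by (intro nn_integral_cmult) measurable
    also have "\<dots> \<le> ennreal (exp (t\<^sup>2 * v)) * ennreal (exp (t\<^sup>2 * v * real n))"
      by (intro mult_left_mono Suc) simp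
    also have "\<dots> = ennreal (exp (t\<^sup>2 * v * real (Suc n)))"
      by (simp add: ennreal_mult[symmetric] exp_add[symmetric] algebra_simps)
    finally show ?case .
  qed
  have [measurable]: "T N \<in> borel_measurable M" by (rule measurable_past_imp[OF Tm])
  have "emeasure M {\<omega> \<in> space M. \<exists>n\<le>N. l \<le> S n \<omega>} \<le> emeasure M {\<omega> \<in> space M. 1 \<le> ennreal (exp (- t * l)) * ennreal (exp (t * T N \<omega>))}"
  proof (rule emeasure_mono)
    show "{\<omega> \<in> space M. \<exists>n\<le>N. l \<le> S n \<omega>} \<subseteq> {\<omega> \<in> space M. 1 \<le> ennreal (exp (- t * l)) * ennreal (exp (t * T N \<omega>))}"
    proof safe
      fix \<omega> n assume "\<omega> \<in> space M" "n \<le> N" "l \<le> S n \<omega>"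
      then have "l \<le> T N \<omega>" using sub by blast
      then have "1 \<le> exp (- t * l + t * T N \<omega>)" using t by simp
      then show "1 \<le> ennreal (exp (- t * l)) * ennreal (exp (t * T N \<omega>))"
        by (simp add: ennreal_mult[symmetric] exp_add[symmetric])
    qed
  qed measurable
  also have "\<dots> \<le> ennreal (exp (- t * l)) * (\<integral>\<^sup>+\<omega>. ennreal (exp (t * T N \<omega>)) * indicator (space M) \<omega> \<partial>M)"
    by (intro nn_integral_Markov_inequality) measurable
  also have "\<dots> \<le> ennreal (exp (- t * l)) * ennreal (exp (t\<^sup>2 * v * real N))"
  proof (rule mult_left_mono)
    have "(\<integral>\<^sup>+\<omega>. ennreal (exp (t * T N \<omega>)) * indicator (space M) \<omega> \<partial>M) = (\<integral>\<^sup>+\<omega>. ennreal (exp (t * T N \<omega>)) \<partial>M)"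
      by (intro nn_integral_cong) auto
    then show "(\<integral>\<^sup>+\<omega>. ennreal (exp (t * T N \<omega>)) * indicator (space M) \<omega> \<partial>M) \<le> ennreal (exp (t\<^sup>2 * v * real N))"
      using bnd by simp
  qed simp
  also have "\<dots> = ennreal (exp (t\<^sup>2 * v * real N - t * l))"
    by (simp add: ennreal_mult[symmetric] exp_add[symmetric])
  finally show ?thesis unfolding S_def by (simp add: emeasure_eq_measure)
qed

end

text \<open>A substitute for Young's inequality. It converts the power \<open>q - 2\<close>, which
  multiplies conditional variances in \<open>powr_add_le\<close>, into the power \<open>q\<close>
  plus a constant, so that the recursion for q-th moments becomes linear.\<close>

lemma powr_interpolation:
  fixes x b q :: real
  assumes "q \<ge> 2" "b > 0"
  shows "\<bar>x\<bar> powr (q - 2) \<le> \<bar>x\<bar> powr q / b\<^sup>2 + b powr (q - 2)"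
proof (cases "\<bar>x\<bar> \<le> b")
  case True
  then have "\<bar>x\<bar> powr (q - 2) \<le> b powr (q - 2)" using assms by (intro powr_mono2) auto
  then show ?thesis by (simp add: add_increasing)
next
  case False
  then have x: "\<bar>x\<bar> > 0" using assms by linarith
  have "\<bar>x\<bar> powr (q - 2) = \<bar>x\<bar> powr q / \<bar>x\<bar>\<^sup>2"
    using x by (simp add: powr_diff)
  also have "\<dots> \<le> \<bar>x\<bar> powr q / b\<^sup>2"
    using False assms by (intro divide_left_mono power_mono) auto
  finally show ?thesis by (simp add: add_increasing2)
qed

context innovations
begin

lemma measurable_innovation_compose:
  assumes "(\<lambda>(e, \<omega>). h e \<omega>) \<in> borel_measurable (borel \<Otimes>\<^sub>M past k)"
  shows "(\<lambda>\<omega>. h (\<epsilon> k \<omega>) \<omega>) \<in> borel_measurable (past (k + 1))"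
proof -
  have id: "(\<lambda>\<omega>. \<omega>) \<in> measurable (past (k + 1)) (past k)"
    by (rule measurable_past_mono[where k=k]) auto
  have "(\<lambda>\<omega>. (\<epsilon> k \<omega>, \<omega>)) \<in> measurable (past (k + 1)) (borel \<Otimes>\<^sub>M past k)"
    using id by (intro measurable_Pair measurable_innovation_past) auto
  from measurable_compose[OF this assms] show ?thesis by simp
qed

lemma exponential_maximal_inequality_abs:
  fixes h :: "nat \<Rightarrow> real \<Rightarrow> 'w \<Rightarrow> real"
  assumes meas: "\<And>s. (\<lambda>(e, \<omega>). h s e \<omega>) \<in> borel_measurable (borel \<Otimes>\<^sub>M past (k + int s))"
    and b: "\<And>s e \<omega>. \<omega> \<in> space M \<Longrightarrow> \<bar>h s e \<omega>\<bar> \<le> b"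
    and centred: "\<And>s \<omega>. \<omega> \<in> space M \<Longrightarrow> (\<integral>e. h s e \<omega> \<partial>\<mu>) = 0"
    and v: "\<And>s \<omega>. \<omega> \<in> space M \<Longrightarrow> (\<integral>e. (h s e \<omega>)\<^sup>2 \<partial>\<mu>) \<le> v"
    and t: "0 < t" "t * b \<le> 1"
  shows "prob {\<omega> \<in> space M. \<exists>n\<le>N. l \<le> \<bar>\<Sum>s<n. h s (\<epsilon> (k + int s) \<omega>) \<omega>\<bar>} \<le> 2 * exp (t\<^sup>2 * v * real N - t * l)"
proof -
  let ?E = "\<lambda>\<sigma>. {\<omega> \<in> space M. \<exists>n\<le>N. l \<le> (\<Sum>s<n. \<sigma> * h s (\<epsilon> (k + int s) \<omega>) \<omega>)}"
  have [measurable]: "(\<lambda>\<omega>. h s (\<epsilon> (k + int s) \<omega>) \<omega>) \<in> borel_measurable M" for s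
    by (rule measurable_past_imp[OF measurable_innovation_compose[OF meas]])
  have one: "prob (?E \<sigma>) \<le> exp (t\<^sup>2 * v * real N - t * l)" if \<sigma>: "\<bar>\<sigma>\<bar> = 1" for \<sigma> :: real
  proof (rule exponential_maximal_inequality[where h="\<lambda>s e \<omega>. \<sigma> * h s e \<omega>", OF _ _ _ _ t])
    show "(\<lambda>(e, \<omega>). \<sigma> * h s e \<omega>) \<in> borel_measurable (borel \<Otimes>\<^sub>M past (k + int s))" for s
      using borel_measurable_times[OF borel_measurable_const meas] by (simp add: case_prod_beta')
    fix s \<omega> e assume \<omega>: "\<omega> \<in> space M"
    show "\<bar>\<sigma> * h s e \<omega>\<bar> \<le> b" using b[OF \<omega>] \<sigma> by (simp add: abs_mult)
    show "(\<integral>e. \<sigma> * h s e \<omega> \<partial>\<mu>) = 0" using \<omega> by (simp add: centred)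
    have "\<sigma>\<^sup>2 = 1" using \<sigma> by (simp add: abs_square_eq_1)
    then show "(\<integral>e. (\<sigma> * h s e \<omega>)\<^sup>2 \<partial>\<mu>) \<le> v"
      using v[OF \<omega>] by (simp add: power_mult_distrib)
  qed
  have "{\<omega> \<in> space M. \<exists>n\<le>N. l \<le> \<bar>\<Sum>s<n. h s (\<epsilon> (k + int s) \<omega>) \<omega>\<bar>} \<subseteq> ?E 1 \<union> ?E (-1)"
    by (auto simp: abs_if sum_negf split: if_splits)
  then have "prob {\<omega> \<in> space M. \<exists>n\<le>N. l \<le> \<bar>\<Sum>s<n. h s (\<epsilon> (k + int s) \<omega>) \<omega>\<bar>} \<le> prob (?E 1 \<union> ?E (-1))"
    by (rule finite_measure_mono) measurable
  moreover have "prob (?E 1 \<union> ?E (-1)) \<le> prob (?E 1) + prob (?E (-1))"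
    by (rule measure_Un_le) measurable
  ultimately show ?thesis using one[of 1] one[of "-1"] by linarith
qed

text \<open>A discrete Gronwall argument in the role of Burkholder's inequality. The envelope
  \<open>\<theta> * \<eta> e\<close> involves the current innovation only, so the conditional
  moments of the increments have constant bounds; \<open>b\<close> secures integrability and does
  not enter the estimate.\<close>

lemma moment_inequality:
  fixes h :: "nat \<Rightarrow> real \<Rightarrow> 'w \<Rightarrow> real" and q \<theta> b :: real
  assumes q: "q \<ge> 2"
    and \<eta> [measurable]: "\<eta> \<in> borel_measurable borel" and \<eta>2: "integrable \<mu> (\<lambda>e. (\<eta> e)\<^sup>2)"
    and \<eta>q: "integrable \<mu> (\<lambda>e. \<bar>\<eta> e\<bar> powr q)"
    and meas: "\<And>s. (\<lambda>(e, \<omega>). h s e \<omega>) \<in> borel_measurable (borel \<Otimes>\<^sub>M past (k + int s))"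
    and b: "\<And>s e \<omega>. \<omega> \<in> space M \<Longrightarrow> \<bar>h s e \<omega>\<bar> \<le> b"
    and centred: "\<And>s \<omega>. \<omega> \<in> space M \<Longrightarrow> (\<integral>e. h s e \<omega> \<partial>\<mu>) = 0"
    and dom: "\<And>s e \<omega>. \<omega> \<in> space M \<Longrightarrow> \<bar>h s e \<omega>\<bar> \<le> \<theta> * \<eta> e"
    and \<theta>: "0 \<le> \<theta>"
  shows "(\<integral>\<omega>. \<bar>\<Sum>s<N. h s (\<epsilon> (k + int s) \<omega>) \<omega>\<bar> powr q \<partial>M)
    \<le> exp (((q + 1) powr q + q\<^sup>2) * ((\<integral>e. (\<eta> e)\<^sup>2 \<partial>\<mu>) + (\<integral>e. \<bar>\<eta> e\<bar> powr q \<partial>\<mu>))) * real N powr (q / 2) * \<theta> powr q"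
proof (cases "\<theta> = 0 \<or> N = 0")
  case True
  have "(\<integral>\<omega>. \<bar>\<Sum>s<N. h s (\<epsilon> (k + int s) \<omega>) \<omega>\<bar> powr q \<partial>M) = (\<integral>\<omega>. 0 \<partial>M)"
  proof (rule Bochner_Integration.integral_cong)
    fix \<omega> assume "\<omega> \<in> space M"
    then have "h s e \<omega> = 0" if "\<theta> = 0" for s e using dom[of \<omega> s e] that by simp
    then show "\<bar>\<Sum>s<N. h s (\<epsilon> (k + int s) \<omega>) \<omega>\<bar> powr q = 0" using True by auto
  qed simp
  then show ?thesis by simp
next
  case False
  then have \<theta>0: "\<theta> > 0" and N: "N > 0" using \<theta> by auto
  let ?C = "(q + 1) powr q + q\<^sup>2"
  let ?m2 = "\<integral>e. (\<eta> e)\<^sup>2 \<partial>\<mu>" and ?mq = "\<integral>e. \<bar>\<eta> e\<bar> powr q \<partial>\<mu>"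
  define c where "c = ?C * (?m2 + ?mq)"
  \<comment> \<open>The size to be expected at the horizon \<open>N\<close>. Adding it to
    \<open>u n\<close> makes the recursion multiplicative with factor \<open>1 + c / N\<close>,
    hence total growth at most \<open>exp c\<close>.\<close>
  define A where "A = real N powr (q / 2) * \<theta> powr q"
  define S where "S n \<omega> = (\<Sum>s<n. h s (\<epsilon> (k + int s) \<omega>) \<omega>)" for n \<omega>
  define u where "u n = (\<integral>\<omega>. \<bar>S n \<omega>\<bar> powr q \<partial>M)" for n
  have C0: "?C \<ge> 0" by simp
  have m2: "?m2 \<ge> 0" by simp
  have mq: "?mq \<ge> 0" by simp
  have c0: "c \<ge> 0" unfolding c_def using C0 m2 mq by simp
  have Sm: "S n \<in> borel_measurable (past (k + int n))" for n
    unfolding S_def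
  proof (rule borel_measurable_sum)
    fix s assume "s \<in> {..<n}"
    then show "(\<lambda>\<omega>. h s (\<epsilon> (k + int s) \<omega>) \<omega>) \<in> borel_measurable (past (k + int n))"
      by (intro measurable_past_mono[OF _ measurable_innovation_compose[OF meas]]) auto
  qed
  have Sm' [measurable]: "S n \<in> borel_measurable M" for n by (rule measurable_past_imp[OF Sm])
  have Sb: "\<bar>S n \<omega>\<bar> \<le> real n * b" if "\<omega> \<in> space M" for n \<omega>
  proof -
    have "\<bar>S n \<omega>\<bar> \<le> (\<Sum>s<n. \<bar>h s (\<epsilon> (k + int s) \<omega>) \<omega>\<bar>)" unfolding S_def by (rule sum_abs)
    also have "\<dots> \<le> (\<Sum>s<n. b)" using b that by (intro sum_mono) auto
    finally show ?thesis by simp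
  qed
  have Sint: "integrable M (\<lambda>\<omega>. \<bar>S n \<omega>\<bar> powr q)" for n
  proof (rule integrable_const_bound[where B="(real n * b) powr q"])
    show "AE \<omega> in M. norm (\<bar>S n \<omega>\<bar> powr q) \<le> (real n * b) powr q"
      using Sb q by (intro AE_I2) (auto intro!: powr_mono2)
  qed measurable
  have pN: "real N powr (q/2 - 1) \<ge> 1" using N q by (intro ge_one_powr_ge_zero) auto
  have pN': "real N powr (q/2 - 1) = real N powr (q/2) / real N" using N by (simp add: powr_diff)
  have step: "u (Suc n) + A \<le> (u n + A) * (1 + c / real N)" for n
  proof -
    let ?\<phi> = "\<lambda>(e, \<omega>). \<bar>S n \<omega> + h n e \<omega>\<bar> powr q"
    have [measurable]: "S n \<in> borel_measurable (past (k + int n))" by (rule Sm)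
    have [measurable]: "(\<lambda>x. h n (fst x) (snd x)) \<in> borel_measurable (borel \<Otimes>\<^sub>M past (k + int n))"
      using meas[of n] by (simp add: case_prod_beta')
    have \<phi>: "?\<phi> \<in> borel_measurable (borel \<Otimes>\<^sub>M past (k + int n))"
      unfolding case_prod_beta' by measurable
    have bnd: "\<bar>?\<phi> (e, \<omega>)\<bar> \<le> (real (Suc n) * b) powr q" if "\<omega> \<in> space M" for e \<omega>
    proof -
      have "\<bar>S n \<omega> + h n e \<omega>\<bar> \<le> real (Suc n) * b"
        using Sb[OF that, of n] b[OF that, of n e] by (simp add: distrib_right)
      then show ?thesis using q by (auto intro!: powr_mono2)
    qed
    have inner: "(\<integral>e. ?\<phi> (e, \<omega>) \<partial>\<mu>) \<le> \<bar>S n \<omega>\<bar> powr q * (1 + c / real N) + A * (c / real N)"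
      if \<omega>: "\<omega> \<in> space M" for \<omega>
    proof -
      have [measurable]: "(\<lambda>e. h n e \<omega>) \<in> borel_measurable borel"
        using measurable_section[OF meas \<omega>] .
      have I1: "integrable \<mu> (\<lambda>e. h n e \<omega>)"
        by (rule law.integrable_const_bound[where B=b]) (auto simp: b \<omega>)
      have I2: "integrable \<mu> (\<lambda>e. (h n e \<omega>)\<^sup>2)"
        by (rule law.integrable_const_bound[where B="b\<^sup>2"])
          (auto intro!: AE_I2, metis \<omega> abs_ge_zero b power2_abs power_mono)
      have Iq: "integrable \<mu> (\<lambda>e. \<bar>h n e \<omega>\<bar> powr q)"
        by (rule law.integrable_const_bound[where B="b powr q"]) (use \<omega> b q in \<open>auto intro!: powr_mono2\<close>)
      have I\<phi>: "integrable \<mu> (\<lambda>e. ?\<phi> (e, \<omega>))"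
        by (rule law.integrable_const_bound[where B="(real (Suc n) * b) powr q"])
          (use bnd[OF \<omega>] in auto)
      have h2: "(\<integral>e. (h n e \<omega>)\<^sup>2 \<partial>\<mu>) \<le> \<theta>\<^sup>2 * ?m2"
      proof -
        have "(\<integral>e. (h n e \<omega>)\<^sup>2 \<partial>\<mu>) \<le> (\<integral>e. \<theta>\<^sup>2 * (\<eta> e)\<^sup>2 \<partial>\<mu>)"
        proof (rule integral_mono[OF I2])
          fix e
          have "\<bar>h n e \<omega>\<bar>\<^sup>2 \<le> (\<theta> * \<eta> e)\<^sup>2" by (intro power_mono dom \<omega>) simp
          then show "(h n e \<omega>)\<^sup>2 \<le> \<theta>\<^sup>2 * (\<eta> e)\<^sup>2" by (simp add: power_mult_distrib)
        qed (use \<eta>2 in simp)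
        then show ?thesis by simp
      qed
      have hq: "(\<integral>e. \<bar>h n e \<omega>\<bar> powr q \<partial>\<mu>) \<le> \<theta> powr q * ?mq"
      proof -
        have "(\<integral>e. \<bar>h n e \<omega>\<bar> powr q \<partial>\<mu>) \<le> (\<integral>e. \<theta> powr q * \<bar>\<eta> e\<bar> powr q \<partial>\<mu>)"
        proof (rule integral_mono[OF Iq])
          fix e
          have "\<bar>h n e \<omega>\<bar> \<le> \<theta> * \<bar>\<eta> e\<bar>"
            using dom[OF \<omega>, of n e] mult_left_mono[OF abs_ge_self \<theta>, of "\<eta> e"] by linarith
          then have "\<bar>h n e \<omega>\<bar> powr q \<le> (\<theta> * \<bar>\<eta> e\<bar>) powr q" using q by (intro powr_mono2) auto
          then show "\<bar>h n e \<omega>\<bar> powr q \<le> \<theta> powr q * \<bar>\<eta> e\<bar> powr q" using \<theta> by (simp add: powr_mult)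
        qed (use \<eta>q in simp)
        then show ?thesis by simp
      qed
      let ?s = "S n \<omega>"
      have "(\<integral>e. ?\<phi> (e, \<omega>) \<partial>\<mu>) \<le> (\<integral>e. \<bar>?s\<bar> powr q + q * sgn ?s * \<bar>?s\<bar> powr (q - 1) * h n e \<omega>
          + ?C * (\<bar>?s\<bar> powr (q - 2) * (h n e \<omega>)\<^sup>2 + \<bar>h n e \<omega>\<bar> powr q) \<partial>\<mu>)"
        using I1 I2 Iq by (intro integral_mono[OF I\<phi>]) (auto intro!: powr_add_le[OF q])
      also have "\<dots> = \<bar>?s\<bar> powr q + ?C * (\<bar>?s\<bar> powr (q - 2) * (\<integral>e. (h n e \<omega>)\<^sup>2 \<partial>\<mu>) + (\<integral>e. \<bar>h n e \<omega>\<bar> powr q \<partial>\<mu>))"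
        using I1 I2 Iq centred[OF \<omega>] law.prob_space by simp
      \<comment> \<open>The mixed term is split at \<open>\<theta> * sqrt N\<close>, the typical
        size of the sum: both parts then carry the factor \<open>1 / N\<close>, relative to the q-th
        power of the sum and to \<open>A\<close> respectively.\<close>
      also have "\<dots> \<le> \<bar>?s\<bar> powr q + ?C * ((\<bar>?s\<bar> powr q / (\<theta> * sqrt (real N))\<^sup>2 + (\<theta> * sqrt (real N)) powr (q - 2)) * (\<theta>\<^sup>2 * ?m2) + \<theta> powr q * ?mq)"
        using h2 hq C0 \<theta>0 N m2 by (intro add_left_mono mult_left_mono add_mono mult_mono powr_interpolation q) auto
      also have "(\<theta> * sqrt (real N))\<^sup>2 = \<theta>\<^sup>2 * real N" using N by (simp add: power_mult_distrib)
      also have "(\<theta> * sqrt (real N)) powr (q - 2) = \<theta> powr q / \<theta>\<^sup>2 * real N powr (q/2 - 1)"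
        using \<theta>0 N by (simp add: powr_mult powr_diff[of \<theta> q 2] powr_half_sqrt[symmetric] powr_powr diff_divide_distrib)
      also have "\<bar>?s\<bar> powr q + ?C * ((\<bar>?s\<bar> powr q / (\<theta>\<^sup>2 * real N) + \<theta> powr q / \<theta>\<^sup>2 * real N powr (q/2 - 1)) * (\<theta>\<^sup>2 * ?m2) + \<theta> powr q * ?mq)
          = \<bar>?s\<bar> powr q * (1 + ?C * ?m2 / real N) + ?C * (\<theta> powr q * real N powr (q/2 - 1) * ?m2 + \<theta> powr q * 1 * ?mq)"
        using \<theta>0 N by (simp add: field_simps)
      also have "\<dots> \<le> \<bar>?s\<bar> powr q * (1 + c / real N) + ?C * (\<theta> powr q * real N powr (q/2 - 1) * ?m2 + \<theta> powr q * real N powr (q/2 - 1) * ?mq)"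
        using C0 m2 mq pN N unfolding c_def
        by (intro add_mono mult_left_mono mult_right_mono divide_right_mono add_left_mono) auto
      also have "\<dots> = \<bar>?s\<bar> powr q * (1 + c / real N) + A * (c / real N)"
        unfolding A_def c_def pN' by (simp add: algebra_simps add_divide_distrib)
      finally show ?thesis .
    qed
    have "u (Suc n) = (\<integral>\<omega>. ?\<phi> (\<epsilon> (k + int n) \<omega>, \<omega>) \<partial>M)" by (simp add: u_def S_def)
    also have "\<dots> = (\<integral>\<omega>. \<integral>e. ?\<phi> (e, \<omega>) \<partial>\<mu> \<partial>M)"
      by (rule integral_decouple[OF \<phi> bnd])
    also have "\<dots> \<le> (\<integral>\<omega>. \<bar>S n \<omega>\<bar> powr q * (1 + c / real N) + A * (c / real N) \<partial>M)"
    proof (rule integral_mono')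
      show "\<And>\<omega>. \<omega> \<in> space M \<Longrightarrow> 0 \<le> \<bar>S n \<omega>\<bar> powr q * (1 + c / real N) + A * (c / real N)"
        using c0 by (auto simp: A_def intro!: add_nonneg_nonneg mult_nonneg_nonneg)
    qed (use Sint inner in auto)
    also have "\<dots> = u n * (1 + c / real N) + A * (c / real N)"
      using Sint prob_space by (simp add: u_def)
    finally show ?thesis by (simp add: algebra_simps add_divide_distrib)
  qed
  have ind: "u n + A \<le> A * (1 + c / real N) ^ n" for n
  proof (induction n)
    case 0 then show ?case by (simp add: u_def S_def)
  next
    case (Suc n)
    have "u (Suc n) + A \<le> (u n + A) * (1 + c / real N)" by (rule step)
    also have "\<dots> \<le> A * (1 + c / real N) ^ n * (1 + c / real N)"
      using c0 by (intro mult_right_mono Suc) auto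
    finally show ?case by (simp add: algebra_simps)
  qed
  have "u N \<le> u N + A" by (simp add: A_def)
  also have "\<dots> \<le> A * (1 + c / real N) ^ N" by (rule ind)
  also have "\<dots> \<le> A * exp c"
  proof (rule mult_left_mono)
    have "(1 + c / real N) ^ N \<le> exp (c / real N) ^ N"
      using c0 by (intro power_mono) (auto simp: exp_ge_add_one_self)
    also have "\<dots> = exp c" using N by (simp flip: exp_of_nat_mult)
    finally show "(1 + c / real N) ^ N \<le> exp c" .
  qed (simp add: A_def)
  finally show ?thesis by (simp add: u_def S_def A_def c_def mult_ac)
qed

end

section \<open>Lipschitz functionals of the past of a linear process\<close>

locale linear_process = innovations M \<epsilon> \<mu> for M :: "'w measure" and \<epsilon> \<mu> +
  fixes a :: "nat \<Rightarrow> real" and \<alpha> :: real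
  assumes AE_summable: "\<And>k. AE \<omega> in M. summable (\<lambda>i. a i * \<epsilon> (k - int i) \<omega>)"
    and moment: "integrable \<mu> (\<lambda>e. \<bar>e\<bar> powr \<alpha>)"
begin

text \<open>\<open>R i 0\<close> is the process itself; for \<open>a 0 = 1\<close>,
  \<open>R i 1\<close> is almost surely the process minus \<open>\<epsilon> i\<close>. Where the
  series diverges \<open>suminf\<close> is a default value, so the recursion in \<open>j\<close>
  holds almost surely.\<close>

definition R :: "int \<Rightarrow> nat \<Rightarrow> 'w \<Rightarrow> real" where
  "R i j \<omega> = (\<Sum>l. a (j + l) * \<epsilon> (i - int (j + l)) \<omega>)"

text \<open>Measurability holds on the whole space, since \<open>suminf\<close> of measurable
  functions is measurable even where the series diverges; adaptedness is thus exact.\<close>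

lemma measurable_R_past: "i - int j < k \<Longrightarrow> R i j \<in> borel_measurable (past k)"
  unfolding R_def
  by (intro borel_measurable_suminf borel_measurable_times borel_measurable_const measurable_innovation_past) auto

lemma measurable_R [measurable]: "R i j \<in> borel_measurable M"
  by (rule measurable_past_imp[OF measurable_R_past[of i j "i + 1"]]) simp

lemma AE_R_Suc: "AE \<omega> in M. \<forall>i j. R i j \<omega> = a j * \<epsilon> (i - int j) \<omega> + R i (Suc j) \<omega>"
proof -
  have "AE \<omega> in M. \<forall>i. summable (\<lambda>l. a l * \<epsilon> (i - int l) \<omega>)"
    unfolding AE_all_countable using AE_summable by blast
  then show ?thesis
  proof (eventually_elim, intro allI)
    fix \<omega> i j assume s: "\<forall>i. summable (\<lambda>l. a l * \<epsilon> (i - int l) \<omega>)"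
    have "summable (\<lambda>l. a (l + j) * \<epsilon> (i - int (l + j)) \<omega>)"
      using s by (subst summable_iff_shift[of "\<lambda>l. a l * \<epsilon> (i - int l) \<omega>" j]) blast
    from suminf_split_head[OF this] show "R i j \<omega> = a j * \<epsilon> (i - int j) \<omega> + R i (Suc j) \<omega>"
      by (simp add: R_def add.commute)
  qed
qed

lemma AE_R_tendsto_0: "AE \<omega> in M. \<forall>i. (\<lambda>j. R i j \<omega>) \<longlonglongrightarrow> 0"
proof -
  have "AE \<omega> in M. \<forall>i. summable (\<lambda>l. a l * \<epsilon> (i - int l) \<omega>)"
    unfolding AE_all_countable using AE_summable by blast
  then show ?thesis
  proof (eventually_elim, intro allI)
    fix \<omega> i assume s: "\<forall>i. summable (\<lambda>l. a l * \<epsilon> (i - int l) \<omega>)"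
    let ?f = "\<lambda>l. a l * \<epsilon> (i - int l) \<omega>"
    have "(\<lambda>j. suminf ?f - (\<Sum>l<j. ?f l)) \<longlonglongrightarrow> suminf ?f - suminf ?f"
      using s by (intro tendsto_diff tendsto_const summable_LIMSEQ) blast
    moreover have "R i j \<omega> = suminf ?f - (\<Sum>l<j. ?f l)" for j
      using suminf_split_initial_segment[of ?f j] s by (simp add: R_def add.commute)
    ultimately show "(\<lambda>j. R i j \<omega>) \<longlonglongrightarrow> 0" by simp
  qed
qed

lemma integrable_abs_powr:
  assumes "0 < s" "s \<le> \<alpha>"
  shows "integrable \<mu> (\<lambda>e. \<bar>e\<bar> powr s)"
proof (rule Bochner_Integration.integrable_bound)
  show "integrable \<mu> (\<lambda>e. 1 + \<bar>e\<bar> powr \<alpha>)" using moment by simp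
  show "AE e in \<mu>. norm (\<bar>e\<bar> powr s) \<le> norm (1 + \<bar>e\<bar> powr \<alpha>)"
  proof (rule AE_I2)
    fix e :: real
    show "norm (\<bar>e\<bar> powr s) \<le> norm (1 + \<bar>e\<bar> powr \<alpha>)"
    proof (cases "\<bar>e\<bar> \<le> 1")
      case True then show ?thesis using powr_mono2[of s "\<bar>e\<bar>" 1] assms by (simp add: add_increasing2)
    next
      case False then have "\<bar>e\<bar> powr s \<le> \<bar>e\<bar> powr \<alpha>" using assms by (intro powr_mono) auto
      then show ?thesis by simp
    qed
  qed
qed measurable

end

text \<open>With \<open>\<beta> \<le> 1\<close>, boundedness and the Lipschitz property merge into a
  Hoelder bound of exponent \<open>\<beta>\<close>; with \<open>\<beta> * q \<le> \<alpha>\<close>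
  the q-th power of that bound is integrable even if the innovations have no mean.\<close>

locale lipschitz_functional = linear_process M \<epsilon> \<mu> a \<alpha> for M :: "'w measure" and \<epsilon> \<mu> a \<alpha> +
  fixes g :: "real \<Rightarrow> real" and K L q \<beta> :: real
  assumes g_bound: "\<And>x. \<bar>g x\<bar> \<le> K" and g_lip: "\<And>x y. \<bar>g x - g y\<bar> \<le> L * \<bar>x - y\<bar>"
    and q: "q \<ge> 2" and \<beta>: "0 < \<beta>" "\<beta> \<le> 1" "\<beta> * q \<le> \<alpha>"
    and summable_\<theta>: "summable (\<lambda>j. \<bar>a (Suc j)\<bar> powr \<beta>)"
begin

text \<open>\<open>G j (R i (Suc j))\<close> is the conditional expectation of \<open>g (R i 1)\<close> given the innovations before
  time \<open>i - j\<close>, and \<open>d i j\<close> is the martingale difference \<open>G j (R i (Suc j)) - G (Suc j) (R i (Suc (Suc j)))\<close>.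
  Note the shift: \<open>d i j\<close> belongs to the coefficient \<open>a (Suc j)\<close>.\<close>

primrec G :: "nat \<Rightarrow> real \<Rightarrow> real" where
  "G 0 = g"
| "G (Suc j) = (\<lambda>y. \<integral>e. G j (y + a (Suc j) * e) \<partial>\<mu>)"

definition D :: "nat \<Rightarrow> real \<Rightarrow> real \<Rightarrow> real" where
  "D j e y = G j (y + a (Suc j) * e) - G (Suc j) y"

definition d :: "int \<Rightarrow> nat \<Rightarrow> 'w \<Rightarrow> real" where
  "d i j \<omega> = D j (\<epsilon> (i - int (Suc j)) \<omega>) (R i (Suc (Suc j)) \<omega>)"

definition \<theta> :: "nat \<Rightarrow> real" where "\<theta> j = \<bar>a (Suc j)\<bar> powr \<beta>"

definition \<gamma> :: real where "\<gamma> = (\<integral>\<omega>. g (R 0 1 \<omega>) \<partial>M)"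

section \<open>Bounds for the iterated averages and their increments\<close>

lemma K_nonneg: "K \<ge> 0" using g_bound[of 0] by linarith
lemma L_nonneg: "L \<ge> 0" using order_trans[OF abs_ge_zero g_lip[of 0 1]] by simp
lemma \<theta>_nonneg [simp]: "\<theta> j \<ge> 0" by (simp add: \<theta>_def)

text \<open>Averaging over translations preserves both constants. They share one induction: the next
  average is integrable by the bound and measurable by the Lipschitz property.\<close>

lemma G_bound_lip: "\<bar>G j x\<bar> \<le> K \<and> \<bar>G j x - G j y\<bar> \<le> L * \<bar>x - y\<bar>"
proof (induction j arbitrary: x y)
  case 0 then show ?case using g_bound g_lip by simp
next
  case (Suc j)
  have [measurable]: "G j \<in> borel_measurable borel"
    by (rule lipschitz_imp_borel_measurable[of _ L]) (use Suc in blast)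
  have I: "integrable \<mu> (\<lambda>e. G j (y + a (Suc j) * e))" for y
    by (rule law.integrable_const_bound[where B=K]) (use Suc in auto)
  have "\<bar>G (Suc j) x\<bar> \<le> (\<integral>e. \<bar>G j (x + a (Suc j) * e)\<bar> \<partial>\<mu>)" by (simp add: integral_abs_bound)
  also have "\<dots> \<le> (\<integral>e. K \<partial>\<mu>)" using I Suc by (intro integral_mono) auto
  finally have 1: "\<bar>G (Suc j) x\<bar> \<le> K" using law.prob_space by simp
  have "\<bar>G (Suc j) x - G (Suc j) y\<bar> = \<bar>\<integral>e. G j (x + a (Suc j) * e) - G j (y + a (Suc j) * e) \<partial>\<mu>\<bar>"
    using I by simp
  also have "\<dots> \<le> (\<integral>e. \<bar>G j (x + a (Suc j) * e) - G j (y + a (Suc j) * e)\<bar> \<partial>\<mu>)" by (rule integral_abs_bound)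
  also have "\<dots> \<le> (\<integral>e. L * \<bar>x - y\<bar> \<partial>\<mu>)"
    proof (rule integral_mono)
    fix e
    show "\<bar>G j (x + a (Suc j) * e) - G j (y + a (Suc j) * e)\<bar> \<le> L * \<bar>x - y\<bar>"
      using Suc[of "x + a (Suc j) * e" "y + a (Suc j) * e"] by simp
  qed (auto intro!: integrable_abs Bochner_Integration.integrable_diff I)
  finally have 2: "\<bar>G (Suc j) x - G (Suc j) y\<bar> \<le> L * \<bar>x - y\<bar>" using law.prob_space by simp
  show ?case using 1 2 by blast
qed

lemma G_bound: "\<bar>G j x\<bar> \<le> K" and G_lip: "\<bar>G j x - G j y\<bar> \<le> L * \<bar>x - y\<bar>"
  using G_bound_lip by auto

lemma G_measurable [measurable]: "G j \<in> borel_measurable borel"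
  by (rule lipschitz_imp_borel_measurable[OF G_lip])

lemma G_integrable: "integrable \<mu> (\<lambda>e. G j (y + a (Suc j) * e))"
  by (rule law.integrable_const_bound[where B=K]) (auto simp: G_bound)

lemma D_measurable [measurable]: "(\<lambda>x. D j (f x) (h x)) \<in> borel_measurable N"
  if [measurable]: "f \<in> borel_measurable N" "h \<in> borel_measurable N"
  unfolding D_def by measurable

lemma D_bound: "\<bar>D j e y\<bar> \<le> 2 * K"
  using G_bound[of j "y + a (Suc j) * e"] G_bound[of "Suc j" y] unfolding D_def by linarith

lemma D_centred: "(\<integral>e. D j e y \<partial>\<mu>) = 0"
  unfolding D_def using G_integrable law.prob_space by simp

text \<open>An envelope of \<open>\<bar>D j e y\<bar> / \<theta> j\<close>, uniform in the lag and
  in the past; the integral pays for the centring.\<close>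

definition \<eta> :: "real \<Rightarrow> real" where
  "\<eta> e = (2 * K + L) * (\<bar>e\<bar> powr \<beta> + (\<integral>e. \<bar>e\<bar> powr \<beta> \<partial>\<mu>))"

lemma \<beta>_le: "\<beta> \<le> \<alpha>"
  using \<beta> q by (smt (verit) mult_le_cancel_left1)

text \<open>A displacement \<open>z\<close> changes \<open>G j\<close> by at most
  \<open>2 * K\<close> and by at most \<open>L * z\<close>. The first bound serves
  \<open>z > 1\<close>, the second \<open>z \<le> 1\<close>, and each is then below
  \<open>(2 * K + L) * z powr \<beta>\<close>.\<close>

lemma D_dom: "\<bar>D j e y\<bar> \<le> \<theta> j * \<eta> e"
proof -
  have le: "\<bar>G j (y + a (Suc j) * e) - G j y\<bar> \<le> (2 * K + L) * \<theta> j * \<bar>e\<bar> powr \<beta>" for e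
  proof -
    let ?z = "\<bar>a (Suc j) * e\<bar>"
    have "\<bar>G j (y + a (Suc j) * e) - G j y\<bar> \<le> (2 * K + L) * ?z powr \<beta>"
    proof (cases "?z \<le> 1")
      case True
      have "?z powr 1 \<le> ?z powr \<beta>" using True \<beta> by (intro powr_mono') auto
      then have "L * ?z \<le> (2 * K + L) * ?z powr \<beta>"
        using K_nonneg L_nonneg by (intro mult_mono) auto
      then show ?thesis using G_lip[of j "y + a (Suc j) * e" y] by simp
    next
      case False
      have "1 \<le> ?z powr \<beta>" using False \<beta> by (intro ge_one_powr_ge_zero) auto
      then have "(2 * K) * 1 \<le> (2 * K + L) * ?z powr \<beta>"
        using K_nonneg L_nonneg by (intro mult_mono) auto
      then show ?thesis using G_bound[of j "y + a (Suc j) * e"] G_bound[of j y] by linarith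
    qed
    then show ?thesis by (simp add: abs_mult powr_mult \<theta>_def mult.assoc)
  qed
  have int: "integrable \<mu> (\<lambda>e. \<bar>e\<bar> powr \<beta>)" using integrable_abs_powr \<beta> \<beta>_le by blast
  have "\<bar>G (Suc j) y - G j y\<bar> = \<bar>\<integral>e. G j (y + a (Suc j) * e) - G j y \<partial>\<mu>\<bar>"
    using G_integrable law.prob_space by simp
  also have "\<dots> \<le> (\<integral>e. \<bar>G j (y + a (Suc j) * e) - G j y\<bar> \<partial>\<mu>)" by (rule integral_abs_bound)
  also have "\<dots> \<le> (\<integral>e. (2 * K + L) * \<theta> j * \<bar>e\<bar> powr \<beta> \<partial>\<mu>)"
    using int le by (intro integral_mono) (auto intro!: integrable_abs Bochner_Integration.integrable_diff G_integrable)
  finally have "\<bar>G (Suc j) y - G j y\<bar> \<le> (2 * K + L) * \<theta> j * (\<integral>e. \<bar>e\<bar> powr \<beta> \<partial>\<mu>)" by simp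
  moreover have "\<bar>D j e y\<bar> \<le> \<bar>G j (y + a (Suc j) * e) - G j y\<bar> + \<bar>G (Suc j) y - G j y\<bar>" unfolding D_def by linarith
  ultimately show ?thesis using le[of e] by (simp add: \<eta>_def algebra_simps)
qed

lemma \<eta>_measurable [measurable]: "\<eta> \<in> borel_measurable borel"
  unfolding \<eta>_def by measurable

lemma \<eta>_nonneg: "\<eta> e \<ge> 0"
  unfolding \<eta>_def using K_nonneg L_nonneg by (intro mult_nonneg_nonneg add_nonneg_nonneg) auto

lemma \<eta>_q: "integrable \<mu> (\<lambda>e. \<bar>\<eta> e\<bar> powr q)"
proof (rule Bochner_Integration.integrable_bound)
  let ?m = "\<integral>e. \<bar>e\<bar> powr \<beta> \<partial>\<mu>"
  have m: "?m \<ge> 0" by simp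
  show "integrable \<mu> (\<lambda>e. (2 * K + L) powr q * (2 powr q * (\<bar>e\<bar> powr (\<beta> * q) + ?m powr q)))"
    using integrable_abs_powr[of "\<beta> * q"] \<beta> q by simp
  show "AE e in \<mu>. norm (\<bar>\<eta> e\<bar> powr q) \<le> norm ((2 * K + L) powr q * (2 powr q * (\<bar>e\<bar> powr (\<beta> * q) + ?m powr q)))"
  proof (rule AE_I2)
    fix e :: real
    let ?x = "\<bar>e\<bar> powr \<beta>"
    have "(?x + ?m) powr q \<le> (2 * max ?x ?m) powr q" using m q by (intro powr_mono2) auto
    also have "\<dots> = 2 powr q * (max ?x ?m) powr q" using m by (subst powr_mult) auto
    also have "\<dots> \<le> 2 powr q * (?x powr q + ?m powr q)"
      by (intro mult_left_mono) (auto simp: max_def)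
    finally have "(?x + ?m) powr q \<le> 2 powr q * (\<bar>e\<bar> powr (\<beta> * q) + ?m powr q)" by (simp add: powr_powr)
    then have "(2 * K + L) powr q * (?x + ?m) powr q \<le> (2 * K + L) powr q * (2 powr q * (\<bar>e\<bar> powr (\<beta> * q) + ?m powr q))"
      by (intro mult_left_mono) auto
    moreover have "\<bar>\<eta> e\<bar> powr q = (2 * K + L) powr q * (?x + ?m) powr q"
      unfolding \<eta>_def using K_nonneg L_nonneg m by (simp add: powr_mult abs_mult)
    ultimately show "norm (\<bar>\<eta> e\<bar> powr q) \<le> norm ((2 * K + L) powr q * (2 powr q * (\<bar>e\<bar> powr (\<beta> * q) + ?m powr q)))"
      by simp
  qed
qed measurable

lemma \<eta>_2: "integrable \<mu> (\<lambda>e. (\<eta> e)\<^sup>2)"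
proof (rule Bochner_Integration.integrable_bound)
  show "integrable \<mu> (\<lambda>e. 1 + \<bar>\<eta> e\<bar> powr q)" using \<eta>_q by simp
  show "AE e in \<mu>. norm ((\<eta> e)\<^sup>2) \<le> norm (1 + \<bar>\<eta> e\<bar> powr q)"
  proof (rule AE_I2)
    fix e :: real
    have "\<eta> e ^ 2 \<le> 1 + \<eta> e powr q"
    proof (cases "\<eta> e \<le> 1")
      case True then show ?thesis using \<eta>_nonneg[of e] by (smt (verit) power_le_one powr_ge_zero)
    next
      case False
      then have "\<eta> e powr 2 \<le> \<eta> e powr q" using q by (intro powr_mono) auto
      then show ?thesis using False by simp
    qed
    then show "norm ((\<eta> e)\<^sup>2) \<le> norm (1 + \<bar>\<eta> e\<bar> powr q)" using \<eta>_nonneg[of e] by simp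
  qed
qed measurable

section \<open>Martingale differences by lag and their moments\<close>

definition C\<eta> :: real where
  "C\<eta> = exp (((q + 1) powr q + q\<^sup>2) * ((\<integral>e. (\<eta> e)\<^sup>2 \<partial>\<mu>) + (\<integral>e. \<bar>\<eta> e\<bar> powr q \<partial>\<mu>)))"

lemma d_measurable [measurable]: "d i j \<in> borel_measurable M"
  unfolding d_def by measurable

lemma D_R_measurable:
  assumes "i - int (Suc (Suc j)) < k"
  shows "(\<lambda>(e, \<omega>). D j e (R i (Suc (Suc j)) \<omega>)) \<in> borel_measurable (borel \<Otimes>\<^sub>M past k)"
proof -
  have [measurable]: "R i (Suc (Suc j)) \<in> borel_measurable (past k)" by (rule measurable_R_past[OF assms])
  show ?thesis unfolding case_prod_beta' by measurable
qed

lemma moment_d: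
  "(\<integral>\<omega>. \<bar>\<Sum>s<n. d (m + int s) j \<omega>\<bar> powr q \<partial>M) \<le> C\<eta> * real n powr (q / 2) * \<theta> j powr q"
proof -
  \<comment> \<open>For a fixed lag the innovation in \<open>d (m + s) j\<close> is that of time
    \<open>m + s - Suc j\<close>, which increases with \<open>s\<close>; the sum over
    \<open>s\<close> is a martingale.\<close>
  have eq: "(\<Sum>s<n. d (m + int s) j \<omega>) = (\<Sum>s<n. D j (\<epsilon> ((m - int (Suc j)) + int s) \<omega>) (R (m + int s) (Suc (Suc j)) \<omega>))" for \<omega>
    unfolding d_def by (intro sum.cong) (auto simp: algebra_simps)
  show ?thesis
    unfolding eq C\<eta>_def
    by (rule moment_inequality[where b="2 * K" and h="\<lambda>s e \<omega>. D j e (R (m + int s) (Suc (Suc j)) \<omega>)"])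
      (auto simp: q \<eta>_2 \<eta>_q D_bound D_centred D_dom intro!: D_R_measurable)
qed

lemma integral_G_R_Suc: "(\<integral>\<omega>. G (Suc j) (R i (Suc (Suc j)) \<omega>) \<partial>M) = (\<integral>\<omega>. G j (R i (Suc j) \<omega>) \<partial>M)"
proof -
  let ?k = "i - int (Suc j)"
  let ?\<phi> = "\<lambda>(e, \<omega>). G j (R i (Suc (Suc j)) \<omega> + a (Suc j) * e)"
  have [measurable]: "R i (Suc (Suc j)) \<in> borel_measurable (past ?k)" by (rule measurable_R_past) simp
  have "?\<phi> \<in> borel_measurable (borel \<Otimes>\<^sub>M past ?k)" unfolding case_prod_beta' by measurable
  then have "(\<integral>\<omega>. ?\<phi> (\<epsilon> ?k \<omega>, \<omega>) \<partial>M) = (\<integral>\<omega>. \<integral>e. ?\<phi> (e, \<omega>) \<partial>\<mu> \<partial>M)"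
    by (rule integral_decouple[where c=K]) (simp add: G_bound)
  moreover have "(\<integral>\<omega>. G j (R i (Suc j) \<omega>) \<partial>M) = (\<integral>\<omega>. ?\<phi> (\<epsilon> ?k \<omega>, \<omega>) \<partial>M)"
  proof (rule integral_cong_AE)
    show "AE \<omega> in M. G j (R i (Suc j) \<omega>) = ?\<phi> (\<epsilon> ?k \<omega>, \<omega>)"
      using AE_R_Suc
    proof eventually_elim
      fix \<omega> assume R: "\<forall>i j. R i j \<omega> = a j * \<epsilon> (i - int j) \<omega> + R i (Suc j) \<omega>"
      show "G j (R i (Suc j) \<omega>) = ?\<phi> (\<epsilon> ?k \<omega>, \<omega>)"
        using R[rule_format, of i "Suc j"] by (simp add: add.commute)
    qed
  qed measurable
  ultimately show ?thesis by simp
qed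

lemma integral_G_R: "(\<integral>\<omega>. G j (R i (Suc j) \<omega>) \<partial>M) = (\<integral>\<omega>. g (R i 1 \<omega>) \<partial>M)"
  by (induction j) (simp_all del: G.simps(2) add: integral_G_R_Suc)

text \<open>\<open>G j (R i (Suc j))\<close> always has the mean of \<open>g (R i 1)\<close>, and it
  approaches the constant \<open>G j 0\<close> because the remainder tends to 0. As
  \<open>G j 0\<close> does not involve \<open>i\<close>, the means agree for all \<open>i\<close>:
  this is the stationarity behind the centring by \<open>\<gamma>\<close>.\<close>

lemma G_0_tendsto: "(\<lambda>j. G j 0) \<longlonglongrightarrow> (\<integral>\<omega>. g (R i 1 \<omega>) \<partial>M)"
proof -
  have I: "integrable M (\<lambda>\<omega>. G j (R i (Suc j) \<omega>))" for j
    by (rule integrable_const_bound[where B=K]) (auto simp: G_bound)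
  have m [measurable]: "(\<lambda>\<omega>. G j (R i (Suc j) \<omega>) - G j 0) \<in> borel_measurable M" for j by measurable
  have "(\<lambda>j. \<integral>\<omega>. G j (R i (Suc j) \<omega>) - G j 0 \<partial>M) \<longlonglongrightarrow> (\<integral>\<omega>. 0 \<partial>M)"
  proof (rule integral_dominated_convergence[where w="\<lambda>_. 2 * K"])
    show "AE \<omega> in M. (\<lambda>j. G j (R i (Suc j) \<omega>) - G j 0) \<longlonglongrightarrow> 0"
      using AE_R_tendsto_0
    proof eventually_elim
      fix \<omega> assume "\<forall>i. (\<lambda>j. R i j \<omega>) \<longlonglongrightarrow> 0"
      then have "(\<lambda>j. R i (Suc j) \<omega>) \<longlonglongrightarrow> 0" by (intro LIMSEQ_Suc) blast
      then have "(\<lambda>j. L * \<bar>R i (Suc j) \<omega>\<bar>) \<longlonglongrightarrow> 0" by (auto intro!: tendsto_eq_intros)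
      then show "(\<lambda>j. G j (R i (Suc j) \<omega>) - G j 0) \<longlonglongrightarrow> 0"
        by (rule Lim_null_comparison[rotated]) (use G_lip[of _ "R i (Suc _) \<omega>" 0] in auto)
    qed
    have "\<bar>G j x - G j 0\<bar> \<le> 2 * K" for j x using G_bound[of j x] G_bound[of j 0] by linarith
    then show "\<And>j. AE \<omega> in M. norm (G j (R i (Suc j) \<omega>) - G j 0) \<le> 2 * K" by auto
  qed auto
  moreover have "(\<integral>\<omega>. G j (R i (Suc j) \<omega>) - G j 0 \<partial>M) = (\<integral>\<omega>. g (R i 1 \<omega>) \<partial>M) - G j 0" for j
    using I prob_space integral_G_R by simp
  ultimately have "(\<lambda>j. (\<integral>\<omega>. g (R i 1 \<omega>) \<partial>M) - G j 0) \<longlonglongrightarrow> 0" by simp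
  from tendsto_diff[OF tendsto_const[of "\<integral>\<omega>. g (R i 1 \<omega>) \<partial>M"] this] show ?thesis by simp
qed

text \<open>The conditional mean of \<open>g (R i 1) - \<gamma>\<close> given the innovations before
  time \<open>i - J\<close>; for \<open>J = 0\<close> it is \<open>g (R i 1) - \<gamma>\<close>
  itself.\<close>

definition tail :: "nat \<Rightarrow> int \<Rightarrow> 'w \<Rightarrow> real" where
  "tail J i \<omega> = G J (R i (Suc J) \<omega>) - \<gamma>"

lemma tail_measurable [measurable]: "tail J i \<in> borel_measurable M"
  unfolding tail_def by measurable

lemma AE_sum_d: "AE \<omega> in M. \<forall>i J n. (\<Sum>j=J..<J+n. d i j \<omega>) = tail J i \<omega> - tail (J + n) i \<omega>"
  using AE_R_Suc
proof (eventually_elim, intro allI)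
  fix \<omega> i J n assume R: "\<forall>i j. R i j \<omega> = a j * \<epsilon> (i - int j) \<omega> + R i (Suc j) \<omega>"
  have "d i j \<omega> = tail j i \<omega> - tail (Suc j) i \<omega>" for j
    using R[rule_format, of i "Suc j"] by (simp del: G.simps add: d_def D_def tail_def add.commute)
  then show "(\<Sum>j=J..<J+n. d i j \<omega>) = tail J i \<omega> - tail (J + n) i \<omega>"
    by (induction n) simp_all
qed

lemma AE_tail_tendsto: "AE \<omega> in M. \<forall>i. (\<lambda>J. tail J i \<omega>) \<longlonglongrightarrow> 0"
  using AE_R_tendsto_0
proof (eventually_elim, intro allI)
  fix \<omega> i assume "\<forall>i. (\<lambda>j. R i j \<omega>) \<longlonglongrightarrow> 0"
  then have "(\<lambda>j. R i (Suc j) \<omega>) \<longlonglongrightarrow> 0" by (intro LIMSEQ_Suc) blast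
  then have "(\<lambda>j. L * \<bar>R i (Suc j) \<omega>\<bar>) \<longlonglongrightarrow> 0" by (auto intro!: tendsto_eq_intros)
  then have "(\<lambda>j. G j (R i (Suc j) \<omega>) - G j 0) \<longlonglongrightarrow> 0"
    by (rule Lim_null_comparison[rotated]) (use G_lip[of _ "R i (Suc _) \<omega>" 0] in auto)
  moreover have "(\<lambda>j. G j 0 - \<gamma>) \<longlonglongrightarrow> 0"
    using tendsto_diff[OF G_0_tendsto[of 0] tendsto_const[of \<gamma>]] by (simp add: \<gamma>_def)
  ultimately show "(\<lambda>J. tail J i \<omega>) \<longlonglongrightarrow> 0"
    using tendsto_add[of "\<lambda>j. G j (R i (Suc j) \<omega>) - G j 0" 0 _ "\<lambda>j. G j 0 - \<gamma>" 0] by (simp add: tail_def)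
qed

lemma \<gamma>_bound: "\<bar>\<gamma>\<bar> \<le> K"
proof -
  have [measurable]: "g \<in> borel_measurable borel" using G_measurable[of 0] by simp
  have "\<bar>\<gamma>\<bar> \<le> (\<integral>\<omega>. \<bar>g (R 0 1 \<omega>)\<bar> \<partial>M)" unfolding \<gamma>_def by (rule integral_abs_bound)
  also have "\<dots> \<le> (\<integral>\<omega>. K \<partial>M)"
    by (intro integral_mono integrable_abs integrable_const_bound[where B=K]) (auto simp: g_bound K_nonneg)
  finally show ?thesis using prob_space by simp
qed

lemma tail_bound: "\<bar>tail J i \<omega>\<bar> \<le> 2 * K"
  using \<gamma>_bound G_bound[of J "R i (Suc J) \<omega>"] unfolding tail_def by linarith

definition \<Theta> :: "nat \<Rightarrow> real" where "\<Theta> J = (\<Sum>j. \<theta> (J + j))"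

lemma sum_\<theta>_le: "(\<Sum>j=J..<J+n. \<theta> j) \<le> \<Theta> J"
proof -
  have s: "summable (\<lambda>j. \<theta> (J + j))"
    using summable_\<theta> summable_iff_shift[of \<theta> J] unfolding \<theta>_def[abs_def] by (simp add: add.commute)
  have "(\<Sum>j=J..<J+n. \<theta> j) = (\<Sum>j<n. \<theta> (J + j))"
    by (rule sum.reindex_bij_witness[of _ "\<lambda>j. J + j" "\<lambda>j. j - J"]) auto
  also have "\<dots> \<le> \<Theta> J" unfolding \<Theta>_def by (rule sum_le_suminf[OF s]) auto
  finally show ?thesis .
qed

text \<open>For finitely many lags, \<open>powr_sum_le_weighted\<close> with weights
  \<open>\<theta> j\<close> combines the bounds of \<open>moment_d\<close>, whose factor
  \<open>\<theta> j powr q\<close> matches. All lags follow by dominated convergence, everything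
  being bounded for fixed \<open>n\<close>.\<close>

lemma moment_tail:
  "(\<integral>\<omega>. \<bar>\<Sum>s<n. tail J (m + int s) \<omega>\<bar> powr q \<partial>M) \<le> C\<eta> * real n powr (q / 2) * \<Theta> J powr q"
proof -
  define S where "S N \<omega> = (\<Sum>s<n. tail J (m + int s) \<omega> - tail (J + N) (m + int s) \<omega>)" for N \<omega>
  define Mj where "Mj j \<omega> = (\<Sum>s<n. d (m + int s) j \<omega>)" for j \<omega>
  have [measurable]: "Mj j \<in> borel_measurable M" "S j \<in> borel_measurable M" for j
    unfolding Mj_def S_def by measurable
  have D2: "\<bar>d i j \<omega>\<bar> \<le> 2 * K" for i j \<omega> unfolding d_def by (rule D_bound)
  have Mjb: "\<bar>Mj j \<omega>\<bar> \<le> real n * (2 * K)" for j \<omega>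
    unfolding Mj_def by (rule order_trans[OF sum_abs]) (use sum_mono[of "{..<n}" "\<lambda>s. \<bar>d (m + int s) j \<omega>\<bar>" "\<lambda>_. 2 * K"] D2 in simp)
  have Mjint: "integrable M (\<lambda>\<omega>. \<bar>Mj j \<omega>\<bar> powr q)" for j
    by (rule integrable_const_bound[where B="(real n * (2 * K)) powr q"]) (use Mjb q in \<open>auto intro!: powr_mono2\<close>)
  have Sb: "\<bar>S N \<omega>\<bar> \<le> real n * (4 * K)" for N \<omega>
  proof -
    have "\<bar>S N \<omega>\<bar> \<le> (\<Sum>s<n. \<bar>tail J (m + int s) \<omega> - tail (J + N) (m + int s) \<omega>\<bar>)" unfolding S_def by (rule sum_abs)
    also have "\<dots> \<le> (\<Sum>s<n. 4 * K)"
    proof (rule sum_mono)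
      fix s
      show "\<bar>tail J (m + int s) \<omega> - tail (J + N) (m + int s) \<omega>\<bar> \<le> 4 * K"
        using tail_bound[of J "m + int s" \<omega>] tail_bound[of "J + N" "m + int s" \<omega>] by linarith
    qed
    finally show ?thesis by simp
  qed
  have Sint: "integrable M (\<lambda>\<omega>. \<bar>S N \<omega>\<bar> powr q)" for N
    by (rule integrable_const_bound[where B="(real n * (4 * K)) powr q"]) (use Sb q in \<open>auto intro!: powr_mono2\<close>)
  have bd: "(\<integral>\<omega>. \<bar>S N \<omega>\<bar> powr q \<partial>M) \<le> C\<eta> * real n powr (q / 2) * \<Theta> J powr q" for N
  proof -
    let ?A = "{J..<J+N}"
    let ?W = "\<Sum>j\<in>?A. \<theta> j"
    \<comment> \<open>By the envelope a zero weight makes the martingale difference vanish, the side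
      condition of \<open>powr_sum_le_weighted\<close>.\<close>
    have Mj0: "Mj j \<omega> = 0" if "\<theta> j = 0" for j \<omega>
    proof -
      have "d i j \<omega> = 0" for i using D_dom[of j _ _] that by (simp add: d_def)
      then show ?thesis by (simp add: Mj_def)
    qed
    have 1: "AE \<omega> in M. \<bar>S N \<omega>\<bar> powr q \<le> ?W powr (q - 1) * (\<Sum>j\<in>?A. \<theta> j * (\<bar>Mj j \<omega>\<bar> / \<theta> j) powr q)"
      using AE_sum_d
    proof eventually_elim
      fix \<omega> assume s: "\<forall>i J n. (\<Sum>j=J..<J+n. d i j \<omega>) = tail J i \<omega> - tail (J + n) i \<omega>"
      have "S N \<omega> = (\<Sum>s<n. \<Sum>j=J..<J+N. d (m + int s) j \<omega>)" unfolding S_def using s by simp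
      also have "\<dots> = (\<Sum>j\<in>?A. Mj j \<omega>)" unfolding Mj_def by (rule sum.swap)
      finally show "\<bar>S N \<omega>\<bar> powr q \<le> ?W powr (q - 1) * (\<Sum>j\<in>?A. \<theta> j * (\<bar>Mj j \<omega>\<bar> / \<theta> j) powr q)"
        using powr_sum_le_weighted[of ?A q \<theta> "\<lambda>j. Mj j \<omega>"] q Mj0 by simp
    qed
    have pd: "(\<bar>Mj j \<omega>\<bar> / \<theta> j) powr q = \<bar>Mj j \<omega>\<bar> powr q / \<theta> j powr q" for j \<omega>
      by (simp add: powr_divide)
    have "(\<integral>\<omega>. \<bar>S N \<omega>\<bar> powr q \<partial>M) \<le> (\<integral>\<omega>. ?W powr (q - 1) * (\<Sum>j\<in>?A. \<theta> j * (\<bar>Mj j \<omega>\<bar> / \<theta> j) powr q) \<partial>M)"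
      using Mjint 1 Sint unfolding pd by (intro integral_mono_AE) auto
    also have "\<dots> = ?W powr (q - 1) * (\<Sum>j\<in>?A. \<theta> j * ((\<integral>\<omega>. \<bar>Mj j \<omega>\<bar> powr q \<partial>M) / \<theta> j powr q))"
      using Mjint unfolding pd by simp
    also have "\<dots> \<le> ?W powr (q - 1) * (\<Sum>j\<in>?A. \<theta> j * (C\<eta> * real n powr (q / 2)))"
    proof (intro mult_left_mono sum_mono)
      fix j
      show "(\<integral>\<omega>. \<bar>Mj j \<omega>\<bar> powr q \<partial>M) / \<theta> j powr q \<le> C\<eta> * real n powr (q / 2)"
        using moment_d[where m=m and n=n and j=j] \<theta>_nonneg[of j]
        by (cases "\<theta> j = 0") (auto simp: Mj_def[symmetric] C\<eta>_def divide_simps)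
    qed auto
    also have "\<dots> = C\<eta> * real n powr (q / 2) * ?W powr q"
    proof -
      have "W powr (q - 1) * W = W powr q" if "W \<ge> 0" for W
      proof (cases "W = 0")
        case False
        have "W powr (q - 1) * W powr 1 = W powr q" by (simp only: powr_add[symmetric]) simp
        then show ?thesis using that False by simp
      qed (use q in simp)
      from this[of ?W] have "?W powr (q - 1) * ?W = ?W powr q" by (simp add: sum_nonneg)
      moreover have "(\<Sum>j\<in>?A. \<theta> j * (C\<eta> * real n powr (q / 2))) = ?W * (C\<eta> * real n powr (q / 2))"
        by (simp only: sum_distrib_right)
      ultimately show ?thesis by (metis mult.assoc mult.commute)
    qed
    also have "\<dots> \<le> C\<eta> * real n powr (q / 2) * \<Theta> J powr q"
      using q by (intro mult_left_mono powr_mono2 sum_\<theta>_le sum_nonneg) (auto simp: C\<eta>_def)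
    finally show ?thesis .
  qed
  have "(\<lambda>N. \<integral>\<omega>. \<bar>S N \<omega>\<bar> powr q \<partial>M) \<longlonglongrightarrow> (\<integral>\<omega>. \<bar>\<Sum>s<n. tail J (m + int s) \<omega>\<bar> powr q \<partial>M)"
  proof (rule integral_dominated_convergence[where w="\<lambda>_. (real n * (4 * K)) powr q"])
    show "AE \<omega> in M. (\<lambda>N. \<bar>S N \<omega>\<bar> powr q) \<longlonglongrightarrow> \<bar>\<Sum>s<n. tail J (m + int s) \<omega>\<bar> powr q"
      using AE_tail_tendsto
    proof eventually_elim
      fix \<omega> assume t: "\<forall>i. (\<lambda>J. tail J i \<omega>) \<longlonglongrightarrow> 0"
      have "(\<lambda>N. tail (J + N) i \<omega>) \<longlonglongrightarrow> 0" for i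
        using t[rule_format, of i] LIMSEQ_ignore_initial_segment[of "\<lambda>J. tail J i \<omega>" 0 J] by (simp add: add.commute)
      then have "(\<lambda>N. S N \<omega>) \<longlonglongrightarrow> (\<Sum>s<n. tail J (m + int s) \<omega> - 0)"
        unfolding S_def by (intro tendsto_sum tendsto_diff tendsto_const)
      then show "(\<lambda>N. \<bar>S N \<omega>\<bar> powr q) \<longlonglongrightarrow> \<bar>\<Sum>s<n. tail J (m + int s) \<omega>\<bar> powr q"
        using q by (intro tendsto_powr2 tendsto_rabs tendsto_const) auto
    qed
  qed (use Sb q in \<open>auto intro!: powr_mono2\<close>)
  then show ?thesis by (rule LIMSEQ_le_const2) (use bd in auto)
qed

end

section \<open>Almost sure rates for sums of Lipschitz functionals\<close>

lemma summable_bertrand: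
  fixes s :: real
  assumes "s > 1"
  shows "summable (\<lambda>k. 1 / (real k * ln (real k) powr s))"
proof -
  \<comment> \<open>The shift inside the logarithm gives the monotonicity from index 1 on that
    condensation demands; with \<open>ln k\<close> the term at 1 would be
    \<open>1 / 0 = 0\<close>.\<close>
  define f where "f k = 1 / (real k * ln (real k + 1) powr s)" for k :: nat
  have "summable (\<lambda>n. 2 ^ n * f (2 ^ n))"
  proof (rule summable_comparison_test_ev)
    show "summable (\<lambda>n. ln 2 powr (- s) * real n powr (- s))"
      using assms by (intro summable_mult) (simp add: summable_real_powr_iff)
    show "\<forall>\<^sub>F n in sequentially. norm (2 ^ n * f (2 ^ n)) \<le> ln 2 powr (- s) * real n powr (- s)"
      using eventually_gt_at_top[of 0]
    proof eventually_elim
      fix n :: nat assume n: "0 < n"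
      have "real n * ln 2 = ln (2 ^ n)" by (simp add: ln_realpow)
      also have "\<dots> \<le> ln (2 ^ n + 1)" by (intro ln_mono) (auto intro: add_pos_pos)
      finally have le: "(real n * ln 2) powr s \<le> ln (2 ^ n + 1) powr s"
        using assms n by (intro powr_mono2) auto
      have "2 ^ n * f (2 ^ n) = 1 / ln (2 ^ n + 1) powr s" by (simp add: f_def)
      also have "\<dots> \<le> 1 / (real n * ln 2) powr s"
      proof -
        have "0 < ln (2 ^ n + 1 :: real)" by (intro ln_gt_zero) simp
        then show ?thesis using le n by (intro divide_left_mono) auto
      qed
      also have "\<dots> = ln 2 powr (- s) * real n powr (- s)"
        by (simp add: powr_mult powr_minus divide_simps)
      finally show "norm (2 ^ n * f (2 ^ n)) \<le> ln 2 powr (- s) * real n powr (- s)"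
        by (simp add: f_def)
    qed
  qed
  then have "summable f"
  proof (subst condensation_test)
    fix m :: nat assume "0 < m"
    then show "f (Suc m) \<le> f m"
      unfolding f_def using assms by (intro divide_left_mono mult_mono powr_mono2) auto
  qed (auto simp: f_def)
  then have "summable (\<lambda>k. 2 powr s * f k)" by (rule summable_mult)
  then show ?thesis
  proof (rule summable_comparison_test_ev[rotated])
    have "\<forall>\<^sub>F k in sequentially. ln (real k + 1) \<le> 2 * ln (real k)" by real_asymp
    then show "\<forall>\<^sub>F k in sequentially. norm (1 / (real k * ln (real k) powr s)) \<le> 2 powr s * f k"
      using eventually_gt_at_top[of 1]
    proof eventually_elim
      fix k :: nat assume k: "ln (real k + 1) \<le> 2 * ln (real k)" "1 < k"
      have "ln (real k + 1) powr s \<le> (2 * ln (real k)) powr s" using k assms by (intro powr_mono2) auto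
      also have "\<dots> = 2 powr s * ln (real k) powr s" by (rule powr_mult)
      finally show "norm (1 / (real k * ln (real k) powr s)) \<le> 2 powr s * f k"
        using k by (simp add: f_def divide_simps mult.commute)
    qed
  qed
qed

lemma sum_lessThan_add:
  fixes x :: "nat \<Rightarrow> 'a::comm_monoid_add"
  shows "(\<Sum>s<n+m. x s) = (\<Sum>s<n. x s) + (\<Sum>s<m. x (n + s))"
  by (induction m) (simp_all add: add.assoc)

text \<open>Shifting the window of summation exchanges only \<open>m\<close> terms at each
  end.\<close>

lemma sum_shift_diff_le:
  fixes x :: "nat \<Rightarrow> real"
  assumes "\<And>s. \<bar>x s\<bar> \<le> B"
  shows "\<bar>(\<Sum>s<n. x s) - (\<Sum>s<n. x (s + m))\<bar> \<le> 2 * real m * B"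
proof -
  have 1: "(\<Sum>s<n. x (s + m)) = (\<Sum>s<n+m. x s) - (\<Sum>s<m. x s)"
    using sum_lessThan_add[of x m n] by (simp add: add.commute)
  have 2: "(\<Sum>s<n+m. x s) = (\<Sum>s<n. x s) + (\<Sum>s<m. x (n + s))" by (rule sum_lessThan_add)
  have "\<bar>\<Sum>s<m. x s\<bar> \<le> real m * B" "\<bar>\<Sum>s<m. x (n + s)\<bar> \<le> real m * B"
    using order_trans[OF sum_abs sum_mono[of "{..<m}" "\<lambda>s. \<bar>x s\<bar>" "\<lambda>_. B"]]
      order_trans[OF sum_abs sum_mono[of "{..<m}" "\<lambda>s. \<bar>x (n + s)\<bar>" "\<lambda>_. B"]] assms by auto
  then show ?thesis unfolding 1 2 by linarith
qed

text \<open>The order of \<open>ell q (2 ^ k)\<close>, with \<open>k\<close> in the place of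
  \<open>ln (2 ^ k)\<close>.\<close>

definition block_rate :: "real \<Rightarrow> nat \<Rightarrow> real" where
  "block_rate q k = (if q > 2 then sqrt (ln (real k)) else real k powr (3/2) * ln (real k))"

lemma summable_over_square: "summable (\<lambda>k. c * (1 / real k ^ 2))"
  using inverse_power_summable[of 2, where 'a=real] by (intro summable_mult) (simp add: inverse_eq_divide)

context prob_space
begin

lemma borel_cantelli_eventually:
  assumes [measurable]: "\<And>k::nat. Measurable.pred M (P k)"
    and "\<forall>\<^sub>F k in sequentially. prob {\<omega> \<in> space M. P k \<omega>} \<le> u k" and "summable u"
  shows "AE \<omega> in M. \<forall>\<^sub>F k in sequentially. \<not> P k \<omega>"
proof -
  have "summable (\<lambda>k. prob {\<omega> \<in> space M. P k \<omega>})"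
    using assms(2) by (intro summable_comparison_test_ev[OF _ assms(3)]) auto
  then have "AE \<omega> in M. \<forall>\<^sub>F k in sequentially. \<omega> \<in> space M - {\<omega> \<in> space M. P k \<omega>}"
    by (intro borel_cantelli_AE1) (auto simp: emeasure_eq_measure)
  then show ?thesis by eventually_elim (auto elim: eventually_mono)
qed

end

section \<open>Maximal inequality and almost sure rates for functionals of the past\<close>

context lipschitz_functional
begin

definition tail_event :: "nat \<Rightarrow> nat \<Rightarrow> real \<Rightarrow> 'w set" where
  "tail_event J k l = {\<omega> \<in> space M. \<exists>n\<le>2^k. l \<le> \<bar>\<Sum>s<n. tail J (1 + int s) \<omega>\<bar>}"

definition block_moment :: "nat \<Rightarrow> nat \<Rightarrow> nat \<Rightarrow> real" where
  "block_moment J k j = 2 ^ j * (C\<eta> * real (2 ^ (k - j)) powr (q / 2) * \<Theta> J powr q)"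

text \<open>On each level the largest block sum is at most the l^q norm of all block sums, whose
  q-th power has a controlled mean. Chaining, Jensen's inequality across levels and Markov's
  inequality follow. The weight \<open>w\<close> stays free, since the good choice depends on
  \<open>q\<close>.\<close>

lemma maximal_tail_weighted:
  fixes w :: real
  assumes w: "0 < w" and l: "l > 0"
  shows "prob (tail_event J k l)
    \<le> (\<Sum>j\<le>k. w ^ j) powr (q - 1) * (\<Sum>j\<le>k. w ^ j * ((1 / w ^ j) powr q * block_moment J k j)) / l powr q"
proof -
  define S where "S n \<omega> = (\<Sum>s<n. tail J (1 + int s) \<omega>)" for n \<omega>
  define B where "B j m \<omega> = (\<Sum>s<2^(k-j). tail J (1 + int (m * 2 ^ (k-j)) + int s) \<omega>)" for j m \<omega>
  define c where "c j \<omega> = (\<Sum>m<2^j. \<bar>B j m \<omega>\<bar> powr q) powr (1 / q)" for j \<omega>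
  define Z where "Z \<omega> = (\<Sum>j\<le>k. w ^ j) powr (q - 1) * (\<Sum>j\<le>k. w ^ j * ((1 / w ^ j) powr q * (\<Sum>m<2^j. \<bar>B j m \<omega>\<bar> powr q)))" for \<omega>
  have [measurable]: "S n \<in> borel_measurable M" "B j m \<in> borel_measurable M" for n j m
    unfolding S_def B_def by measurable
  have Bint: "integrable M (\<lambda>\<omega>. \<bar>B j m \<omega>\<bar> powr q)" for j m
  proof (rule integrable_const_bound[where B="(real (2^(k-j)) * (2 * K)) powr q"])
    have "\<bar>B j m \<omega>\<bar> \<le> real (2^(k-j)) * (2 * K)" for \<omega>
      unfolding B_def by (rule order_trans[OF sum_abs])
       (use sum_mono[of "{..<2^(k-j)}" "\<lambda>s. \<bar>tail J (1 + int (m * 2 ^ (k-j)) + int s) \<omega>\<bar>" "\<lambda>_. 2 * K"] tail_bound in simp)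
    then show "AE \<omega> in M. norm (\<bar>B j m \<omega>\<bar> powr q) \<le> (real (2^(k-j)) * (2 * K)) powr q"
      using q by (auto intro!: powr_mono2)
  qed measurable
  have Sdiff: "S (Suc m * 2 ^ (k - j)) \<omega> - S (m * 2 ^ (k - j)) \<omega> = B j m \<omega>" for j m \<omega>
  proof -
    have "S (m * 2 ^ (k - j) + 2 ^ (k - j)) \<omega> = S (m * 2 ^ (k - j)) \<omega> + (\<Sum>s<2^(k-j). tail J (1 + int (m * 2 ^ (k - j) + s)) \<omega>)"
      unfolding S_def by (rule sum_lessThan_add)
    then show ?thesis by (simp add: B_def add.commute add.left_commute)
  qed
  have chain: "\<bar>S n \<omega>\<bar> powr q \<le> Z \<omega>" if "n \<le> 2 ^ k" for n \<omega>
  proof -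
    have "\<bar>S (n * 2 ^ (k - k)) \<omega> - S (0 * 2 ^ (k - 0)) \<omega>\<bar> \<le> (\<Sum>j\<le>k. c j \<omega>)"
    proof (rule dyadic_chaining[where g="\<lambda>j m. S (m * 2 ^ (k - j)) \<omega>"])
      fix j m :: nat assume "j < k"
      then have "k - j = Suc (k - Suc j)" by simp
      then show "S (2 * m * 2 ^ (k - Suc j)) \<omega> = S (m * 2 ^ (k - j)) \<omega>" by (simp add: mult_ac)
    next
      fix j m :: nat assume "j \<le> k" "m < 2 ^ j"
      then have "\<bar>B j m \<omega>\<bar> powr q \<le> (\<Sum>m<2^j. \<bar>B j m \<omega>\<bar> powr q)"
        by (intro member_le_sum) auto
      then have "(\<bar>B j m \<omega>\<bar> powr q) powr (1/q) \<le> c j \<omega>" unfolding c_def using q by (intro powr_mono2) auto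
      then show "\<bar>S (Suc m * 2 ^ (k - j)) \<omega> - S (m * 2 ^ (k - j)) \<omega>\<bar> \<le> c j \<omega>"
        unfolding Sdiff using q by (simp add: powr_powr)
    qed (use that in simp)
    then have "\<bar>S n \<omega>\<bar> \<le> \<bar>\<Sum>j\<le>k. c j \<omega>\<bar>" by (simp add: S_def)
    then have "\<bar>S n \<omega>\<bar> powr q \<le> \<bar>\<Sum>j\<le>k. c j \<omega>\<bar> powr q" using q by (intro powr_mono2) auto
    also have "\<dots> \<le> (\<Sum>j\<le>k. w ^ j) powr (q - 1) * (\<Sum>j\<le>k. w ^ j * (\<bar>c j \<omega>\<bar> / w ^ j) powr q)"
      using q w by (intro powr_sum_le_weighted) auto
    also have "\<dots> = Z \<omega>"
      unfolding Z_def
    proof (intro arg_cong2[where f="(*)"] refl sum.cong)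
      fix j
      have "(\<bar>c j \<omega>\<bar> / w ^ j) powr q = (1 / w ^ j) powr q * (c j \<omega>) powr q"
        using w by (simp add: c_def powr_divide)
      also have "c j \<omega> powr q = (\<Sum>m<2^j. \<bar>B j m \<omega>\<bar> powr q)"
        unfolding c_def using q by (simp add: powr_powr sum_nonneg)
      finally show "(\<bar>c j \<omega>\<bar> / w ^ j) powr q = (1 / w ^ j) powr q * (\<Sum>m<2^j. \<bar>B j m \<omega>\<bar> powr q)" .
    qed
    finally show ?thesis .
  qed
  have Zint: "integrable M Z" unfolding Z_def using Bint by simp
  have "prob {\<omega> \<in> space M. \<exists>n\<le>2^k. l \<le> \<bar>S n \<omega>\<bar>} \<le> prob {\<omega> \<in> space M. l powr q \<le> Z \<omega>}"
  proof (rule finite_measure_mono)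
    show "{\<omega> \<in> space M. l powr q \<le> Z \<omega>} \<in> events" using Zint by simp
    show "{\<omega> \<in> space M. \<exists>n\<le>2^k. l \<le> \<bar>S n \<omega>\<bar>} \<subseteq> {\<omega> \<in> space M. l powr q \<le> Z \<omega>}"
    proof safe
      fix \<omega> n assume "n \<le> 2 ^ k" "l \<le> \<bar>S n \<omega>\<bar>"
      then show "l powr q \<le> Z \<omega>" using chain[of n \<omega>] l q powr_mono2[of q l "\<bar>S n \<omega>\<bar>"] by simp
    qed
  qed
  also have "\<dots> \<le> (\<integral>\<omega>. Z \<omega> \<partial>M) / l powr q"
    using Zint l w unfolding Z_def
    by (intro integral_Markov_inequality_measure[where A="{}"])
      (auto intro!: mult_nonneg_nonneg sum_nonneg AE_I2)
  also have "\<dots> \<le> (\<Sum>j\<le>k. w ^ j) powr (q - 1) * (\<Sum>j\<le>k. w ^ j * ((1 / w ^ j) powr q * block_moment J k j)) / l powr q"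
  proof (rule divide_right_mono)
    have "(\<integral>\<omega>. Z \<omega> \<partial>M) = (\<Sum>j\<le>k. w ^ j) powr (q - 1) * (\<Sum>j\<le>k. w ^ j * ((1 / w ^ j) powr q * (\<Sum>m<2^j. \<integral>\<omega>. \<bar>B j m \<omega>\<bar> powr q \<partial>M)))"
      unfolding Z_def using Bint by simp
    also have "\<dots> \<le> (\<Sum>j\<le>k. w ^ j) powr (q - 1) * (\<Sum>j\<le>k. w ^ j * ((1 / w ^ j) powr q * block_moment J k j))"
    proof (intro mult_left_mono sum_mono)
      fix j
      have "(\<Sum>m<2^j. \<integral>\<omega>. \<bar>B j m \<omega>\<bar> powr q \<partial>M) \<le> (\<Sum>m<(2::nat)^j. C\<eta> * real (2 ^ (k - j)) powr (q / 2) * \<Theta> J powr q)"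
        unfolding B_def by (intro sum_mono moment_tail)
      then show "(\<Sum>m<2^j. \<integral>\<omega>. \<bar>B j m \<omega>\<bar> powr q \<partial>M) \<le> block_moment J k j" by (simp add: block_moment_def)
    qed (use w in auto)
    finally show "(\<integral>\<omega>. Z \<omega> \<partial>M) \<le> (\<Sum>j\<le>k. w ^ j) powr (q - 1) * (\<Sum>j\<le>k. w ^ j * ((1 / w ^ j) powr q * block_moment J k j))" .
  qed simp
  finally show ?thesis unfolding S_def tail_event_def .
qed

text \<open>Level \<open>j\<close> contributes \<open>2 ^ j * (2 ^ (k - j)) powr (q / 2)\<close>.
  For \<open>q > 2\<close> this decays geometrically in \<open>j\<close>, so the levels add up to a
  constant. For \<open>q = 2\<close> all levels are equal; with \<open>w = 1\<close>, one factor
  \<open>k + 1\<close> comes from the weights and one from the levels.\<close>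

lemma maximal_tail:
  obtains C where "C > 0"
    "\<And>k J l. l > 0 \<Longrightarrow> prob (tail_event J k l)
      \<le> C * (if q > 2 then 1 else (real k + 1)\<^sup>2) * (2 ^ k) powr (q / 2) * \<Theta> J powr q / l powr q"
proof (cases "q > 2")
  case True
  \<comment> \<open>Half of the decay \<open>2 powr (1 - q / 2)\<close> per level is spent on the
    weights, which cost \<open>w powr (1 - q)\<close>; \<open>r\<close> is the ratio that
    remains.\<close>
  define w where "w = 2 powr (- (q/2 - 1) / (2 * (q - 1)))"
  define r where "r = 2 powr (- (q/2 - 1) / 2)"
  have neg: "- (q/2 - 1) / (2 * (q - 1)) < 0" "- (q/2 - 1) / 2 < 0" using True by (auto intro!: divide_neg_pos)
  have w: "0 < w" "w < 1" using neg by (auto simp: w_def powr_less_one)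
  have r: "0 < r" "r < 1" using neg by (auto simp: r_def powr_less_one)
  have wq: "w powr (1 - q) = 2 powr ((q/2 - 1) / 2)"
  proof -
    have "- (q/2 - 1) / (2 * (q - 1)) * (1 - q) = (q/2 - 1) / 2" using True by (simp add: field_simps)
    then show ?thesis unfolding w_def by (simp only: powr_powr)
  qed
  have summand: "w ^ j * ((1 / w ^ j) powr q * block_moment J k j)
    = r ^ j * (C\<eta> * (2 ^ k) powr (q / 2) * \<Theta> J powr q)" if "j \<le> k" for j k J
  proof -
    have a: "w ^ j * (1 / w ^ j) powr q = (w powr (1 - q)) ^ j"
      using w by (simp add: powr_divide powr_diff power_divide powr_realpow[symmetric] powr_powr mult.commute)
    have b: "real (2 ^ (k - j)) powr (q / 2) = (2 ^ k) powr (q / 2) / (2 ^ j) powr (q / 2)"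
    proof -
      have "real (2 ^ (k - j)) = 2 ^ k / 2 ^ j" using that power_diff[of "2::real" j k] by simp
      then show ?thesis by (simp add: powr_divide)
    qed
    have c: "2 ^ j / (2 ^ j) powr (q / 2) = (2 powr (1 - q / 2)) ^ j"
      by (simp add: powr_diff power_divide powr_realpow[symmetric] powr_powr mult.commute)
    have d: "w powr (1 - q) * 2 powr (1 - q / 2) = r"
    proof -
      have "(q/2 - 1) / 2 + (1 - q / 2) = - (q/2 - 1) / 2" by (simp add: field_simps)
      then show ?thesis unfolding wq r_def powr_add[symmetric] by (simp only:)
    qed
    have "w ^ j * ((1 / w ^ j) powr q * block_moment J k j)
      = (w ^ j * (1 / w ^ j) powr q) * (2 ^ j / (2 ^ j) powr (q / 2)) * (C\<eta> * (2 ^ k) powr (q / 2) * \<Theta> J powr q)"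
      unfolding b block_moment_def by simp
    also have "\<dots> = (w powr (1 - q) * 2 powr (1 - q / 2)) ^ j * (C\<eta> * (2 ^ k) powr (q / 2) * \<Theta> J powr q)"
      unfolding a c by (simp add: power_mult_distrib)
    finally show ?thesis unfolding d .
  qed
  define C where "C = (1 / (1 - w)) powr (q - 1) * (1 / (1 - r)) * C\<eta>"
  show thesis
  proof (rule that[of C])
    show "C > 0" using w r by (simp add: C_def C\<eta>_def)
    fix k J and l :: real assume l: "l > 0"
    have geo: "(\<Sum>j\<le>k. x ^ j) \<le> 1 / (1 - x)" if "0 < x" "x < 1" for x :: real
      using that sum_le_suminf[of "\<lambda>j. x ^ j" "{..k}"] by (simp add: suminf_geometric summable_geometric)
    have "prob (tail_event J k l)
      \<le> (\<Sum>j\<le>k. w ^ j) powr (q - 1) * (\<Sum>j\<le>k. w ^ j * ((1 / w ^ j) powr q * block_moment J k j)) / l powr q"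
      by (rule maximal_tail_weighted[OF w(1) l])
    also have "(\<Sum>j\<le>k. w ^ j * ((1 / w ^ j) powr q * block_moment J k j))
      = (\<Sum>j\<le>k. r ^ j) * (C\<eta> * (2 ^ k) powr (q / 2) * \<Theta> J powr q)"
      unfolding sum_distrib_right by (intro sum.cong summand) auto
    also have "(\<Sum>j\<le>k. w ^ j) powr (q - 1) * ((\<Sum>j\<le>k. r ^ j) * (C\<eta> * (2 ^ k) powr (q / 2) * \<Theta> J powr q)) / l powr q
      \<le> (1 / (1 - w)) powr (q - 1) * ((1 / (1 - r)) * (C\<eta> * (2 ^ k) powr (q / 2) * \<Theta> J powr q)) / l powr q"
      using True w r geo[OF w] geo[OF r]
      by (intro divide_right_mono mult_mono powr_mono2 mult_right_mono mult_nonneg_nonneg sum_nonneg) (auto simp: C\<eta>_def)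
    finally show "prob (tail_event J k l)
      \<le> C * (if q > 2 then 1 else (real k + 1)\<^sup>2) * (2 ^ k) powr (q / 2) * \<Theta> J powr q / l powr q"
      using True by (simp add: C_def mult_ac)
  qed
next
  case False
  then have q2: "q = 2" using q by simp
  show thesis
  proof (rule that[of C\<eta>])
    show "C\<eta> > 0" by (simp add: C\<eta>_def)
    fix k J and l :: real assume l: "l > 0"
    have "prob (tail_event J k l)
      \<le> (\<Sum>j\<le>k. 1 ^ j) powr (q - 1) * (\<Sum>j\<le>k. 1 ^ j * ((1 / 1 ^ j) powr q * block_moment J k j)) / l powr q"
      by (rule maximal_tail_weighted[OF _ l]) simp
    also have "(\<Sum>j\<le>k. 1 ^ j * ((1 / 1 ^ j) powr q * block_moment J k j))
      = (\<Sum>j\<le>k. C\<eta> * 2 ^ k * \<Theta> J powr q)"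
      proof (intro sum.cong refl)
      fix j assume "j \<in> {..k}"
      then have "real (2 ^ (k - j)) = 2 ^ k / 2 ^ j" using power_diff[of "2::real" j k] by simp
      then show "1 ^ j * ((1 / 1 ^ j) powr q * block_moment J k j)
        = C\<eta> * 2 ^ k * \<Theta> J powr q"
        unfolding block_moment_def by (simp add: q2)
    qed
    finally show "prob (tail_event J k l)
      \<le> C\<eta> * (if q > 2 then 1 else (real k + 1)\<^sup>2) * (2 ^ k) powr (q / 2) * \<Theta> J powr q / l powr q"
      by (simp add: q2 power2_eq_square mult_ac add.commute)
  qed
qed

text \<open>For \<open>q > 2\<close> the cutoff is a power of \<open>2 ^ k\<close>, so that its logarithm is of order \<open>k\<close> and the
  Borel--Cantelli series is \<open>\<Sum> 1 / (k ln\<^bsup>q/2\<^esup> k)\<close>; the exponent \<open>1/8\<close> keeps the boundary terms, of order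
  \<open>cutoff k ^ 2\<close>, negligible.\<close>

definition cutoff :: "nat \<Rightarrow> nat" where
  "cutoff k = (if q > 2 then 2 ^ (k div 8) else 0)"

lemma AE_tail_rate:
  assumes tail_sums: "q > 2 \<Longrightarrow> \<exists>c. \<forall>\<^sub>F J in sequentially. \<Theta> J powr q \<le> c / ln (real J)"
  shows "AE \<omega> in M. \<forall>\<^sub>F k in sequentially. \<forall>n\<le>2^k.
    \<bar>\<Sum>s<n. tail (cutoff k) (1 + int s) \<omega>\<bar> < sqrt (2 ^ k) * block_rate q k"
proof -
  let ?l = "\<lambda>k. sqrt (2 ^ k) * block_rate q k"
  obtain C where C: "C > 0" and P: "\<And>k J l. l > 0 \<Longrightarrow> prob (tail_event J k l)
      \<le> C * (if q > 2 then 1 else (real k + 1)\<^sup>2) * (2 ^ k) powr (q / 2) * \<Theta> J powr q / l powr q"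
    using maximal_tail[where thesis=thesis] by simp
  have P': "prob (tail_event J k (?l k))
      \<le> C * (if q > 2 then 1 else (real k + 1)\<^sup>2) * \<Theta> J powr q / block_rate q k powr q" if k: "k \<ge> 2" for k J
  proof -
    have r: "block_rate q k > 0" using k by (simp add: block_rate_def)
    have s: "?l k powr q = (2 ^ k) powr (q / 2) * block_rate q k powr q"
      using r by (simp add: powr_mult powr_half_sqrt[symmetric] powr_powr)
    have "?l k > 0" using r by simp
    from P[OF this, of J k] show ?thesis unfolding s by simp
  qed
  have "\<exists>u. summable u \<and> (\<forall>\<^sub>F k in sequentially. prob (tail_event (cutoff k) k (?l k)) \<le> u k)"
  proof (cases "q > 2")
    case True
    obtain c where c: "\<forall>\<^sub>F J in sequentially. \<Theta> J powr q \<le> c / ln (real J)" using tail_sums[OF True] by blast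
    have lim: "filterlim (\<lambda>k::nat. 2 ^ (k div 8) :: nat) at_top sequentially"
    proof (rule filterlim_at_top_mono)
      show "filterlim (\<lambda>k::nat. k div 8) at_top sequentially"
        by (rule filterlim_at_top_div_const_nat) simp
      show "\<forall>\<^sub>F k in sequentially. k div 8 \<le> 2 ^ (k div 8)" by (simp add: less_imp_le)
    qed
    \<comment> \<open>\<open>16\<close> stems from \<open>k \<le> 16 * (k div 8)\<close> for
      \<open>k \<ge> 16\<close>; \<open>max c 0\<close> keeps the numerator nonnegative while the
      denominator is lowered.\<close>
    define c' where "c' = max c 0 * 16 / ln 2"
    have ev: "\<forall>\<^sub>F k in sequentially. \<Theta> (cutoff k) powr q \<le> c' / real k"
      using eventually_compose_filterlim[OF c lim] eventually_ge_at_top[of 16]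
    proof eventually_elim
      fix k :: nat assume h: "\<Theta> (2 ^ (k div 8)) powr q \<le> c / ln (real (2 ^ (k div 8)))" and k: "16 \<le> k"
      have k8: "real k \<le> 16 * real (k div 8)" using k by linarith
      have "\<Theta> (2 ^ (k div 8)) powr q \<le> max c 0 / ln (real (2 ^ (k div 8)))"
        by (rule order_trans[OF h divide_right_mono]) auto
      also have "\<dots> = max c 0 / (real (k div 8) * ln 2)" by (simp add: ln_realpow)
      also have "\<dots> \<le> max c 0 / (real k / 16 * ln 2)"
        using k8 k by (intro divide_left_mono mult_right_mono) auto
      finally show "\<Theta> (cutoff k) powr q \<le> c' / real k" using True by (simp add: cutoff_def c'_def field_simps)
    qed
    show ?thesis
    proof (intro exI conjI)
      show "summable (\<lambda>k. C * c' * (1 / (real k * ln (real k) powr (q / 2))))"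
        using True by (intro summable_mult summable_bertrand) simp
      show "\<forall>\<^sub>F k in sequentially. prob (tail_event (cutoff k) k (?l k))
        \<le> C * c' * (1 / (real k * ln (real k) powr (q / 2)))"
        using ev eventually_ge_at_top[of 2]
      proof eventually_elim
        fix k :: nat assume h: "\<Theta> (cutoff k) powr q \<le> c' / real k" and k: "2 \<le> k"
        have b: "block_rate q k powr q = ln (real k) powr (q / 2)"
          using True k by (simp add: block_rate_def powr_half_sqrt[symmetric] powr_powr)
        have "prob (tail_event (cutoff k) k (?l k))
          \<le> C * \<Theta> (cutoff k) powr q / ln (real k) powr (q / 2)"
          using P'[OF k, of "cutoff k"] True b by simp
        also have "\<dots> \<le> C * (c' / real k) / ln (real k) powr (q / 2)"
          using h C by (intro divide_right_mono mult_left_mono) auto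
        finally show "prob (tail_event (cutoff k) k (?l k))
          \<le> C * c' * (1 / (real k * ln (real k) powr (q / 2)))" by simp
      qed
    qed
  next
    case False
    then have q2: "q = 2" using q by simp
    have c0: "cutoff k = 0" for k unfolding cutoff_def using q2 by simp
    show ?thesis
    proof (intro exI conjI)
      \<comment> \<open>The loss \<open>(k + 1) ^ 2\<close> against the squared rate
        \<open>k ^ 3 * (ln k) ^ 2\<close> leaves a convergent Bertrand series; this explains the
        exponent \<open>3/2\<close> in \<open>block_rate\<close>.\<close>
      show "summable (\<lambda>k. C * 4 * \<Theta> 0 powr 2 * (1 / (real k * ln (real k) powr 2)))"
        by (intro summable_mult summable_bertrand) simp
      show "\<forall>\<^sub>F k in sequentially. prob (tail_event (cutoff k) k (?l k))
        \<le> C * 4 * \<Theta> 0 powr 2 * (1 / (real k * ln (real k) powr 2))"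
        using eventually_ge_at_top[of 2]
      proof eventually_elim
        fix k :: nat assume k: "2 \<le> k"
        have b: "block_rate q k powr q = real k ^ 3 * ln (real k) powr 2"
        proof -
          have "(real k powr (3/2)) powr 2 = real k powr real 3" by (simp add: powr_powr)
          also have "\<dots> = real k ^ 3" by (rule powr_realpow) (use k in simp)
          finally show ?thesis using k by (simp add: q2 block_rate_def powr_mult del: powr_numeral)
        qed
        have "prob (tail_event (cutoff k) k (?l k))
          \<le> C * (real k + 1)\<^sup>2 * \<Theta> 0 powr 2 / (real k ^ 3 * ln (real k) powr 2)"
          using P'[OF k, of 0] b unfolding c0 by (simp add: q2)
        also have "\<dots> \<le> C * (2 * real k)\<^sup>2 * \<Theta> 0 powr 2 / (real k ^ 3 * ln (real k) powr 2)"
          using k C by (intro divide_right_mono mult_right_mono mult_left_mono power_mono) auto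
        also have "\<dots> = C * 4 * \<Theta> 0 powr 2 * (1 / (real k * ln (real k) powr 2))"
          using k by (simp add: power2_eq_square power3_eq_cube)
        finally show "prob (tail_event (cutoff k) k (?l k))
          \<le> C * 4 * \<Theta> 0 powr 2 * (1 / (real k * ln (real k) powr 2))" .
      qed
    qed
  qed
  then obtain u where u: "summable u" "\<forall>\<^sub>F k in sequentially. prob (tail_event (cutoff k) k (?l k)) \<le> u k"
    by blast
  have "AE \<omega> in M. \<forall>\<^sub>F k in sequentially. \<not> (\<exists>n\<le>2^k. ?l k \<le> \<bar>\<Sum>s<n. tail (cutoff k) (1 + int s) \<omega>\<bar>)"
    by (rule borel_cantelli_eventually[OF _ u(2)[unfolded tail_event_def] u(1)]) measurable
  then show ?thesis by (simp add: not_le[symmetric] del: not_le)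
qed

text \<open>For fixed \<open>\<omega>\<close> the innovation entering at time \<open>l\<close> contributes to the observations at times
  \<open>l + 1, \<dots>, l + J\<close>; collecting its contributions gives a single martingale difference.\<close>

definition collected :: "nat \<Rightarrow> int \<Rightarrow> real \<Rightarrow> 'w \<Rightarrow> real" where
  "collected J l e \<omega> = (\<Sum>j<J. D j e (R (l + int (Suc j)) (Suc (Suc j)) \<omega>))"

lemma collected_measurable:
  "(\<lambda>(e, \<omega>). collected J l e \<omega>) \<in> borel_measurable (borel \<Otimes>\<^sub>M past l)"
proof -
  have [measurable]: "R (l + int (Suc j)) (Suc (Suc j)) \<in> borel_measurable (past l)" for j
    by (rule measurable_R_past) simp
  show ?thesis unfolding collected_def case_prod_beta' by measurable
qed

lemma collected_measurable_innovation [measurable]: "(\<lambda>\<omega>. collected J l (\<epsilon> l \<omega>) \<omega>) \<in> borel_measurable M"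
  unfolding collected_def by measurable

lemma collected_bound: "\<bar>collected J l e \<omega>\<bar> \<le> 2 * K * real J"
  unfolding collected_def
  using order_trans[OF sum_abs sum_mono[of "{..<J}" "\<lambda>j. \<bar>D j e (R (l + int (Suc j)) (Suc (Suc j)) \<omega>)\<bar>" "\<lambda>_. 2 * K"]] D_bound
  by (simp add: mult.commute)

lemma D_integrable: "integrable \<mu> (\<lambda>e. D j e y)"
  by (rule law.integrable_const_bound[where B="2 * K"]) (auto simp: D_bound)

lemma collected_centred: "(\<integral>e. collected J l e \<omega> \<partial>\<mu>) = 0"
  unfolding collected_def using D_integrable by (simp add: D_centred)

text \<open>The envelopes of all lags are added before squaring, so the bound is free of
  \<open>J\<close> and of the past; the number of collected lags may thus grow with the
  block.\<close>

lemma collected_variance: "(\<integral>e. (collected J l e \<omega>)\<^sup>2 \<partial>\<mu>) \<le> (\<Theta> 0)\<^sup>2 * (\<integral>e. (\<eta> e)\<^sup>2 \<partial>\<mu>)"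
proof -
  have le: "\<bar>collected J l e \<omega>\<bar> \<le> \<Theta> 0 * \<eta> e" for e
  proof -
    have "\<bar>collected J l e \<omega>\<bar> \<le> (\<Sum>j<J. \<bar>D j e (R (l + int (Suc j)) (Suc (Suc j)) \<omega>)\<bar>)"
      unfolding collected_def by (rule sum_abs)
    also have "\<dots> \<le> (\<Sum>j<J. \<theta> j * \<eta> e)" by (intro sum_mono D_dom)
    also have "\<dots> = (\<Sum>j<J. \<theta> j) * \<eta> e" by (simp add: sum_distrib_right)
    also have "\<dots> \<le> \<Theta> 0 * \<eta> e"
      using sum_\<theta>_le[of 0 J] by (intro mult_right_mono \<eta>_nonneg) (simp add: lessThan_atLeast0)
    finally show ?thesis .
  qed
  have m [measurable]: "(\<lambda>e. collected J l e \<omega>) \<in> borel_measurable borel" unfolding collected_def by measurable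
  have "(\<integral>e. (collected J l e \<omega>)\<^sup>2 \<partial>\<mu>) \<le> (\<integral>e. (\<Theta> 0)\<^sup>2 * (\<eta> e)\<^sup>2 \<partial>\<mu>)"
  proof (rule integral_mono)
    show "integrable \<mu> (\<lambda>e. (collected J l e \<omega>)\<^sup>2)"
      by (rule law.integrable_const_bound[where B="(2 * K * real J)\<^sup>2"])
        (auto intro!: AE_I2, metis abs_ge_zero collected_bound power2_abs power_mono)
    fix e
    show "(collected J l e \<omega>)\<^sup>2 \<le> (\<Theta> 0)\<^sup>2 * (\<eta> e)\<^sup>2"
      using power_mono[OF le[of e], of 2] by (simp add: power_mult_distrib)
  qed (use \<eta>_2 in simp)
  then show ?thesis by simp
qed

lemma AE_collected_rate:
  "\<exists>A>0. AE \<omega> in M. \<forall>\<^sub>F k in sequentially. \<forall>n\<le>2^k.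
    \<bar>\<Sum>s<n. collected (2 ^ (k div 8)) (1 + int s) (\<epsilon> (1 + int s) \<omega>) \<omega>\<bar> < A * (sqrt (2 ^ k) * sqrt (ln (real k)))"
proof -
  define v where "v = (\<Theta> 0)\<^sup>2 * (\<integral>e. (\<eta> e)\<^sup>2 \<partial>\<mu>)"
  have v: "v \<ge> 0" by (simp add: v_def)
  \<comment> \<open>With \<open>t\<^sup>2 * 2 ^ k = ln k\<close> the variance term costs
    \<open>v * ln k\<close>; the factor \<open>v + 2\<close> leaves \<open>- 2 * ln k\<close>, that
    is a summable \<open>1 / k ^ 2\<close>.\<close>
  let ?l = "\<lambda>k::nat. (v + 2) * (sqrt (2 ^ k) * sqrt (ln (real k)))"
  let ?S = "\<lambda>k n \<omega>. \<Sum>s<n. collected (2 ^ (k div 8)) (1 + int s) (\<epsilon> (1 + int s) \<omega>) \<omega>"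
  \<comment> \<open>Preparation for \<open>t * b \<le> 1\<close>: this factor and the number of lags
    are each at most \<open>2 powr (k / 4)\<close>, and the product of these bounds is
    \<open>sqrt (2 ^ k)\<close>.\<close>
  have "\<forall>\<^sub>F k in sequentially. sqrt (ln (real k)) * 2 * K \<le> 2 powr (real k / 4)" by real_asymp
  then have bound: "\<forall>\<^sub>F k in sequentially. prob {\<omega> \<in> space M. \<exists>n\<le>2^k. ?l k \<le> \<bar>?S k n \<omega>\<bar>} \<le> 2 * (1 / real k ^ 2)"
    using eventually_ge_at_top[of 2]
  proof eventually_elim
    fix k :: nat assume k: "2 \<le> k" and small: "sqrt (ln (real k)) * 2 * K \<le> 2 powr (real k / 4)"
    define t where "t = sqrt (ln (real k)) / sqrt (2 ^ k)"
    have t: "t > 0" using k by (simp add: t_def)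
    have J: "real (2 ^ (k div 8)) \<le> 2 powr (real k / 4)"
    proof -
      have "real (2 ^ (k div 8)) = 2 powr real (k div 8)" by (simp add: powr_realpow)
      also have "\<dots> \<le> 2 powr (real k / 4)" by (intro powr_mono) linarith+
      finally show ?thesis .
    qed
    have sq: "sqrt (2 ^ k) = 2 powr (real k / 4) * 2 powr (real k / 4)"
      by (simp add: powr_add[symmetric] powr_half_sqrt[symmetric] powr_realpow[symmetric] powr_powr)
    have "sqrt (ln (real k)) * 2 * K * real (2 ^ (k div 8)) \<le> sqrt (2 ^ k)"
      unfolding sq using small J K_nonneg k by (intro mult_mono) auto
    then have tb: "t * (2 * K * real (2 ^ (k div 8))) \<le> 1" by (simp add: t_def field_simps)
    have ex: "t\<^sup>2 * v * real (2 ^ k) - t * ?l k = ln (1 / real k ^ 2)"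
    proof -
      have "t\<^sup>2 * real (2 ^ k) = ln (real k)" using k by (simp add: t_def power_divide)
      moreover have "t * (sqrt (2 ^ k) * sqrt (ln (real k))) = ln (real k)" using k by (simp add: t_def)
      moreover have "t * ?l k = (v + 2) * (t * (sqrt (2 ^ k) * sqrt (ln (real k))))" by (simp only: mult_ac)
      moreover have "t\<^sup>2 * v * real (2 ^ k) = v * (t\<^sup>2 * real (2 ^ k))" by (simp only: mult_ac)
      ultimately have "t\<^sup>2 * v * real (2 ^ k) - t * ?l k = - 2 * ln (real k)"
        by (simp only: distrib_right)
      also have "\<dots> = ln (1 / real k ^ 2)" using k by (simp add: ln_div ln_realpow)
      finally show ?thesis .
    qed
    have "prob {\<omega> \<in> space M. \<exists>n\<le>2^k. ?l k \<le> \<bar>?S k n \<omega>\<bar>} \<le> 2 * exp (t\<^sup>2 * v * real (2 ^ k) - t * ?l k)"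
      by (rule exponential_maximal_inequality_abs[where h="\<lambda>s e \<omega>. collected (2 ^ (k div 8)) (1 + int s) e \<omega>" and k=1, OF _ _ _ _ t tb])
        (simp_all only: collected_measurable collected_bound collected_centred collected_variance v_def)
    also have "\<dots> = 2 * (1 / real k ^ 2)" unfolding ex using k by simp
    finally show "prob {\<omega> \<in> space M. \<exists>n\<le>2^k. ?l k \<le> \<bar>?S k n \<omega>\<bar>} \<le> 2 * (1 / real k ^ 2)" .
  qed
  have "AE \<omega> in M. \<forall>\<^sub>F k in sequentially. \<not> (\<exists>n\<le>2^k. ?l k \<le> \<bar>?S k n \<omega>\<bar>)"
  proof (rule borel_cantelli_eventually[OF _ bound])
    show "summable (\<lambda>k. 2 * (1 / real k ^ 2))"
      by (rule summable_over_square)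
  qed measurable
  then show ?thesis using v by (intro exI[of _ "v + 2"]) (simp add: not_le[symmetric] del: not_le)
qed

text \<open>For \<open>q = 2\<close> the tail from lag 0 on is already the whole sum. For
  \<open>q > 2\<close> the lags below the cutoff are reordered by innovation time instead of
  observation time, which yields the collected martingale up to boundary terms.\<close>

lemma AE_sum_rate:
  assumes tail_sums: "q > 2 \<Longrightarrow> \<exists>c. \<forall>\<^sub>F J in sequentially. \<Theta> J powr q \<le> c / ln (real J)"
  shows "\<exists>A>0. AE \<omega> in M. \<forall>\<^sub>F k in sequentially. \<forall>n\<le>2^k.
    \<bar>\<Sum>s<n. g (R (1 + int s) 1 \<omega>) - \<gamma>\<bar> \<le> A * (sqrt (2 ^ k) * block_rate q k)"
proof -
  have tail0: "g (R i 1 \<omega>) - \<gamma> = tail 0 i \<omega>" for i \<omega> by (simp add: tail_def)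
  have tr: "AE \<omega> in M. \<forall>\<^sub>F k in sequentially. \<forall>n\<le>2^k.
    \<bar>\<Sum>s<n. tail (cutoff k) (1 + int s) \<omega>\<bar> < sqrt (2 ^ k) * block_rate q k"
    by (rule AE_tail_rate[OF tail_sums])
  let ?c = "\<lambda>A \<omega> k n. \<bar>\<Sum>s<n. collected (2 ^ (k div 8)) (1 + int s) (\<epsilon> (1 + int s) \<omega>) \<omega>\<bar> < A * (sqrt (2 ^ k) * sqrt (ln (real k)))"
  show ?thesis
  proof (cases "q > 2")
    case False
    then show ?thesis
      using tr unfolding tail0
      by (intro exI[of _ 1] conjI) (auto simp: cutoff_def elim!: eventually_mono intro: less_imp_le)
  next
    case True
    obtain A where A: "A > 0" and coll: "AE \<omega> in M. \<forall>\<^sub>F k in sequentially. \<forall>n\<le>2^k. ?c A \<omega> k n"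
      using AE_collected_rate by blast
    have "AE \<omega> in M. \<forall>\<^sub>F k in sequentially. \<forall>n\<le>2^k.
      \<bar>\<Sum>s<n. g (R (1 + int s) 1 \<omega>) - \<gamma>\<bar> \<le> (A + 1 + 4 * K) * (sqrt (2 ^ k) * block_rate q k)"
      using coll tr AE_sum_d
    proof eventually_elim
      fix \<omega>
      assume c: "\<forall>\<^sub>F k in sequentially. \<forall>n\<le>2^k. ?c A \<omega> k n"
        and t: "\<forall>\<^sub>F k in sequentially. \<forall>n\<le>2^k. \<bar>\<Sum>s<n. tail (cutoff k) (1 + int s) \<omega>\<bar> < sqrt (2 ^ k) * block_rate q k"
        and s: "\<forall>i J n. (\<Sum>j=J..<J+n. d i j \<omega>) = tail J i \<omega> - tail (J + n) i \<omega>"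
      show "\<forall>\<^sub>F k in sequentially. \<forall>n\<le>2^k.
        \<bar>\<Sum>s<n. g (R (1 + int s) 1 \<omega>) - \<gamma>\<bar> \<le> (A + 1 + 4 * K) * (sqrt (2 ^ k) * block_rate q k)"
        using c t eventually_ge_at_top[of 3]
      proof (eventually_elim, intro allI impI)
        fix k n :: nat
        assume c: "\<forall>n\<le>2^k. ?c A \<omega> k n"
          and t: "\<forall>n\<le>2^k. \<bar>\<Sum>s<n. tail (cutoff k) (1 + int s) \<omega>\<bar> < sqrt (2 ^ k) * block_rate q k"
          and k: "3 \<le> k" and n: "n \<le> 2 ^ k"
        let ?J = "2 ^ (k div 8) :: nat"
        have J: "cutoff k = ?J" using True by (simp add: cutoff_def)
        have br: "block_rate q k = sqrt (ln (real k))" using True by (simp add: block_rate_def)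
        have "exp 1 \<le> (3 :: real)" by (rule exp_le)
        then have "exp 1 \<le> real k" using k by linarith
        then have "1 \<le> ln (real k)" using k by (simp add: ln_ge_iff)
        then have br1: "block_rate q k \<ge> 1" unfolding br by simp
        have s0: "(\<Sum>j<?J. d i j \<omega>) = tail 0 i \<omega> - tail ?J i \<omega>" for i
          using s[rule_format, of i 0 ?J] by (simp add: lessThan_atLeast0)
        have "(\<Sum>s<n. g (R (1 + int s) 1 \<omega>) - \<gamma>) = (\<Sum>s<n. (\<Sum>j<?J. d (1 + int s) j \<omega>)) + (\<Sum>s<n. tail ?J (1 + int s) \<omega>)"
          unfolding tail0 sum.distrib[symmetric]
          unfolding s0 by simp
        also have "(\<Sum>s<n. (\<Sum>j<?J. d (1 + int s) j \<omega>)) = (\<Sum>j<?J. \<Sum>s<n. d (1 + int s) j \<omega>)" by (rule sum.swap)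
        finally have decomp: "(\<Sum>s<n. g (R (1 + int s) 1 \<omega>) - \<gamma>) = (\<Sum>j<?J. \<Sum>s<n. d (1 + int s) j \<omega>) + (\<Sum>s<n. tail ?J (1 + int s) \<omega>)" .
        \<comment> \<open>The innovation of time \<open>1 + s\<close> acts through lag
          \<open>j\<close> on the observation \<open>Suc j\<close> steps later.\<close>
        have coll: "(\<Sum>s<n. collected ?J (1 + int s) (\<epsilon> (1 + int s) \<omega>) \<omega>) = (\<Sum>j<?J. \<Sum>s<n. d (1 + int (s + Suc j)) j \<omega>)"
          unfolding collected_def d_def by (subst sum.swap) (auto intro!: sum.cong simp: algebra_simps)
        have Jsq: "real ?J * real ?J \<le> sqrt (2 ^ k)"
        proof -
          have "real ?J * real ?J = 2 powr real (2 * (k div 8))"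
            by (simp add: powr_realpow[symmetric] powr_add[symmetric])
          also have "\<dots> \<le> 2 powr (real k / 2)" by (intro powr_mono) linarith+
          also have "\<dots> = sqrt (2 ^ k)"
            by (simp add: powr_half_sqrt[symmetric] powr_realpow[symmetric] powr_powr)
          finally show ?thesis .
        qed
        \<comment> \<open>For lag \<open>j\<close>, at most \<open>Suc j\<close> terms of size
          \<open>2 * K\<close> differ at each end; over all collected lags this is at most
          \<open>4 * K\<close> times the squared cutoff, hence of order
          \<open>sqrt (2 ^ k)\<close>.\<close>
        have "\<bar>(\<Sum>j<?J. \<Sum>s<n. d (1 + int s) j \<omega>) - (\<Sum>j<?J. \<Sum>s<n. d (1 + int (s + Suc j)) j \<omega>)\<bar>
          \<le> (\<Sum>j<?J. \<bar>(\<Sum>s<n. d (1 + int s) j \<omega>) - (\<Sum>s<n. d (1 + int (s + Suc j)) j \<omega>)\<bar>)"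
          unfolding sum_subtractf[symmetric] by (rule sum_abs)
        also have "\<dots> \<le> (\<Sum>j<?J. 4 * K * real ?J)"
        proof (rule sum_mono)
          fix j assume j: "j \<in> {..<?J}"
          have "\<bar>(\<Sum>s<n. d (1 + int s) j \<omega>) - (\<Sum>s<n. d (1 + int (s + Suc j)) j \<omega>)\<bar> \<le> 2 * real (Suc j) * (2 * K)"
            by (rule sum_shift_diff_le[where x="\<lambda>s. d (1 + int s) j \<omega>"]) (simp add: d_def D_bound)
          also have "\<dots> \<le> 2 * real ?J * (2 * K)"
            using j K_nonneg by (intro mult_right_mono mult_left_mono) (auto simp del: of_nat_power of_nat_Suc)
          finally show "\<bar>(\<Sum>s<n. d (1 + int s) j \<omega>) - (\<Sum>s<n. d (1 + int (s + Suc j)) j \<omega>)\<bar> \<le> 4 * K * real ?J"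
            by (simp add: mult_ac)
        qed
        also have "\<dots> = 4 * K * (real ?J * real ?J)" by simp
        also have "\<dots> \<le> 4 * K * (sqrt (2 ^ k) * block_rate q k)"
        proof (intro mult_left_mono)
          show "real ?J * real ?J \<le> sqrt (2 ^ k) * block_rate q k"
          proof -
            have "sqrt (2 ^ k) * 1 \<le> sqrt (2 ^ k) * block_rate q k" by (intro mult_left_mono br1) simp
            then show ?thesis using Jsq by linarith
          qed
        qed (use K_nonneg in simp)
        finally have shift: "\<bar>(\<Sum>j<?J. \<Sum>s<n. d (1 + int s) j \<omega>) - (\<Sum>j<?J. \<Sum>s<n. d (1 + int (s + Suc j)) j \<omega>)\<bar>
          \<le> 4 * K * (sqrt (2 ^ k) * block_rate q k)" .
        have "\<bar>\<Sum>j<?J. \<Sum>s<n. d (1 + int (s + Suc j)) j \<omega>\<bar> < A * (sqrt (2 ^ k) * block_rate q k)"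
          using c n unfolding coll[symmetric] br by blast
        moreover have "\<bar>\<Sum>s<n. tail ?J (1 + int s) \<omega>\<bar> < sqrt (2 ^ k) * block_rate q k"
          using t n unfolding J by blast
        ultimately show "\<bar>\<Sum>s<n. g (R (1 + int s) 1 \<omega>) - \<gamma>\<bar> \<le> (A + 1 + 4 * K) * (sqrt (2 ^ k) * block_rate q k)"
          unfolding decomp distrib_right using shift by linarith
      qed
    qed
    then show ?thesis using A K_nonneg by (intro exI[of _ "A + 1 + 4 * K"]) auto
  qed
qed

end

lemma ex_grid_cell:
  fixes r :: real
  assumes "0 \<le> r" "r \<le> real N" "N > 0"
  shows "\<exists>m<N. real m \<le> r \<and> r \<le> real (Suc m)"
proof (cases "r = real N")
  case True
  then show ?thesis using assms by (intro exI[of _ "N - 1"]) (auto simp: of_nat_diff)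
next
  case False
  then have "nat \<lfloor>r\<rfloor> < N" using assms by linarith
  moreover have "real (nat \<lfloor>r\<rfloor>) \<le> r" "r \<le> real (Suc (nat \<lfloor>r\<rfloor>))" using assms by linarith+
  ultimately show ?thesis by blast
qed

section \<open>Oscillation of the martingale part\<close>

locale smooth_linear_process = linear_process M \<epsilon> \<mu> a \<alpha> for M :: "'w measure" and \<epsilon> \<mu> a \<alpha> +
  fixes f :: "real \<Rightarrow> real" and B :: real
  assumes f_nonneg: "\<And>x. 0 \<le> f x" and f_le: "\<And>x. f x \<le> B"
    and f_lip: "\<And>x y. \<bar>f x - f y\<bar> \<le> B * \<bar>x - y\<bar>"
    and law_density: "\<mu> = density lborel (\<lambda>x. ennreal (f x))"
    and B_pos: "B > 0"
begin

lemma f_measurable [measurable]: "f \<in> borel_measurable borel"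
  by (rule lipschitz_imp_borel_measurable[OF f_lip])

section \<open>The distribution function of the innovations\<close>

definition F\<epsilon> :: "real \<Rightarrow> real" where "F\<epsilon> = cdf \<mu>"

lemma law_real_distribution: "real_distribution \<mu>"
  by (intro real_distribution.intro real_distribution_axioms.intro law.prob_space_axioms) simp

lemma F\<epsilon>_diff: "x \<le> y \<Longrightarrow> F\<epsilon> y - F\<epsilon> x = measure \<mu> {x<..y}"
proof -
  interpret real_distribution \<mu> by (rule law_real_distribution)
  show "x \<le> y \<Longrightarrow> F\<epsilon> y - F\<epsilon> x = measure \<mu> {x<..y}"
    unfolding F\<epsilon>_def by (cases "x = y") (auto simp: cdf_diff_eq)
qed

lemma measure_law:
  assumes "x \<le> y"
  shows "measure \<mu> {x<..y} = (\<integral>z. indicator {x<..y} z * f z \<partial>lborel)"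
proof -
  have "emeasure \<mu> {x<..y} = (\<integral>\<^sup>+z. ennreal (indicator {x<..y} z * f z) \<partial>lborel)"
    unfolding law_density by (subst emeasure_density) (auto intro!: nn_integral_cong simp: indicator_def)
  moreover have "(\<integral>z. indicator {x<..y} z * f z \<partial>lborel) = enn2real (\<integral>\<^sup>+z. ennreal (indicator {x<..y} z * f z) \<partial>lborel)"
    by (rule integral_eq_nn_integral) (auto simp: f_nonneg)
  ultimately show ?thesis unfolding measure_def by simp
qed

lemma integrable_indicator_f: "integrable lborel (\<lambda>z. indicator {x<..y} z * f z)"
proof (rule Bochner_Integration.integrable_bound)
  show "integrable lborel (\<lambda>z. B * indicator {x<..y} z)" by (cases "x \<le> y") auto
  show "AE z in lborel. norm (indicator {x<..y} z * f z) \<le> norm (B * indicator {x<..y} z)"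
    using f_nonneg f_le B_pos by (auto simp: indicator_def)
qed measurable

lemma F\<epsilon>_mono: "x \<le> y \<Longrightarrow> F\<epsilon> x \<le> F\<epsilon> y"
  using F\<epsilon>_diff[of x y] measure_nonneg[of \<mu> "{x<..y}"] by linarith

lemma F\<epsilon>_diff_le: "x \<le> y \<Longrightarrow> F\<epsilon> y - F\<epsilon> x \<le> B * (y - x)"
proof -
  assume le: "x \<le> y"
  have "(\<integral>z. indicator {x<..y} z * f z \<partial>lborel) \<le> (\<integral>z. B * indicator {x<..y} z \<partial>lborel)"
  proof (rule integral_mono[OF integrable_indicator_f])
    show "integrable lborel (\<lambda>z. B * indicator {x<..y} z)" using le by simp
    show "indicator {x<..y} z * f z \<le> B * indicator {x<..y} z" for z
      using f_le[of z] by (simp add: indicator_def)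
  qed
  then show ?thesis unfolding F\<epsilon>_diff[OF le] measure_law[OF le] using le by simp
qed

lemma F\<epsilon>_lip: "\<bar>F\<epsilon> x - F\<epsilon> y\<bar> \<le> B * \<bar>x - y\<bar>"
  using F\<epsilon>_diff_le[of x y] F\<epsilon>_diff_le[of y x] F\<epsilon>_mono[of x y] F\<epsilon>_mono[of y x] by (cases "x \<le> y") auto

lemma F\<epsilon>_bound: "0 \<le> F\<epsilon> x" "F\<epsilon> x \<le> 1"
  unfolding F\<epsilon>_def cdf_def by auto

lemma F\<epsilon>_measurable [measurable]: "F\<epsilon> \<in> borel_measurable borel"
  by (rule lipschitz_imp_borel_measurable[OF F\<epsilon>_lip])

text \<open>The point \<open>z\<close> is free in the interval so that expansions at the left and at
  the right endpoint both follow.\<close>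

lemma F\<epsilon>_expand_aux:
  assumes le: "x \<le> y" and z: "x \<le> z" "z \<le> y"
  shows "\<bar>F\<epsilon> y - F\<epsilon> x - (y - x) * f z\<bar> \<le> B * (y - x)\<^sup>2"
proof -
  have i: "integrable lborel (\<lambda>u. indicator {x<..y} u :: real)" using le by simp
  have "F\<epsilon> y - F\<epsilon> x - (y - x) * f z = (\<integral>u. indicator {x<..y} u * f u \<partial>lborel) - (\<integral>u. indicator {x<..y} u * f z \<partial>lborel)"
    unfolding F\<epsilon>_diff[OF le] measure_law[OF le] using le by simp
  also have "\<dots> = (\<integral>u. indicator {x<..y} u * f u - indicator {x<..y} u * f z \<partial>lborel)"
    using i by (intro Bochner_Integration.integral_diff[symmetric] integrable_indicator_f) auto
  finally have eq: "F\<epsilon> y - F\<epsilon> x - (y - x) * f z = (\<integral>u. indicator {x<..y} u * f u - indicator {x<..y} u * f z \<partial>lborel)" .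
  have "\<bar>F\<epsilon> y - F\<epsilon> x - (y - x) * f z\<bar> \<le> (\<integral>u. \<bar>indicator {x<..y} u * f u - indicator {x<..y} u * f z\<bar> \<partial>lborel)"
    unfolding eq by (rule integral_abs_bound)
  also have "\<dots> \<le> (\<integral>u. B * (y - x) * indicator {x<..y} u \<partial>lborel)"
  proof (rule integral_mono)
    show "integrable lborel (\<lambda>u. \<bar>indicator {x<..y} u * f u - indicator {x<..y} u * f z\<bar>)"
      using i by (intro integrable_abs Bochner_Integration.integrable_diff integrable_indicator_f) auto
    fix u
    have "B * \<bar>u - z\<bar> \<le> B * (y - x)" if "x < u" "u \<le> y"
      using that z B_pos by (intro mult_left_mono) auto
    then show "\<bar>indicator {x<..y} u * f u - indicator {x<..y} u * f z\<bar> \<le> B * (y - x) * indicator {x<..y} u"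
      using f_lip[of u z] by (force simp: indicator_def)
  qed (use i in simp)
  also have "\<dots> = B * (y - x)\<^sup>2" using le by (simp add: power2_eq_square)
  finally show ?thesis .
qed

lemma F\<epsilon>_expand: "\<bar>F\<epsilon> y - F\<epsilon> x - (y - x) * f x\<bar> \<le> B * (y - x)\<^sup>2"
proof (cases "x \<le> y")
  case True then show ?thesis using F\<epsilon>_expand_aux[of x y x] by simp
next
  case False
  have "F\<epsilon> y - F\<epsilon> x - (y - x) * f x = - (F\<epsilon> x - F\<epsilon> y - (x - y) * f x)" by (simp add: algebra_simps)
  then show ?thesis using False F\<epsilon>_expand_aux[of y x x] by (simp add: power2_commute)
qed

section \<open>The martingale part of the empirical process\<close>

definition W :: "real \<Rightarrow> real \<Rightarrow> real \<Rightarrow> real" where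
  "W x e y = (if e + y \<le> x then 1 else 0) - F\<epsilon> (x - y)"

definition mart :: "nat \<Rightarrow> real \<Rightarrow> 'w \<Rightarrow> real" where
  "mart n x \<omega> = (\<Sum>s<n. W x (\<epsilon> (1 + int s) \<omega>) (R (1 + int s) 1 \<omega>))"

lemma W_measurable [measurable]: "(\<lambda>z. W x (h z) (g z)) \<in> borel_measurable N"
  if [measurable]: "h \<in> borel_measurable N" "g \<in> borel_measurable N"
  unfolding W_def by measurable

lemma mart_measurable [measurable]: "mart n x \<in> borel_measurable M"
  unfolding mart_def by measurable

lemma indicator_moments:
  assumes "A \<in> sets borel"
  shows "(\<integral>e. indicator A e - measure \<mu> A \<partial>\<mu>) = 0" "(\<integral>e. (indicator A e - measure \<mu> A)\<^sup>2 \<partial>\<mu>) \<le> measure \<mu> A"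
proof -
  have i: "integrable \<mu> (\<lambda>e. indicator A e :: real)" using assms by (intro law.integrable_const_bound[where B=1]) auto
  show "(\<integral>e. indicator A e - measure \<mu> A \<partial>\<mu>) = 0" using i assms law.prob_space by simp
  have "(\<integral>e. (indicator A e - measure \<mu> A)\<^sup>2 \<partial>\<mu>) = (\<integral>e. indicator A e - 2 * measure \<mu> A * indicator A e + (measure \<mu> A)\<^sup>2 \<partial>\<mu>)"
    by (intro Bochner_Integration.integral_cong refl) (auto simp: indicator_def power2_eq_square algebra_simps)
  also have "\<dots> = measure \<mu> A - (measure \<mu> A)\<^sup>2"
    using i assms law.prob_space by (simp add: power2_eq_square)
  finally show "(\<integral>e. (indicator A e - measure \<mu> A)\<^sup>2 \<partial>\<mu>) \<le> measure \<mu> A" by simp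
qed

lemma R_section_measurable:
  assumes "(\<lambda>x. H (fst x) (snd x)) \<in> borel_measurable (borel \<Otimes>\<^sub>M borel)"
  shows "(\<lambda>(e, \<omega>). H e (R i 1 \<omega>)) \<in> borel_measurable (borel \<Otimes>\<^sub>M past i)"
proof -
  have [measurable]: "R i 1 \<in> borel_measurable (past i)" by (rule measurable_R_past) simp
  have "(\<lambda>x. (fst x, R i 1 (snd x))) \<in> measurable (borel \<Otimes>\<^sub>M past i) (borel \<Otimes>\<^sub>M borel)"
    by measurable
  from measurable_compose[OF this assms] show ?thesis by (simp add: case_prod_beta')
qed

lemma prob_mart:
  assumes "0 < t" "t \<le> 1"
  shows "prob {\<omega> \<in> space M. \<exists>n\<le>N. l \<le> \<bar>mart n x \<omega>\<bar>} \<le> 2 * exp (t\<^sup>2 * real N - t * l)"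
proof -
  have W: "W x e y = indicator {..x - y} e - measure \<mu> {..x - y}" for e y
    by (auto simp: W_def F\<epsilon>_def cdf_def indicator_def)
  have "prob {\<omega> \<in> space M. \<exists>n\<le>N. l \<le> \<bar>\<Sum>s<n. W x (\<epsilon> (1 + int s) \<omega>) (R (1 + int s) 1 \<omega>)\<bar>} \<le> 2 * exp (t\<^sup>2 * 1 * real N - t * l)"
  proof (rule exponential_maximal_inequality_abs[where h="\<lambda>s e \<omega>. W x e (R (1 + int s) 1 \<omega>)" and b=1])
    show "(\<lambda>(e, \<omega>). W x e (R (1 + int s) 1 \<omega>)) \<in> borel_measurable (borel \<Otimes>\<^sub>M past (1 + int s))" for s
      by (rule R_section_measurable) measurable
    fix s \<omega> e
    show "\<bar>W x e (R (1 + int s) 1 \<omega>)\<bar> \<le> 1"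
      using F\<epsilon>_bound[of "x - R (1 + int s) 1 \<omega>"] by (auto simp: W_def)
    show "(\<integral>e. W x e (R (1 + int s) 1 \<omega>) \<partial>\<mu>) = 0" unfolding W by (rule indicator_moments) simp
    have "(\<integral>e. (W x e (R (1 + int s) 1 \<omega>))\<^sup>2 \<partial>\<mu>) \<le> measure \<mu> {..x - R (1 + int s) 1 \<omega>}"
      unfolding W by (rule indicator_moments) simp
    also have "\<dots> \<le> 1" by simp
    finally show "(\<integral>e. (W x e (R (1 + int s) 1 \<omega>))\<^sup>2 \<partial>\<mu>) \<le> 1" .
  qed (use assms in auto)
  then show ?thesis unfolding mart_def by simp
qed

text \<open>Given the past, an increment in \<open>x\<close> is the centred indicator of a
  translated interval of length \<open>y - x\<close>, whose probability is at most
  \<open>B * (y - x)\<close> wherever it lies.\<close>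

lemma prob_mart_diff:
  assumes "0 < t" "t \<le> 1" and xy: "x \<le> y"
  shows "prob {\<omega> \<in> space M. \<exists>n\<le>N. l \<le> \<bar>mart n y \<omega> - mart n x \<omega>\<bar>} \<le> 2 * exp (t\<^sup>2 * (B * (y - x)) * real N - t * l)"
proof -
  have W: "W y e r - W x e r = indicator {x - r<..y - r} e - measure \<mu> {x - r<..y - r}" for e r
    using xy F\<epsilon>_diff[of "x - r" "y - r"] by (auto simp: W_def indicator_def)
  have "prob {\<omega> \<in> space M. \<exists>n\<le>N. l \<le> \<bar>\<Sum>s<n. W y (\<epsilon> (1 + int s) \<omega>) (R (1 + int s) 1 \<omega>) - W x (\<epsilon> (1 + int s) \<omega>) (R (1 + int s) 1 \<omega>)\<bar>}
    \<le> 2 * exp (t\<^sup>2 * (B * (y - x)) * real N - t * l)"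
  proof (rule exponential_maximal_inequality_abs[where h="\<lambda>s e \<omega>. W y e (R (1 + int s) 1 \<omega>) - W x e (R (1 + int s) 1 \<omega>)" and b=1])
    show "(\<lambda>(e, \<omega>). W y e (R (1 + int s) 1 \<omega>) - W x e (R (1 + int s) 1 \<omega>)) \<in> borel_measurable (borel \<Otimes>\<^sub>M past (1 + int s))" for s
      by (rule R_section_measurable[where H="\<lambda>e r. W y e r - W x e r"]) measurable
    fix s \<omega> e
    let ?r = "R (1 + int s) 1 \<omega>"
    have ind: "\<bar>indicator A z - p\<bar> \<le> 1" if "0 \<le> p" "p \<le> 1" for A and p z :: real
      using that by (auto simp: indicator_def abs_if)
    show "\<bar>W y e ?r - W x e ?r\<bar> \<le> 1"
      unfolding W by (rule ind) simp_all
    show "(\<integral>e. W y e ?r - W x e ?r \<partial>\<mu>) = 0" unfolding W by (rule indicator_moments) simp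
    have "(\<integral>e. (W y e ?r - W x e ?r)\<^sup>2 \<partial>\<mu>) \<le> measure \<mu> {x - ?r<..y - ?r}"
      unfolding W by (rule indicator_moments) simp
    also have "\<dots> \<le> B * (y - x)"
      using F\<epsilon>_diff[of "x - ?r" "y - ?r"] F\<epsilon>_diff_le[of "x - ?r" "y - ?r"] xy by simp
    finally show "(\<integral>e. (W y e ?r - W x e ?r)\<^sup>2 \<partial>\<mu>) \<le> B * (y - x)" .
  qed (use assms in auto)
  then show ?thesis unfolding mart_def sum_subtractf .
qed

text \<open>The count and its compensator are both nondecreasing in the argument, so inside a cell
  the martingale exceeds the endpoint increment by at most the growth of the compensator.\<close>

lemma mart_between:
  assumes "x \<le> z" "z \<le> y"
  shows "\<bar>mart n z \<omega> - mart n x \<omega>\<bar> \<le> \<bar>mart n y \<omega> - mart n x \<omega>\<bar> + real n * (B * (y - x))"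
proof -
  define ct where "ct u = (\<Sum>s<n. if \<epsilon> (1 + int s) \<omega> + R (1 + int s) 1 \<omega> \<le> u then 1 else 0 :: real)" for u
  define cp where "cp u = (\<Sum>s<n. F\<epsilon> (u - R (1 + int s) 1 \<omega>))" for u
  have m: "mart n u \<omega> = ct u - cp u" for u by (simp add: mart_def W_def ct_def cp_def sum_subtractf)
  have ct: "ct x \<le> ct z" "ct z \<le> ct y" using assms unfolding ct_def by (auto intro!: sum_mono)
  have cp: "cp x \<le> cp z" "cp z \<le> cp y" using assms unfolding cp_def by (auto intro!: sum_mono F\<epsilon>_mono)
  have "cp y - cp x = (\<Sum>s<n. F\<epsilon> (y - R (1 + int s) 1 \<omega>) - F\<epsilon> (x - R (1 + int s) 1 \<omega>))"
    by (simp add: cp_def sum_subtractf)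
  also have "\<dots> \<le> (\<Sum>s<n. B * (y - x))"
  proof (rule sum_mono)
    fix s
    show "F\<epsilon> (y - R (1 + int s) 1 \<omega>) - F\<epsilon> (x - R (1 + int s) 1 \<omega>) \<le> B * (y - x)"
      using assms F\<epsilon>_diff_le[of "x - R (1 + int s) 1 \<omega>" "y - R (1 + int s) 1 \<omega>"] by simp
  qed
  finally have "cp y - cp x \<le> real n * (B * (y - x))" by simp
  then show ?thesis unfolding m using ct cp by linarith
qed

text \<open>Chaining with thresholds decaying like \<open>(4/5) ^ j\<close>, slower than the standard deviations
  \<open>2 powr (- j / 2)\<close> of the increments at level \<open>j\<close>: the exponents then grow geometrically and beat the
  number \<open>2 ^ j\<close> of increments. The finest level \<open>J\<close> is where the exponential inequality leaves its
  Gaussian range; below it monotonicity suffices.\<close>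

lemma mart_oscillation:
  fixes x0 w :: real and k :: nat
  assumes k: "k \<ge> 3" and w: "w > 0" and big: "16 * ln (real k) \<le> B * w * 2 ^ k"
  shows "\<exists>E\<in>events. prob E \<le> 4 * (1 / real k ^ 2) \<and> (\<forall>\<omega>\<in>space M - E. \<forall>n\<le>2^k. \<forall>x\<in>{x0..x0+w}.
    \<bar>mart n x \<omega> - mart n x0 \<omega>\<bar> \<le> 128 * sqrt (B * w * 2 ^ k * ln (real k)))"
proof -
  \<comment> \<open>\<open>Q\<close> bounds the sum of the conditional variances over block and
    window.\<close>
  define Q where "Q = B * w * 2 ^ k"
  define s where "s = ln (real k)"
  have "exp 1 \<le> (3 :: real)" by (rule exp_le)
  then have "exp 1 \<le> real k" using k by linarith
  then have s1: "s \<ge> 1" using k by (simp add: s_def ln_ge_iff)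
  have Q: "Q > 0" "16 * s \<le> Q" using w B_pos big by (auto simp: Q_def s_def)
  \<comment> \<open>\<open>z\<close> equals \<open>Q / (4 * u)\<close> for the \<open>u\<close>
    below; \<open>2 ^ J \<le> z\<close> keeps every \<open>t j\<close> at most 1, and
    \<open>big\<close> makes \<open>z \<ge> 1\<close>.\<close>
  define z where "z = sqrt Q / (4 * sqrt s)"
  have "sqrt (16 * s) \<le> sqrt Q" using Q by (intro real_sqrt_le_mono)
  then have z1: "z \<ge> 1" using s1 by (simp add: z_def real_sqrt_mult)
  define J where "J = nat \<lfloor>log 2 z\<rfloor>"
  have J1: "2 ^ J \<le> z" and J2: "z < 2 ^ Suc J"
  proof -
    have l0: "log 2 z \<ge> 0" using z1 by simp
    have "real J \<le> log 2 z" "log 2 z < real (Suc J)" unfolding J_def using l0 by linarith+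
    then have "2 powr real J \<le> z" "z < 2 powr real (Suc J)"
      using z1 by (simp_all add: le_log_iff log_less_iff)
    then show "2 ^ J \<le> z" "z < 2 ^ Suc J" by (simp_all add: powr_realpow del: of_nat_Suc power_Suc)
  qed
  define u where "u = sqrt (Q * s)"
  have u: "u > 0" "u\<^sup>2 = Q * s" using Q s1 by (auto simp: u_def)
  have zu: "z * (4 * u) = Q"
    using Q s1 by (simp add: z_def u_def real_sqrt_mult)
  define c where "c j = 8 * u * (4/5) ^ j" for j :: nat
  define pt where "pt j m = x0 + w * real m / 2 ^ j" for j m :: nat
  \<comment> \<open>The minimizer of \<open>t\<^sup>2 * v - t * c j\<close> for the variance
    \<open>v = Q / 2 ^ j\<close> of an increment of level \<open>j\<close>.\<close>
  define t where "t j = c j * 2 ^ j / (2 * Q)" for j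
  have tj: "0 < t j" "t j \<le> 1" if "j \<le> J" for j
  proof -
    show "0 < t j" using u Q by (simp add: t_def c_def)
    have "c j \<le> 8 * u * 1"
      unfolding c_def using u by (intro mult_left_mono power_le_one) auto
    then have "c j * 2 ^ j \<le> 8 * u * 2 ^ J"
      using that u by (intro mult_mono power_increasing) auto
    also have "\<dots> \<le> 8 * u * z" using J1 u by (intro mult_left_mono) auto
    also have "\<dots> = 2 * Q" using zu by (simp add: algebra_simps)
    finally show "t j \<le> 1" using Q by (simp add: t_def)
  qed
  \<comment> \<open>The exponent is \<open>- 16 * s * (32/25) ^ j\<close>, where
    \<open>32/25 = 2 * (4/5)\<^sup>2\<close>. By Bernoulli's inequality it beats
    \<open>2 * s\<close>, which gives \<open>1 / k ^ 2\<close>, together with \<open>4 * j\<close>: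
    since \<open>exp (- 4) \<le> 1/5\<close>, the union over \<open>2 ^ j\<close> increments leaves
    a series of \<open>(2/5) ^ j\<close>.\<close>
  have expo: "(t j)\<^sup>2 * (B * (w / 2 ^ j)) * 2 ^ k - t j * c j \<le> - 2 * s - 4 * real j" for j
  proof -
    have "(t j)\<^sup>2 * (B * (w / 2 ^ j)) * 2 ^ k = (t j)\<^sup>2 * Q / 2 ^ j" by (simp add: Q_def)
    also have "\<dots> = (c j)\<^sup>2 * 2 ^ j / (4 * Q)"
      using Q by (simp add: t_def power2_eq_square field_simps)
    finally have e1: "(t j)\<^sup>2 * (B * (w / 2 ^ j)) * 2 ^ k = (c j)\<^sup>2 * 2 ^ j / (4 * Q)" .
    have e2: "t j * c j = 2 * ((c j)\<^sup>2 * 2 ^ j / (4 * Q))"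
      using Q by (simp add: t_def power2_eq_square)
    have e3: "(c j)\<^sup>2 * 2 ^ j / (4 * Q) = 16 * s * (32/25) ^ j"
    proof -
      have "(c j)\<^sup>2 * 2 ^ j = 64 * u\<^sup>2 * (((4/5) ^ j)\<^sup>2 * 2 ^ j)" by (simp add: c_def power_mult_distrib)
      also have "((4/5::real) ^ j)\<^sup>2 * 2 ^ j = (32/25) ^ j"
        by (simp add: power_mult[symmetric] mult.commute[of j 2] power_mult power_mult_distrib[symmetric] power_divide)
      finally show ?thesis using Q u by (simp add: field_simps)
    qed
    have eq: "(t j)\<^sup>2 * (B * (w / 2 ^ j)) * 2 ^ k - t j * c j = - (16 * s * (32/25) ^ j)"
      unfolding e1 e2 e3 by simp
    have "1 + real j * (7/25) \<le> (1 + 7/25 :: real) ^ j" by (rule Bernoulli_inequality) simp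
    then have p: "1 + real j * (7/25) \<le> (32/25 :: real) ^ j" by simp
    have "2 * s + 4 * real j \<le> 16 * s * (1 + real j * (7/25))"
    proof -
      have "real j * 1 \<le> real j * s" using s1 by (intro mult_left_mono) auto
      then show ?thesis using s1 by (simp add: algebra_simps)
    qed
    also have "\<dots> \<le> 16 * s * (32/25) ^ j" using p s1 by (intro mult_left_mono) auto
    finally show ?thesis unfolding eq by linarith
  qed
  define E0 where "E0 j m = {\<omega> \<in> space M. \<exists>n\<le>2^k. c j \<le> \<bar>mart n (pt j (Suc m)) \<omega> - mart n (pt j m) \<omega>\<bar>}" for j m
  have E0m [measurable]: "E0 j m \<in> events" for j m unfolding E0_def by measurable
  define E where "E = (\<Union>j\<le>J. \<Union>m<2^j. E0 j m)"
  have Em: "E \<in> events" unfolding E_def by measurable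
  have width: "pt j (Suc m) - pt j m = w / 2 ^ j" for j m by (simp add: pt_def field_simps)
  have pE0: "prob (E0 j m) \<le> 2 * ((1 / real k ^ 2) * (1/5) ^ j)" if "j \<le> J" for j m
  proof -
    have "prob (E0 j m) \<le> 2 * exp ((t j)\<^sup>2 * (B * (pt j (Suc m) - pt j m)) * real (2 ^ k) - t j * c j)"
      unfolding E0_def using tj[OF that] width[of j m] w by (intro prob_mart_diff) (auto simp: algebra_simps)
    also have "\<dots> \<le> 2 * exp (- 2 * s - 4 * real j)" unfolding width using expo[of j] by simp
    also have "exp (- 2 * s - 4 * real j) = exp (- 2 * s) * exp (- 4) ^ j"
      by (simp add: exp_diff exp_minus exp_of_nat_mult[symmetric] field_simps exp_add[symmetric])
    also have "exp (- 2 * s) = 1 / real k ^ 2"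
    proof -
      have "- 2 * s = ln (1 / real k ^ 2)" using k by (simp add: s_def ln_div ln_realpow)
      then show ?thesis using k by simp
    qed
    also have "2 * (1 / real k ^ 2 * exp (- 4) ^ j) \<le> 2 * ((1 / real k ^ 2) * (1/5) ^ j)"
    proof -
      have "exp (- 4) \<le> 1 / (5::real)" using exp_ge_add_one_self[of 4] by (simp add: exp_minus field_simps)
      then show ?thesis by (intro mult_left_mono power_mono) auto
    qed
    finally show ?thesis .
  qed
  have "prob E \<le> (\<Sum>j\<le>J. prob (\<Union>m<2^j. E0 j m))"
    unfolding E_def by (intro finite_measure_subadditive_finite) auto
  also have "\<dots> \<le> (\<Sum>j\<le>J. \<Sum>m<(2::nat)^j. prob (E0 j m))"
    by (intro sum_mono finite_measure_subadditive_finite) auto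
  also have "\<dots> \<le> (\<Sum>j\<le>J. \<Sum>m<(2::nat)^j. 2 * ((1 / real k ^ 2) * (1/5) ^ j))"
    by (intro sum_mono pE0) auto
  also have "\<dots> = 2 * (1 / real k ^ 2) * (\<Sum>j\<le>J. (2/5) ^ j)"
    by (simp add: sum_distrib_left power_divide mult_ac)
  also have "\<dots> \<le> 2 * (1 / real k ^ 2) * 2"
  proof (intro mult_left_mono)
    have "(\<Sum>j\<le>J. (2/5::real) ^ j) \<le> (\<Sum>j. (2/5) ^ j)" by (intro sum_le_suminf summable_geometric) auto
    also have "\<dots> \<le> 2" by (subst suminf_geometric) auto
    finally show "(\<Sum>j\<le>J. (2/5::real) ^ j) \<le> 2" .
  qed simp
  finally have pE: "prob E \<le> 4 * (1 / real k ^ 2)" by simp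
  \<comment> \<open>\<open>40\<close> for a grid point (\<open>8\<close> times the geometric sum
    \<open>5\<close>), \<open>80\<close> for the difference between the two ends of the cell,
    \<open>8\<close> for the compensator.\<close>
  have osc: "\<bar>mart n x \<omega> - mart n x0 \<omega>\<bar> \<le> 128 * u" if \<omega>: "\<omega> \<in> space M - E" and n: "n \<le> 2 ^ k" and x: "x \<in> {x0..x0+w}" for \<omega> n x
  proof -
    have sc: "(\<Sum>j\<le>J. c j) \<le> 40 * u"
    proof -
      have "(\<Sum>j\<le>J. (4/5::real) ^ j) \<le> (\<Sum>j. (4/5) ^ j)" by (intro sum_le_suminf summable_geometric) auto
      also have "\<dots> = 5" by (subst suminf_geometric) auto
      finally have "8 * u * (\<Sum>j\<le>J. (4/5::real) ^ j) \<le> 8 * u * 5" using u by (intro mult_left_mono) auto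
      then show ?thesis by (simp add: c_def sum_distrib_left)
    qed
    have grid: "\<bar>mart n (pt J m) \<omega> - mart n x0 \<omega>\<bar> \<le> 40 * u" if "m \<le> 2 ^ J" for m
    proof -
      have "\<bar>mart n (pt J m) \<omega> - mart n (pt 0 0) \<omega>\<bar> \<le> (\<Sum>j\<le>J. c j)"
      proof (rule dyadic_chaining[where g="\<lambda>j m. mart n (pt j m) \<omega>", OF _ _ that])
        show "mart n (pt (Suc j) (2 * m)) \<omega> = mart n (pt j m) \<omega>" for j m by (simp add: pt_def)
        fix j m :: nat assume "j \<le> J" "m < 2 ^ j"
        then have "\<omega> \<notin> E0 j m" using \<omega> by (auto simp: E_def)
        then show "\<bar>mart n (pt j (Suc m)) \<omega> - mart n (pt j m) \<omega>\<bar> \<le> c j"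
          using \<omega> n unfolding E0_def by (force simp: not_le)
      qed
      then show ?thesis using sc by (simp add: pt_def)
    qed
    let ?r = "(x - x0) / w * 2 ^ J"
    have "0 \<le> ?r" using x w by simp
    moreover have "?r \<le> real (2 ^ J)"
    proof -
      have "(x - x0) / w \<le> 1" using x w by (simp add: divide_le_eq)
      then have "?r \<le> 1 * 2 ^ J" by (intro mult_right_mono) auto
      then show ?thesis by simp
    qed
    ultimately obtain m where m: "m < 2 ^ J" "real m \<le> ?r" "?r \<le> real (Suc m)"
      using ex_grid_cell[of ?r "2 ^ J"] by auto
    have scale: "w / 2 ^ J * ?r = x - x0" using w by simp
    have "w / 2 ^ J * real m \<le> x - x0" using mult_left_mono[OF m(2), of "w / 2 ^ J"] w unfolding scale by simp
    then have b1: "pt J m \<le> x" by (simp add: pt_def)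
    have "x - x0 \<le> w / 2 ^ J * real (Suc m)"
      using mult_left_mono[OF m(3), of "w / 2 ^ J"] w unfolding scale by (simp del: of_nat_Suc)
    then have b2: "x \<le> pt J (Suc m)" by (simp add: pt_def del: of_nat_Suc)
    have "real n * (B * (pt J (Suc m) - pt J m)) \<le> 2 ^ k * (B * (w / 2 ^ J))"
    proof -
      have "real n \<le> 2 ^ k" using n by (metis of_nat_le_iff of_nat_numeral of_nat_power)
      then show ?thesis unfolding width using B_pos w by (intro mult_right_mono) auto
    qed
    also have "\<dots> = Q / 2 ^ J" by (simp add: Q_def)
    also have "\<dots> \<le> 8 * u"
    proof -
      have "Q = z * (4 * u)" using zu by simp
      also have "\<dots> \<le> 2 ^ Suc J * (4 * u)" using J2 u by (intro mult_right_mono) auto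
      finally show ?thesis by (simp add: field_simps)
    qed
    finally have r: "real n * (B * (pt J (Suc m) - pt J m)) \<le> 8 * u" .
    have "\<bar>mart n x \<omega> - mart n (pt J m) \<omega>\<bar> \<le> \<bar>mart n (pt J (Suc m)) \<omega> - mart n (pt J m) \<omega>\<bar> + 8 * u"
      using mart_between[OF b1 b2, of n \<omega>] r by linarith
    then show ?thesis using grid[of m] grid[of "Suc m"] m(1) by linarith
  qed
  show ?thesis
    using Em pE osc unfolding u_def Q_def s_def by (intro bexI[of _ E]) auto
qed

end

section \<open>The density and the quantiles\<close>

lemma continuous_AE_eq_imp_eq:
  fixes f g :: "real \<Rightarrow> real"
  assumes f: "continuous_on UNIV f" and g: "continuous_on UNIV g" and ae: "AE x in lborel. f x = g x"
  shows "f = g"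
proof (rule ccontr)
  assume "f \<noteq> g"
  then have ne: "{x. f x \<noteq> g x} \<noteq> {}" by auto
  have op: "open {x. f x \<noteq> g x}" by (intro open_Collect_neq f g)
  have "{x. f x \<noteq> g x} \<in> null_sets lborel"
    using ae op by (subst AE_iff_null_sets) auto
  then have "negligible {x. f x \<noteq> g x}"
    unfolding negligible_iff_null_sets by (rule null_sets_completionI)
  then show False using open_not_negligible[OF op ne] by blast
qed

lemma cont_density_eq:
  assumes nn: "\<And>x. 0 \<le> f x" and c: "continuous_on UNIV f"
    and d: "distributed M lborel Y (\<lambda>x. ennreal (f x))"
  shows "cont_density M Y = f"
  unfolding cont_density_def
proof (rule the_equality)
  fix g assume g: "(\<forall>x. 0 \<le> g x) \<and> continuous_on UNIV g \<and> distributed M lborel Y (\<lambda>x. ennreal (g x))"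
  have "AE x in lborel. ennreal (g x) = ennreal (f x)"
  proof (rule sigma_finite_measure.density_unique)
    show "sigma_finite_measure lborel" by unfold_locales
    show "density lborel (\<lambda>x. ennreal (g x)) = density lborel (\<lambda>x. ennreal (f x))"
      using g d by (metis distributed_distr_eq_density)
  qed (use g d in \<open>auto dest: distributed_borel_measurable\<close>)
  then have "AE x in lborel. g x = f x"
    using g nn by (auto elim!: eventually_mono)
  then show "g = f" using g c continuous_AE_eq_imp_eq by blast
qed (use assms in auto)

lemma quantile_bracket:
  fixes G :: "real \<Rightarrow> real"
  assumes "mono G" "G l < p" "p \<le> G u"
  shows "l \<le> quantile G p" "quantile G p \<le> u"
proof -
  have lb: "l \<le> x" if "p \<le> G x" for x using that assms(2) monoD[OF assms(1), of x l] by linarith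
  show "l \<le> quantile G p" unfolding quantile_def using assms lb by (intro cInf_greatest) auto
  show "quantile G p \<le> u" unfolding quantile_def using assms lb by (intro cInf_lower bdd_belowI[of _ l]) auto
qed

text \<open>\<open>G\<close> may jump at its quantile, so it need not equal \<open>p\<close> there.
  But \<open>G < p\<close> to the left and \<open>G \<ge> p\<close> to the right; the linear
  approximation is inserted at such points, for which the strict inequality in \<open>near\<close>
  leaves room, and one-sided limits are taken. The size of the jump never enters.\<close>

lemma quantile_linearization:
  fixes G :: "real \<Rightarrow> real"
  assumes mono: "mono G" and ne: "p \<le> G u" and bd: "G l < p" and \<phi>: "\<phi> > 0" and \<rho>: "0 < \<rho>"
    and near: "\<bar>quantile G p - \<xi>\<bar> < \<rho>"
    and lin: "\<And>x. \<bar>x - \<xi>\<bar> \<le> \<rho> \<Longrightarrow> \<bar>G x - G \<xi> - (x - \<xi>) * \<phi>\<bar> \<le> E"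
  shows "\<bar>quantile G p - (\<xi> + (p - G \<xi>) / \<phi>)\<bar> \<le> E / \<phi>"
proof -
  let ?t = "quantile G p"
  have lb: "l \<le> x" if "p \<le> G x" for x using that bd monoD[OF mono, of x l] by linarith
  have below: "G x < p" if "x < ?t" for x
  proof (rule ccontr)
    assume "\<not> G x < p"
    then have "?t \<le> x" unfolding quantile_def using lb by (intro cInf_lower bdd_belowI[of _ l]) auto
    then show False using that by simp
  qed
  have above: "p \<le> G x" if x: "?t < x" for x
  proof -
    obtain y where "p \<le> G y" "y < x"
      using x unfolding quantile_def by (subst (asm) cInf_less_iff) (use ne lb in \<open>auto intro: bdd_belowI[of _ l]\<close>)
    then show ?thesis using monoD[OF mono, of y x] by linarith
  qed
  have "(?t - \<xi>) * \<phi> \<le> p - G \<xi> + E"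
  proof (rule tendsto_upperbound)
    show "((\<lambda>x. (x - \<xi>) * \<phi>) \<longlongrightarrow> (?t - \<xi>) * \<phi>) (at_left ?t)" by (intro tendsto_intros)
    have "\<forall>\<^sub>F x in at_left ?t. x \<in> {\<xi> - \<rho><..<?t}" using near by (intro eventually_at_left_real) linarith
    then show "\<forall>\<^sub>F x in at_left ?t. (x - \<xi>) * \<phi> \<le> p - G \<xi> + E"
    proof eventually_elim
      fix x assume x: "x \<in> {\<xi> - \<rho><..<?t}"
      then have "\<bar>x - \<xi>\<bar> \<le> \<rho>" using near by auto
      from lin[OF this] below[of x] x show "(x - \<xi>) * \<phi> \<le> p - G \<xi> + E" by auto
    qed
  qed simp
  moreover have "p - G \<xi> - E \<le> (?t - \<xi>) * \<phi>"
  proof (rule tendsto_lowerbound)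
    show "((\<lambda>x. (x - \<xi>) * \<phi>) \<longlongrightarrow> (?t - \<xi>) * \<phi>) (at_right ?t)" by (intro tendsto_intros)
    have "\<forall>\<^sub>F x in at_right ?t. x \<in> {?t<..<\<xi> + \<rho>}" using near by (intro eventually_at_right_real) linarith
    then show "\<forall>\<^sub>F x in at_right ?t. p - G \<xi> - E \<le> (x - \<xi>) * \<phi>"
    proof eventually_elim
      fix x assume x: "x \<in> {?t<..<\<xi> + \<rho>}"
      then have "\<bar>x - \<xi>\<bar> \<le> \<rho>" using near by auto
      from lin[OF this] above[of x] x show "p - G \<xi> - E \<le> (x - \<xi>) * \<phi>" by auto
    qed
  qed simp
  ultimately have "\<bar>(?t - \<xi>) * \<phi> - (p - G \<xi>)\<bar> \<le> E" by (simp add: abs_le_iff)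
  then have "\<bar>(?t - \<xi>) * \<phi> - (p - G \<xi>)\<bar> / \<phi> \<le> E / \<phi>" using \<phi> by (intro divide_right_mono) auto
  moreover have "?t - (\<xi> + (p - G \<xi>) / \<phi>) = ((?t - \<xi>) * \<phi> - (p - G \<xi>)) / \<phi>" using \<phi> by (simp add: field_simps)
  ultimately show ?thesis using \<phi> by (simp add: abs_divide)
qed

text \<open>Closedness of \<open>{x. p \<le> F x}\<close> gives one inequality, a point from the
  intermediate value theorem the other.\<close>

lemma quantile_continuous:
  fixes F :: "real \<Rightarrow> real"
  assumes mono: "mono F" and cont: "continuous_on UNIV F"
    and bot: "(F \<longlongrightarrow> 0) at_bot" and top: "(F \<longlongrightarrow> 1) at_top" and p: "0 < p" "p < 1"
  shows "F (quantile F p) = p"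
proof -
  obtain l where l: "F l < p"
    using order_tendstoD(2)[OF bot p(1)] by (auto simp: eventually_at_bot_linorder)
  obtain u where u: "p < F u"
    using order_tendstoD(1)[OF top p(2)] by (auto simp: eventually_at_top_linorder)
  have lb: "l \<le> x" if "p \<le> F x" for x using that l monoD[OF mono, of x l] by linarith
  have "closed {x. p \<le> F x}" by (intro closed_Collect_le continuous_on_const cont)
  then have mem: "p \<le> F (quantile F p)"
  proof -
    have "bdd_below {x. p \<le> F x}" using lb by (auto intro: bdd_belowI[of _ l])
    moreover have "{x. p \<le> F x} \<noteq> {}" using u by (auto intro: less_imp_le)
    ultimately show ?thesis
      using closed_contains_Inf[OF _ _ \<open>closed {x. p \<le> F x}\<close>] unfolding quantile_def by blast
  qed
  have lu: "l \<le> u" using lb[of u] u by simp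
  obtain x where x: "F x = p"
    using IVT'[of F l p u] l u lu continuous_on_subset[OF cont] by (auto intro: less_imp_le)
  have "quantile F p \<le> x"
    unfolding quantile_def using x lb by (intro cInf_lower bdd_belowI[of _ l]) auto
  then have "F (quantile F p) \<le> p" using monoD[OF mono, of "quantile F p" x] x by simp
  then show ?thesis using mem by simp
qed

section \<open>The marginal law of the process\<close>

locale unit_linear_process = smooth_linear_process M \<epsilon> \<mu> a \<alpha> f B for M :: "'w measure" and \<epsilon> \<mu> a \<alpha> f B +
  assumes a0: "a 0 = 1"
begin

text \<open>The innovation density averaged over the law of \<open>R 0 1\<close>. It is continuous,
  hence the version that \<open>cont_density\<close> selects.\<close>

definition fX :: "real \<Rightarrow> real" where "fX x = (\<integral>\<omega>. f (x - R 0 1 \<omega>) \<partial>M)"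

lemma f_R_integrable: "integrable M (\<lambda>\<omega>. f (x - R i 1 \<omega>))"
  by (rule integrable_const_bound[where B=B]) (use f_nonneg f_le in auto)

lemma AE_X: "AE \<omega> in M. \<forall>i. R i 0 \<omega> = \<epsilon> i \<omega> + R i 1 \<omega>"
  using AE_R_Suc
proof (eventually_elim, intro allI)
  fix \<omega> i assume R: "\<forall>i j. R i j \<omega> = a j * \<epsilon> (i - int j) \<omega> + R i (Suc j) \<omega>"
  show "R i 0 \<omega> = \<epsilon> i \<omega> + R i 1 \<omega>" using R[rule_format, of i 0] a0 by simp
qed

lemma fX_nonneg: "0 \<le> fX x"
  unfolding fX_def using f_nonneg by (intro integral_nonneg_AE) auto

lemma integral_R_lip:
  assumes b: "\<And>x. \<bar>g x\<bar> \<le> K" and lip: "\<And>x y. \<bar>g x - g y\<bar> \<le> L * \<bar>x - y\<bar>"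
  shows "\<bar>(\<integral>\<omega>. g (x - R 0 1 \<omega>) \<partial>M) - (\<integral>\<omega>. g (y - R 0 1 \<omega>) \<partial>M)\<bar> \<le> L * \<bar>x - y\<bar>"
proof -
  have [measurable]: "g \<in> borel_measurable borel" by (rule lipschitz_imp_borel_measurable[OF lip])
  have I: "integrable M (\<lambda>\<omega>. g (x - R 0 1 \<omega>))" for x
    by (rule integrable_const_bound[where B=K]) (use b in auto)
  have "\<bar>(\<integral>\<omega>. g (x - R 0 1 \<omega>) \<partial>M) - (\<integral>\<omega>. g (y - R 0 1 \<omega>) \<partial>M)\<bar>
    = \<bar>\<integral>\<omega>. g (x - R 0 1 \<omega>) - g (y - R 0 1 \<omega>) \<partial>M\<bar>"
    using I by simp
  also have "\<dots> \<le> (\<integral>\<omega>. \<bar>g (x - R 0 1 \<omega>) - g (y - R 0 1 \<omega>)\<bar> \<partial>M)" by (rule integral_abs_bound)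
  also have "\<dots> \<le> (\<integral>\<omega>. L * \<bar>x - y\<bar> \<partial>M)"
  proof (rule integral_mono)
    show "\<bar>g (x - R 0 1 \<omega>) - g (y - R 0 1 \<omega>)\<bar> \<le> L * \<bar>x - y\<bar>" for \<omega>
      using lip[of "x - R 0 1 \<omega>" "y - R 0 1 \<omega>"] by simp
  qed (intro integrable_abs Bochner_Integration.integrable_diff I integrable_const)+
  finally show ?thesis using prob_space by simp
qed

lemma fX_continuous: "continuous_on UNIV fX"
  unfolding fX_def using f_nonneg f_le
  by (intro lipschitz_imp_continuous[of _ B] integral_R_lip[where K=B] f_lip) auto

text \<open>Almost surely \<open>R 0 0 = \<epsilon> 0 + R 0 1\<close>, and \<open>R 0 1\<close>
  belongs to \<open>past 0\<close>. Integrating out \<open>\<epsilon> 0\<close>, translating and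
  exchanging the integrals yields the convolution.\<close>

lemma distributed_X: "distributed M lborel (R 0 0) (\<lambda>x. ennreal (fX x))"
  unfolding distributed_def
proof (intro conjI)
  have [measurable]: "fX \<in> borel_measurable borel" by (intro borel_measurable_continuous_onI fX_continuous)
  then show "(\<lambda>x. ennreal (fX x)) \<in> borel_measurable lborel" by simp
  show "R 0 0 \<in> measurable M lborel" by simp
  show "distr M lborel (R 0 0) = density lborel (\<lambda>x. ennreal (fX x))"
  proof (rule measure_eqI)
    fix A :: "real set" assume "A \<in> sets (distr M lborel (R 0 0))"
    then have A [measurable]: "A \<in> sets borel" by simp
    let ?\<phi> = "\<lambda>(e, \<omega>). indicator A (e + R 0 1 \<omega>) :: ennreal"
    have [measurable]: "R 0 1 \<in> borel_measurable (past 0)" by (rule measurable_R_past) simp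
    have \<phi>: "?\<phi> \<in> borel_measurable (borel \<Otimes>\<^sub>M past 0)" unfolding case_prod_beta' by measurable
    have "emeasure (distr M lborel (R 0 0)) A = (\<integral>\<^sup>+\<omega>. indicator A (R 0 0 \<omega>) \<partial>M)"
    proof -
      have "emeasure (distr M lborel (R 0 0)) A = emeasure M (R 0 0 -` A \<inter> space M)"
        by (rule emeasure_distr) auto
      also have "\<dots> = (\<integral>\<^sup>+\<omega>. indicator (R 0 0 -` A \<inter> space M) \<omega> \<partial>M)"
        by (rule nn_integral_indicator[symmetric]) measurable
      also have "\<dots> = (\<integral>\<^sup>+\<omega>. indicator A (R 0 0 \<omega>) \<partial>M)"
        by (intro nn_integral_cong) (auto simp: indicator_def)
      finally show ?thesis .
    qed
    also have "\<dots> = (\<integral>\<^sup>+\<omega>. ?\<phi> (\<epsilon> 0 \<omega>, \<omega>) \<partial>M)"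
      using AE_X by (intro nn_integral_cong_AE) (auto elim!: eventually_mono)
    also have "\<dots> = (\<integral>\<^sup>+\<omega>. \<integral>\<^sup>+e. ?\<phi> (e, \<omega>) \<partial>\<mu> \<partial>M)" by (rule nn_integral_decouple[OF \<phi>])
    also have "\<dots> = (\<integral>\<^sup>+\<omega>. \<integral>\<^sup>+x. ennreal (f (x - R 0 1 \<omega>)) * indicator A x \<partial>lborel \<partial>M)"
    proof (rule nn_integral_cong)
      fix \<omega>
      have "(\<integral>\<^sup>+e. ?\<phi> (e, \<omega>) \<partial>\<mu>) = (\<integral>\<^sup>+e. ennreal (f e) * indicator A (e + R 0 1 \<omega>) \<partial>lborel)"
        unfolding law_density by (subst nn_integral_density) auto
      also have "\<dots> = (\<integral>\<^sup>+x. ennreal (f (x - R 0 1 \<omega>)) * indicator A x \<partial>lborel)"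
        using nn_integral_real_affine[of "\<lambda>e. ennreal (f e) * indicator A (e + R 0 1 \<omega>)" 1 "- R 0 1 \<omega>"]
        by (simp add: ac_simps)
      finally show "(\<integral>\<^sup>+e. ?\<phi> (e, \<omega>) \<partial>\<mu>) = (\<integral>\<^sup>+x. ennreal (f (x - R 0 1 \<omega>)) * indicator A x \<partial>lborel)" .
    qed
    also have "\<dots> = (\<integral>\<^sup>+x. \<integral>\<^sup>+\<omega>. ennreal (f (x - R 0 1 \<omega>)) * indicator A x \<partial>M \<partial>lborel)"
    proof -
      interpret pair_sigma_finite M lborel ..
      show ?thesis
        by (rule Fubini'[where f="\<lambda>\<omega> x. ennreal (f (x - R 0 1 \<omega>)) * indicator A x", symmetric]) measurable
    qed
    also have "\<dots> = (\<integral>\<^sup>+x. ennreal (fX x) * indicator A x \<partial>lborel)"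
    proof (rule nn_integral_cong)
      fix x
      have "(\<integral>\<^sup>+\<omega>. ennreal (f (x - R 0 1 \<omega>)) * indicator A x \<partial>M) = (\<integral>\<^sup>+\<omega>. ennreal (f (x - R 0 1 \<omega>)) \<partial>M) * indicator A x"
        by (rule nn_integral_multc) measurable
      also have "(\<integral>\<^sup>+\<omega>. ennreal (f (x - R 0 1 \<omega>)) \<partial>M) = ennreal (fX x)"
        unfolding fX_def using f_nonneg f_R_integrable by (intro nn_integral_eq_integral) auto
      finally show "(\<integral>\<^sup>+\<omega>. ennreal (f (x - R 0 1 \<omega>)) * indicator A x \<partial>M) = ennreal (fX x) * indicator A x" .
    qed
    also have "\<dots> = emeasure (density lborel (\<lambda>x. ennreal (fX x))) A"
      by (subst emeasure_density) auto
    finally show "emeasure (distr M lborel (R 0 0)) A = emeasure (density lborel (\<lambda>x. ennreal (fX x))) A" .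
  qed simp
qed

lemma cont_density_X: "cont_density M (R 0 0) = fX"
  by (rule cont_density_eq[OF fX_nonneg fX_continuous distributed_X])

lemma dist_fun_X: "dist_fun M (R 0 0) x = (\<integral>\<omega>. F\<epsilon> (x - R 0 1 \<omega>) \<partial>M)"
proof -
  let ?\<phi> = "\<lambda>(e, \<omega>). indicator {..x} (e + R 0 1 \<omega>) :: real"
  have [measurable]: "R 0 1 \<in> borel_measurable (past 0)" by (rule measurable_R_past) simp
  have \<phi>: "?\<phi> \<in> borel_measurable (borel \<Otimes>\<^sub>M past 0)" unfolding case_prod_beta' by measurable
  have "dist_fun M (R 0 0) x = (\<integral>\<omega>. indicator {..x} (R 0 0 \<omega>) \<partial>M)"
  proof -
    have "dist_fun M (R 0 0) x = measure M (R 0 0 -` {..x} \<inter> space M)"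
      unfolding dist_fun_def cdf_def by (rule measure_distr) auto
    also have "\<dots> = (\<integral>\<omega>. indicator (R 0 0 -` {..x} \<inter> space M) \<omega> \<partial>M)" by simp
    also have "\<dots> = (\<integral>\<omega>. indicator {..x} (R 0 0 \<omega>) \<partial>M)"
      by (intro Bochner_Integration.integral_cong refl) (auto simp: indicator_def)
    finally show ?thesis .
  qed
  also have "\<dots> = (\<integral>\<omega>. ?\<phi> (\<epsilon> 0 \<omega>, \<omega>) \<partial>M)"
    using AE_X by (intro integral_cong_AE) (auto elim!: eventually_mono)
  also have "\<dots> = (\<integral>\<omega>. \<integral>e. ?\<phi> (e, \<omega>) \<partial>\<mu> \<partial>M)"
    by (rule integral_decouple[OF \<phi>, where c=1]) (auto simp: indicator_def)
  also have "\<dots> = (\<integral>\<omega>. F\<epsilon> (x - R 0 1 \<omega>) \<partial>M)"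
  proof (rule Bochner_Integration.integral_cong[OF refl])
    fix \<omega>
    have "(\<integral>e. ?\<phi> (e, \<omega>) \<partial>\<mu>) = (\<integral>e. indicator {..x - R 0 1 \<omega>} e \<partial>\<mu>)"
      by (intro Bochner_Integration.integral_cong refl) (auto simp: indicator_def)
    also have "\<dots> = F\<epsilon> (x - R 0 1 \<omega>)" by (simp add: F\<epsilon>_def cdf_def)
    finally show "(\<integral>e. ?\<phi> (e, \<omega>) \<partial>\<mu>) = F\<epsilon> (x - R 0 1 \<omega>)" .
  qed
  finally show ?thesis .
qed

lemma dist_fun_X_quantile:
  assumes "0 < p" "p < 1"
  shows "dist_fun M (R 0 0) (quantile (dist_fun M (R 0 0)) p) = p"
proof -
  interpret D: real_distribution "distr M borel (R 0 0)"
    by (rule real_distribution_distr) simp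
  show ?thesis
  proof (rule quantile_continuous)
    show "mono (dist_fun M (R 0 0))" unfolding dist_fun_def by (intro monoI D.cdf_nondecreasing)
    show "continuous_on UNIV (dist_fun M (R 0 0))"
      unfolding dist_fun_X[abs_def] using F\<epsilon>_bound
      by (intro lipschitz_imp_continuous[of _ B] integral_R_lip[where K=1] F\<epsilon>_lip) auto
    show "(dist_fun M (R 0 0) \<longlongrightarrow> 0) at_bot" unfolding dist_fun_def by (rule D.cdf_lim_at_bot)
    show "(dist_fun M (R 0 0) \<longlongrightarrow> 1) at_top" unfolding dist_fun_def by (rule D.cdf_lim_at_top_prob)
  qed (use assms in auto)
qed

end

section \<open>From dyadic blocks to rates in the sample size\<close>

lemma eventually_dyadic:
  assumes "\<forall>\<^sub>F k in sequentially. \<forall>n. 2 ^ k \<le> n \<longrightarrow> n \<le> 2 ^ Suc k \<longrightarrow> P n"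
  shows "\<forall>\<^sub>F n in sequentially. P (n::nat)"
proof -
  obtain k0 where k0: "\<And>k n. k0 \<le> k \<Longrightarrow> 2 ^ k \<le> n \<Longrightarrow> n \<le> 2 ^ Suc k \<Longrightarrow> P n"
    using assms unfolding eventually_sequentially by blast
  have "P n" if n: "2 ^ k0 \<le> n" for n
  proof -
    obtain k where k: "2 ^ k \<le> n" "n < 2 ^ (k + 1)"
    proof -
      have "1 \<le> (2::nat) ^ k0" by simp
      then have "1 \<le> n" using n by linarith
      then show thesis using ex_power_ivl1[of 2 n] that by auto
    qed
    have "(2::nat) ^ k0 < 2 ^ (k + 1)" using n k by linarith
    then have "k0 < k + 1" by (rule power_less_imp_less_exp[rotated]) simp
    then show "P n" using k0[of k n] k by simp
  qed
  then show ?thesis unfolding eventually_sequentially by blast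
qed

lemma ln_dyadic:
  assumes "2 ^ k \<le> (n::nat)" shows "real k * ln 2 \<le> ln (real n)"
proof -
  have "real k * ln 2 = ln (2 ^ k)" by (simp add: ln_realpow)
  also have "\<dots> \<le> ln (real n)"
  proof (rule ln_mono)
    show "2 ^ k \<le> real n" using assms by (metis of_nat_le_iff of_nat_numeral of_nat_power)
  qed simp
  finally show ?thesis .
qed

lemma sqrt_dyadic:
  assumes "2 ^ k \<le> (n::nat)" shows "sqrt (2 ^ Suc k) \<le> 2 * sqrt (real n)"
proof -
  have "2 ^ k \<le> real n" using assms by (metis of_nat_le_iff of_nat_numeral of_nat_power)
  then have "2 ^ Suc k \<le> 4 * real n" unfolding power_Suc by linarith
  then have "sqrt (2 ^ Suc k) \<le> sqrt (4 * real n)" by (rule real_sqrt_le_mono)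
  then show ?thesis by (simp add: real_sqrt_mult)
qed

lemma ln_Suc_dyadic:
  "\<forall>\<^sub>F k in sequentially. \<forall>n. 2 ^ k \<le> n \<longrightarrow> ln (real (Suc k)) \<le> 4 * ln (ln (real n))"
proof -
  have "\<forall>\<^sub>F k in sequentially. ln (real k + 1) \<le> 4 * ln (real k * ln 2)" by real_asymp
  then show ?thesis
    using eventually_gt_at_top[of 0]
  proof (eventually_elim, intro allI impI)
    fix k n :: nat assume h: "ln (real k + 1) \<le> 4 * ln (real k * ln 2)" "0 < k" "2 ^ k \<le> n"
    have "ln (real k * ln 2) \<le> ln (ln (real n))" using ln_dyadic[OF h(3)] h(2) by (intro ln_mono) auto
    then show "ln (real (Suc k)) \<le> 4 * ln (ln (real n))" using h(1) by (simp add: add.commute)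
  qed
qed

text \<open>Sample sizes between \<open>2 ^ k\<close> and \<open>2 ^ Suc k\<close> are handled
  inside block \<open>Suc k\<close>, hence the shift; the comparison rests on
  \<open>k * ln 2 \<le> ln n\<close>.\<close>

lemma block_rate_le_ell:
  assumes "q \<ge> 2"
  shows "\<forall>\<^sub>F k in sequentially. \<forall>n. 2 ^ k \<le> n \<longrightarrow> block_rate q (Suc k) \<le> 8 * ell q n"
proof (cases "q > 2")
  case True
  show ?thesis using ln_Suc_dyadic
  proof (eventually_elim, intro allI impI)
    fix k n :: nat assume h: "\<forall>n. 2 ^ k \<le> n \<longrightarrow> ln (real (Suc k)) \<le> 4 * ln (ln (real n))" "2 ^ k \<le> n"
    have "sqrt (ln (real (Suc k))) \<le> sqrt (4 * ln (ln (real n)))" using h by (intro real_sqrt_le_mono) blast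
    also have "\<dots> = 2 * sqrt (ln (ln (real n)))" by (simp add: real_sqrt_mult)
    finally have le: "sqrt (ln (real (Suc k))) \<le> 2 * sqrt (ln (ln (real n)))" .
    moreover have "0 \<le> sqrt (ln (real (Suc k)))" by simp
    ultimately show "block_rate q (Suc k) \<le> 8 * ell q n"
      using True unfolding block_rate_def ell_def by (simp del: of_nat_Suc real_sqrt_ge_0_iff)
  qed
next
  case False
  have "\<forall>\<^sub>F k in sequentially. (real k + 1) powr (3/2) * ln (real k + 1) \<le> 8 * ((real k * ln 2) powr (3/2) * ln (real k * ln 2))"
    using eventually_ge_at_top[of 4]
  proof eventually_elim
    fix k :: nat assume k: "4 \<le> k"
    define y where "y = real k * ln 2"
    have "real k * (2/3) \<le> y" unfolding y_def using ln2_ge_two_thirds by (intro mult_left_mono) auto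
    then have y: "real k + 1 \<le> 2 * y" "2 \<le> y" using k by linarith+
    have "(real k + 1) powr (3/2) \<le> (2 * y) powr (3/2)" using y by (intro powr_mono2) auto
    also have "\<dots> = 2 powr (3/2) * y powr (3/2)" by (rule powr_mult)
    also have "\<dots> \<le> 2 powr 2 * y powr (3/2)" by (intro mult_right_mono powr_mono) auto
    finally have 1: "(real k + 1) powr (3/2) \<le> 4 * y powr (3/2)" by simp
    have "ln (real k + 1) \<le> ln (2 * y)" using y by (intro ln_mono) auto
    also have "\<dots> = ln 2 + ln y" using y by (intro ln_mult_pos) auto
    also have "\<dots> \<le> ln y + ln y" using y by (intro add_right_mono ln_mono) auto
    finally have 2: "ln (real k + 1) \<le> 2 * ln y" by simp
    have "(real k + 1) powr (3/2) * ln (real k + 1) \<le> (4 * y powr (3/2)) * (2 * ln y)"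
      by (intro mult_mono 1 2) auto
    then show "(real k + 1) powr (3/2) * ln (real k + 1) \<le> 8 * ((real k * ln 2) powr (3/2) * ln (real k * ln 2))"
      unfolding y_def by simp
  qed
  moreover have "\<forall>\<^sub>F k in sequentially. 0 \<le> ln (real k * ln 2)" by real_asymp
  ultimately show ?thesis using eventually_gt_at_top[of 0]
  proof (eventually_elim, intro allI impI)
    fix k n :: nat
    assume h: "(real k + 1) powr (3/2) * ln (real k + 1) \<le> 8 * ((real k * ln 2) powr (3/2) * ln (real k * ln 2))"
      "0 \<le> ln (real k * ln 2)" "0 < k" "2 ^ k \<le> n"
    have l: "real k * ln 2 \<le> ln (real n)" by (rule ln_dyadic[OF h(4)])
    have "(real k * ln 2) powr (3/2) * ln (real k * ln 2) \<le> ln (real n) powr (3/2) * ln (ln (real n))"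
      using l h by (intro mult_mono powr_mono2 ln_mono) auto
    then show "block_rate q (Suc k) \<le> 8 * ell q n"
      using h(1) False unfolding block_rate_def ell_def by (simp add: add.commute)
  qed
qed

text \<open>The converse comparison: it puts the window belonging to \<open>n\<close> inside the
  window fixed for the block.\<close>

lemma ell_le_block_rate:
  "\<forall>\<^sub>F k in sequentially. \<forall>n. 2 ^ k \<le> n \<longrightarrow> n \<le> 2 ^ Suc k \<longrightarrow> ell q n \<le> block_rate q (Suc k)"
proof -
  have "\<forall>\<^sub>F k in sequentially. 1 \<le> real k * ln 2" by real_asymp
  then show ?thesis
  proof (eventually_elim, intro allI impI)
    fix k n :: nat assume k: "1 \<le> real k * ln 2" and n: "2 ^ k \<le> n" "n \<le> 2 ^ Suc k"
    have l1: "1 \<le> ln (real n)" using ln_dyadic[OF n(1)] k by linarith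
    have n0: "real n > 0" using n(1) by (auto intro: gr0I)
    have "real n \<le> 2 ^ Suc k" using n(2) by (metis of_nat_le_iff of_nat_numeral of_nat_power)
    then have "ln (real n) \<le> ln (2 ^ Suc k)" using n0 by (intro ln_mono) auto
    also have "\<dots> = real (Suc k) * ln 2" by (rule ln_realpow)
    also have "\<dots> \<le> real (Suc k) * 1" using ln_2_less_1 by (intro mult_left_mono) auto
    finally have l2: "ln (real n) \<le> real (Suc k)" by simp
    have l3: "ln (ln (real n)) \<le> ln (real (Suc k))" using l1 l2 by (intro ln_mono) auto
    have l4: "0 \<le> ln (ln (real n))" using l1 by simp
    show "ell q n \<le> block_rate q (Suc k)"
      unfolding ell_def block_rate_def using l1 l2 l3 l4
      by (auto simp del: of_nat_Suc intro!: mult_mono powr_mono2)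
  qed
qed

lemma eventually_block_rate_ge:
  "\<forall>\<^sub>F k in sequentially. 1 \<le> block_rate q k \<and> sqrt (ln (real k)) \<le> block_rate q k"
proof (cases "q > 2")
  case True
  have "\<forall>\<^sub>F k in sequentially. 1 \<le> sqrt (ln (real k))" by real_asymp
  then show ?thesis using True by (simp add: block_rate_def)
next
  case False
  have "\<forall>\<^sub>F k in sequentially. 1 \<le> real k powr (3/2) * ln (real k)" by real_asymp
  moreover have "\<forall>\<^sub>F k in sequentially. sqrt (ln (real k)) \<le> real k powr (3/2) * ln (real k)" by real_asymp
  ultimately show ?thesis using False by (simp add: block_rate_def eventually_conj_iff)
qed

text \<open>The factor \<open>16\<close> is \<open>2\<close> from \<open>sqrt_dyadic\<close> times
  \<open>8\<close> from \<open>block_rate_le_ell\<close>.\<close>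

lemma block_to_rate:
  fixes Y :: "nat \<Rightarrow> real"
  assumes Y: "\<forall>\<^sub>F k in sequentially. \<forall>n\<le>2^k. Y n \<le> A * (sqrt (2 ^ k) * block_rate q k)" and A: "A > 0" and q: "q \<ge> 2"
  shows "\<forall>\<^sub>F n in sequentially. Y n \<le> 16 * A * (sqrt (real n) * ell q n)"
proof (rule eventually_dyadic)
  show "\<forall>\<^sub>F k in sequentially. \<forall>n. 2 ^ k \<le> n \<longrightarrow> n \<le> 2 ^ Suc k \<longrightarrow> Y n \<le> 16 * A * (sqrt (real n) * ell q n)"
    using eventually_sequentially_Suc[THEN iffD2, OF Y] eventually_sequentially_Suc[THEN iffD2, OF eventually_block_rate_ge[of q]]
      block_rate_le_ell[OF q]
  proof (eventually_elim, intro allI impI)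
    fix k n :: nat
    assume h: "\<forall>n\<le>2 ^ Suc k. Y n \<le> A * (sqrt (2 ^ Suc k) * block_rate q (Suc k))"
      "1 \<le> block_rate q (Suc k) \<and> sqrt (ln (real (Suc k))) \<le> block_rate q (Suc k)"
      "\<forall>n. 2 ^ k \<le> n \<longrightarrow> block_rate q (Suc k) \<le> 8 * ell q n" and n: "2 ^ k \<le> n" "n \<le> 2 ^ Suc k"
    have "Y n \<le> A * (sqrt (2 ^ Suc k) * block_rate q (Suc k))" using h n by blast
    also have "\<dots> \<le> A * ((2 * sqrt (real n)) * (8 * ell q n))"
      using h n A by (intro mult_left_mono mult_mono sqrt_dyadic) auto
    finally show "Y n \<le> 16 * A * (sqrt (real n) * ell q n)" by simp
  qed
qed

text \<open>\<open>n\<close> times the error rate of the Bahadur representation. In a window of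
  width \<open>ell q n / sqrt n\<close>, \<open>n\<close> observations have a variance of order
  \<open>sqrt n * ell q n\<close>; the iterated logarithm comes from the exponential
  inequality.\<close>

definition osc_rate :: "real \<Rightarrow> nat \<Rightarrow> real" where
  "osc_rate q n = sqrt (sqrt (real n) * ell q n * ln (ln (real n)))"

lemma eventually_ell_pos: "\<forall>\<^sub>F n in sequentially. 0 < ell q n"
proof (cases "q > 2")
  case True
  have "\<forall>\<^sub>F n in sequentially. 0 < sqrt (ln (ln (real n)))" by real_asymp
  then show ?thesis using True by (simp add: ell_def)
next
  case False
  have "\<forall>\<^sub>F n in sequentially. 0 < ln (real n) powr (3/2) * ln (ln (real n))" by real_asymp
  then show ?thesis using False by (simp add: ell_def)
qed

text \<open>Disposes of second-order terms: \<open>n\<close> times the squared width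
  \<open>ell q n / sqrt n\<close> is \<open>(ell q n)\<^sup>2\<close>.\<close>

lemma ell_square_le_osc_rate: "\<forall>\<^sub>F n in sequentially. (ell q n)\<^sup>2 \<le> osc_rate q n"
proof (cases "q > 2")
  case True
  have "\<forall>\<^sub>F n in sequentially. (sqrt (ln (ln (real n))))\<^sup>2 \<le> sqrt (sqrt (real n) * sqrt (ln (ln (real n))) * ln (ln (real n)))" by real_asymp
  then show ?thesis using True by (simp add: ell_def osc_rate_def)
next
  case False
  have "\<forall>\<^sub>F n in sequentially. (ln (real n) powr (3/2) * ln (ln (real n)))\<^sup>2 \<le> sqrt (sqrt (real n) * (ln (real n) powr (3/2) * ln (ln (real n))) * ln (ln (real n)))" by real_asymp
  then show ?thesis using False by (simp add: ell_def osc_rate_def)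
qed

text \<open>Makes the linearization error negligible against the growth of the empirical
  distribution function over the window, so that it crosses \<open>p\<close> there.\<close>

lemma osc_rate_small:
  assumes "c > 0"
  shows "\<forall>\<^sub>F n in sequentially. osc_rate q n < c * (sqrt (real n) * ell q n)"
proof -
  have "(\<lambda>n. osc_rate q n / (sqrt (real n) * ell q n)) \<longlonglongrightarrow> 0"
  proof (cases "q > 2")
    case True
    have "(\<lambda>n. sqrt (sqrt (real n) * sqrt (ln (ln (real n))) * ln (ln (real n))) / (sqrt (real n) * sqrt (ln (ln (real n))))) \<longlonglongrightarrow> 0" by real_asymp
    then show ?thesis using True by (simp add: ell_def osc_rate_def)
  next
    case False
    have "(\<lambda>n. sqrt (sqrt (real n) * (ln (real n) powr (3/2) * ln (ln (real n))) * ln (ln (real n))) / (sqrt (real n) * (ln (real n) powr (3/2) * ln (ln (real n))))) \<longlonglongrightarrow> 0" by real_asymp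
    then show ?thesis using False by (simp add: ell_def osc_rate_def)
  qed
  from order_tendstoD(2)[OF this assms] eventually_ell_pos[of q] eventually_gt_at_top[of 0]
  show ?thesis by eventually_elim (simp add: divide_less_eq)
qed

lemma osc_rate_div:
  assumes "n > 0"
  shows "osc_rate q n / real n = real n powr (- 3/4) * sqrt (ln (ln (real n))) * sqrt (ell q n)"
proof -
  have "sqrt (sqrt (real n)) / real n = real n powr (1/4) / real n powr 1"
    using assms by (simp add: powr_half_sqrt[symmetric] powr_powr)
  also have "\<dots> = real n powr (- 3/4)" by (simp only: powr_diff[symmetric]) simp
  finally have e: "sqrt (sqrt (real n)) / real n = real n powr (- 3/4)" .
  have "osc_rate q n / real n = sqrt (sqrt (real n)) / real n * sqrt (ln (ln (real n))) * sqrt (ell q n)"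
    by (simp add: osc_rate_def real_sqrt_mult)
  then show ?thesis unfolding e .
qed

section \<open>Almost sure rates for the martingale part\<close>

context unit_linear_process
begin

lemma AE_mart_rate:
  assumes q: "q \<ge> 2"
  shows "\<exists>A>0. AE \<omega> in M. \<forall>\<^sub>F n in sequentially. \<bar>mart n x \<omega>\<bar> \<le> A * (sqrt (real n) * ell q n)"
proof -
  \<comment> \<open>The conditional variances are at most 1, so
    \<open>t\<^sup>2 * 2 ^ k = ln k\<close> gives the exponent
    \<open>ln k - 3 * ln k\<close>.\<close>
  let ?l = "\<lambda>k::nat. 3 * (sqrt (2 ^ k) * sqrt (ln (real k)))"
  have "\<forall>\<^sub>F k in sequentially. sqrt (ln (real k)) \<le> sqrt (2 ^ k)" by real_asymp
  then have bound: "\<forall>\<^sub>F k in sequentially. prob {\<omega> \<in> space M. \<exists>n\<le>2^k. ?l k \<le> \<bar>mart n x \<omega>\<bar>} \<le> 2 * (1 / real k ^ 2)"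
    using eventually_ge_at_top[of 2]
  proof eventually_elim
    fix k :: nat assume k: "2 \<le> k" and small: "sqrt (ln (real k)) \<le> sqrt (2 ^ k)"
    define t where "t = sqrt (ln (real k)) / sqrt (2 ^ k)"
    have t: "0 < t" "t \<le> 1" using k small by (auto simp: t_def)
    have "t\<^sup>2 * real (2 ^ k) = ln (real k)" using k by (simp add: t_def power_divide)
    moreover have "t * (sqrt (2 ^ k) * sqrt (ln (real k))) = ln (real k)" using k by (simp add: t_def)
    moreover have "t * ?l k = 3 * (t * (sqrt (2 ^ k) * sqrt (ln (real k))))" by (simp only: mult_ac)
    ultimately have "t\<^sup>2 * real (2 ^ k) - t * ?l k = - 2 * ln (real k)" by linarith
    also have "\<dots> = ln (1 / real k ^ 2)" using k by (simp add: ln_div ln_realpow)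
    finally have ex: "t\<^sup>2 * real (2 ^ k) - t * ?l k = ln (1 / real k ^ 2)" .
    have "prob {\<omega> \<in> space M. \<exists>n\<le>2^k. ?l k \<le> \<bar>mart n x \<omega>\<bar>} \<le> 2 * exp (t\<^sup>2 * real (2 ^ k) - t * ?l k)"
      by (rule prob_mart[OF t])
    also have "\<dots> = 2 * (1 / real k ^ 2)" unfolding ex using k by simp
    finally show "prob {\<omega> \<in> space M. \<exists>n\<le>2^k. ?l k \<le> \<bar>mart n x \<omega>\<bar>} \<le> 2 * (1 / real k ^ 2)" .
  qed
  have "AE \<omega> in M. \<forall>\<^sub>F k in sequentially. \<not> (\<exists>n\<le>2^k. ?l k \<le> \<bar>mart n x \<omega>\<bar>)"
  proof (rule borel_cantelli_eventually[OF _ bound])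
    show "summable (\<lambda>k. 2 * (1 / real k ^ 2))"
      by (rule summable_over_square)
  qed measurable
  then have "AE \<omega> in M. \<forall>\<^sub>F n in sequentially. \<bar>mart n x \<omega>\<bar> \<le> 16 * 3 * (sqrt (real n) * ell q n)"
  proof eventually_elim
    fix \<omega> assume h: "\<forall>\<^sub>F k in sequentially. \<not> (\<exists>n\<le>2^k. ?l k \<le> \<bar>mart n x \<omega>\<bar>)"
    show "\<forall>\<^sub>F n in sequentially. \<bar>mart n x \<omega>\<bar> \<le> 16 * 3 * (sqrt (real n) * ell q n)"
    proof (rule block_to_rate[OF _ _ q])
      show "\<forall>\<^sub>F k in sequentially. \<forall>n\<le>2^k. \<bar>mart n x \<omega>\<bar> \<le> 3 * (sqrt (2 ^ k) * block_rate q k)"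
        using h eventually_block_rate_ge[of q]
      proof (eventually_elim, intro allI impI)
        fix k n :: nat assume h: "\<not> (\<exists>n\<le>2^k. ?l k \<le> \<bar>mart n x \<omega>\<bar>)"
          "1 \<le> block_rate q k \<and> sqrt (ln (real k)) \<le> block_rate q k" and n: "n \<le> 2 ^ k"
        have "\<bar>mart n x \<omega>\<bar> \<le> ?l k" using h(1) n by force
        also have "\<dots> \<le> 3 * (sqrt (2 ^ k) * block_rate q k)" using h(2) by (intro mult_left_mono) auto
        finally show "\<bar>mart n x \<omega>\<bar> \<le> 3 * (sqrt (2 ^ k) * block_rate q k)" .
      qed
    qed simp
  qed
  then show ?thesis by (intro exI[of _ "16 * 3"]) auto
qed

lemma AE_mart_oscillation:
  assumes q: "q \<ge> 2" and D: "D > 0"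
  shows "\<exists>A>0. AE \<omega> in M. \<forall>\<^sub>F n in sequentially. \<forall>x. \<bar>x - \<xi>\<bar> \<le> D * ell q n / sqrt (real n) \<longrightarrow>
    \<bar>mart n x \<omega> - mart n \<xi> \<omega>\<bar> \<le> A * osc_rate q n"
proof -
  \<comment> \<open>The full width of the window. In block \<open>Suc k\<close>,
    \<open>sqrt n \<ge> sqrt (2 ^ Suc k) / 2\<close>, so the radius
    \<open>D * ell q n / sqrt n\<close> is at most \<open>w (Suc k) / 2\<close>.\<close>
  define w where "w k = 4 * D * block_rate q k / sqrt (2 ^ k)" for k
  have Bw: "B * w k * 2 ^ k = 4 * B * D * (block_rate q k * sqrt (2 ^ k))" for k
    by (simp add: w_def field_simps)
  let ?b = "\<lambda>k. 128 * sqrt (B * w k * 2 ^ k * ln (real k))"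
  let ?good = "\<lambda>k E. E \<in> events \<and> prob E \<le> 4 * (1 / real k ^ 2) \<and> (\<forall>\<omega>\<in>space M - E. \<forall>n\<le>2^k. \<forall>x\<in>{\<xi> - w k / 2..\<xi> - w k / 2 + w k}.
    \<bar>mart n x \<omega> - mart n (\<xi> - w k / 2) \<omega>\<bar> \<le> ?b k)"
  have "(\<lambda>k. 16 * ln (real k) / sqrt (2 ^ k)) \<longlonglongrightarrow> 0" by real_asymp
  from order_tendstoD(2)[OF this, of "4 * B * D"] B_pos D
  have "\<forall>\<^sub>F k in sequentially. 16 * ln (real k) / sqrt (2 ^ k) < 4 * B * D" by simp
  then have ev: "\<forall>\<^sub>F k in sequentially. \<exists>E. ?good k E"
    using eventually_ge_at_top[of 3] eventually_block_rate_ge[of q]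
  proof eventually_elim
    fix k :: nat
    assume h: "16 * ln (real k) / sqrt (2 ^ k) < 4 * B * D" "3 \<le> k" "1 \<le> block_rate q k \<and> sqrt (ln (real k)) \<le> block_rate q k"
    have "16 * ln (real k) \<le> 4 * B * D * (1 * sqrt (2 ^ k))" using h(1) by (simp add: divide_less_eq)
    also have "\<dots> \<le> B * w k * 2 ^ k"
      unfolding Bw using h(3) B_pos D by (intro mult_left_mono mult_right_mono) auto
    finally have big: "16 * ln (real k) \<le> B * w k * 2 ^ k" .
    have "w k > 0" using h(3) D unfolding w_def by (intro divide_pos_pos mult_pos_pos) auto
    from mart_oscillation[OF h(2) this big, of "\<xi> - w k / 2"] show "\<exists>E. ?good k E" by blast
  qed
  \<comment> \<open>One exceptional event per block; the default \<open>{}\<close> makes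
    \<open>E k\<close> measurable also for small \<open>k\<close>, where
    \<open>mart_oscillation\<close> may not apply.\<close>
  define E where "E k = (if \<exists>E. ?good k E then SOME E. ?good k E else {})" for k
  have E: "\<forall>\<^sub>F k in sequentially. ?good k (E k)"
    using ev
  proof eventually_elim
    fix k assume ex: "\<exists>E. ?good k E"
    show "?good k (E k)" unfolding E_def if_P[OF ex] by (rule someI_ex[OF ex])
  qed
  have Em [measurable]: "E k \<in> events" for k
  proof (cases "\<exists>E. ?good k E")
    case True
    then have "?good k (E k)" unfolding E_def if_P[OF True] by (rule someI_ex)
    then show ?thesis by blast
  next
    case False
    have "E k = {}" unfolding E_def by (rule if_not_P[OF False])
    then show ?thesis by simp
  qed
  have "\<forall>\<^sub>F k in sequentially. prob {\<omega> \<in> space M. \<omega> \<in> E k} \<le> 4 * (1 / real k ^ 2)"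
    using E
  proof eventually_elim
    fix k assume g: "?good k (E k)"
    have "{\<omega> \<in> space M. \<omega> \<in> E k} = E k" using sets.sets_into_space[OF Em] by blast
    then show "prob {\<omega> \<in> space M. \<omega> \<in> E k} \<le> 4 * (1 / real k ^ 2)" using g by simp
  qed
  then have "AE \<omega> in M. \<forall>\<^sub>F k in sequentially. \<omega> \<notin> E k"
  proof (rule borel_cantelli_eventually[rotated])
    show "summable (\<lambda>k. 4 * (1 / real k ^ 2))"
      by (rule summable_over_square)
  qed measurable
  then have "AE \<omega> in M. \<forall>\<^sub>F n in sequentially. \<forall>x. \<bar>x - \<xi>\<bar> \<le> D * ell q n / sqrt (real n) \<longrightarrow>
    \<bar>mart n x \<omega> - mart n \<xi> \<omega>\<bar> \<le> 256 * sqrt (256 * B * D) * osc_rate q n"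
    using AE_space
  proof eventually_elim
    fix \<omega> assume nE: "\<forall>\<^sub>F k in sequentially. \<omega> \<notin> E k" and \<omega>: "\<omega> \<in> space M"
    show "\<forall>\<^sub>F n in sequentially. \<forall>x. \<bar>x - \<xi>\<bar> \<le> D * ell q n / sqrt (real n) \<longrightarrow>
      \<bar>mart n x \<omega> - mart n \<xi> \<omega>\<bar> \<le> 256 * sqrt (256 * B * D) * osc_rate q n"
    proof (rule eventually_dyadic)
      have "\<forall>\<^sub>F k in sequentially. \<omega> \<notin> E k \<and> ?good k (E k) \<and> 1 \<le> block_rate q k \<and> k \<ge> 1"
        using nE E eventually_block_rate_ge[of q] eventually_ge_at_top[of 1] by eventually_elim blast
      from eventually_sequentially_Suc[THEN iffD2, OF this]
      show "\<forall>\<^sub>F k in sequentially. \<forall>n. 2 ^ k \<le> n \<longrightarrow> n \<le> 2 ^ Suc k \<longrightarrow> (\<forall>x. \<bar>x - \<xi>\<bar> \<le> D * ell q n / sqrt (real n) \<longrightarrow>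
        \<bar>mart n x \<omega> - mart n \<xi> \<omega>\<bar> \<le> 256 * sqrt (256 * B * D) * osc_rate q n)"
        using block_rate_le_ell[OF q] ell_le_block_rate[of q] ln_Suc_dyadic
      proof (eventually_elim, intro allI impI)
        fix k n x
        assume h: "\<omega> \<notin> E (Suc k) \<and> ?good (Suc k) (E (Suc k)) \<and> 1 \<le> block_rate q (Suc k) \<and> Suc k \<ge> 1"
          and r1: "\<forall>n. 2 ^ k \<le> n \<longrightarrow> block_rate q (Suc k) \<le> 8 * ell q n"
          and r2: "\<forall>n. 2 ^ k \<le> n \<longrightarrow> n \<le> 2 ^ Suc k \<longrightarrow> ell q n \<le> block_rate q (Suc k)"
          and r3: "\<forall>n. 2 ^ k \<le> n \<longrightarrow> ln (real (Suc k)) \<le> 4 * ln (ln (real n))"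
          and n: "2 ^ k \<le> n" "n \<le> 2 ^ Suc k" and x: "\<bar>x - \<xi>\<bar> \<le> D * ell q n / sqrt (real n)"
        let ?K = "Suc k"
        have "D * ell q n / sqrt (real n) \<le> D * block_rate q ?K / (sqrt (2 ^ ?K) / 2)"
        proof (rule frac_le)
          show "D * ell q n \<le> D * block_rate q ?K" using r2 n D by (intro mult_left_mono) auto
          show "sqrt (2 ^ ?K) / 2 \<le> sqrt (real n)" using sqrt_dyadic[OF n(1)] by simp
          show "0 \<le> D * block_rate q ?K" using D h by (intro mult_nonneg_nonneg) auto
        qed simp
        also have "\<dots> = w ?K / 2" by (simp add: w_def)
        finally have xw: "\<bar>x - \<xi>\<bar> \<le> w ?K / 2" using x by linarith
        \<comment> \<open>The reference point is the left end of the window; passing from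
          \<open>x\<close> to \<open>\<xi>\<close> through it doubles the constant.\<close>
        have osc: "\<bar>mart n y \<omega> - mart n (\<xi> - w ?K / 2) \<omega>\<bar> \<le> ?b ?K" if "\<bar>y - \<xi>\<bar> \<le> w ?K / 2" for y
        proof -
          have "y \<in> {\<xi> - w ?K / 2..\<xi> - w ?K / 2 + w ?K}" using that unfolding atLeastAtMost_iff by linarith
          then show ?thesis using h \<omega> n(2) by blast
        qed
        have b: "?b ?K \<le> 128 * (sqrt (256 * B * D) * osc_rate q n)"
        proof -
          have e0: "0 \<le> ell q n" using r1 n(1) h by fastforce
          have "B * w ?K * 2 ^ ?K * ln (real ?K) = 4 * B * D * (block_rate q ?K * sqrt (2 ^ ?K) * ln (real ?K))"
            unfolding Bw by simp
          also have "\<dots> \<le> 4 * B * D * ((8 * ell q n) * (2 * sqrt (real n)) * (4 * ln (ln (real n))))"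
            using r1 r3 n(1) h B_pos D e0 sqrt_dyadic[OF n(1)]
            by (intro mult_left_mono mult_mono) (auto simp del: of_nat_Suc power_Suc)
          also have "\<dots> = 256 * B * D * (sqrt (real n) * ell q n * ln (ln (real n)))" by simp
          finally have "sqrt (B * w ?K * 2 ^ ?K * ln (real ?K)) \<le> sqrt (256 * B * D * (sqrt (real n) * ell q n * ln (ln (real n))))"
            by (rule real_sqrt_le_mono)
          also have "\<dots> = sqrt (256 * B * D) * osc_rate q n"
            unfolding osc_rate_def by (rule real_sqrt_mult)
          finally show ?thesis by simp
        qed
        have "\<bar>mart n x \<omega> - mart n \<xi> \<omega>\<bar> \<le> ?b ?K + ?b ?K"
          using osc[OF xw] osc[of \<xi>] xw by linarith
        then show "\<bar>mart n x \<omega> - mart n \<xi> \<omega>\<bar> \<le> 256 * sqrt (256 * B * D) * osc_rate q n"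
          using b by linarith
      qed
    qed
  qed
  then show ?thesis using B_pos D by (intro exI[of _ "256 * sqrt (256 * B * D)"]) auto
qed

lemma AE_emp_cdf:
  "AE \<omega> in M. \<forall>n x. real n * emp_cdf (\<lambda>i. R i 0) n \<omega> x = mart n x \<omega> + (\<Sum>s<n. F\<epsilon> (x - R (1 + int s) 1 \<omega>))"
  using AE_X
proof (eventually_elim, intro allI)
  fix \<omega> n x assume X: "\<forall>i. R i 0 \<omega> = \<epsilon> i \<omega> + R i 1 \<omega>"
  have "real n * emp_cdf (\<lambda>i. R i 0) n \<omega> x = (\<Sum>i=1..n. if R (int i) 0 \<omega> \<le> x then 1 else 0)"
    unfolding emp_cdf_def by simp
  also have "\<dots> = (\<Sum>s<n. if R (1 + int s) 0 \<omega> \<le> x then 1 else 0)"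
    by (simp add: sum.atLeast1_atMost_eq)
  also have "\<dots> = mart n x \<omega> + (\<Sum>s<n. F\<epsilon> (x - R (1 + int s) 1 \<omega>))"
    unfolding mart_def W_def sum.distrib[symmetric] using X by (intro sum.cong) auto
  finally show "real n * emp_cdf (\<lambda>i. R i 0) n \<omega> x = mart n x \<omega> + (\<Sum>s<n. F\<epsilon> (x - R (1 + int s) 1 \<omega>))" .
qed

end

section \<open>The Bahadur representation\<close>

lemma mono_emp_cdf: "mono (emp_cdf X n \<omega>)"
  unfolding emp_cdf_def by (intro monoI divide_right_mono sum_mono) auto

context unit_linear_process
begin

context
  fixes p q \<beta> :: real
  assumes p: "0 < p" "p < 1" and q: "q \<ge> 2" and \<beta>: "0 < \<beta>" "\<beta> \<le> 1" "\<beta> * q \<le> \<alpha>"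
    and summable_\<beta>: "summable (\<lambda>j. \<bar>a (Suc j)\<bar> powr \<beta>)"
    and tail_sums: "q > 2 \<Longrightarrow> \<exists>c. \<forall>\<^sub>F J in sequentially. (\<Sum>j. \<bar>a (Suc (J + j))\<bar> powr \<beta>) powr q \<le> c / ln (real J)"
    and fX_pos: "fX (quantile (dist_fun M (R 0 0)) p) > 0"
begin

definition \<xi> :: real where "\<xi> = quantile (dist_fun M (R 0 0)) p"

lemma AE_functional_rate:
  assumes g: "\<And>x. \<bar>g x\<bar> \<le> K" "\<And>x y. \<bar>g x - g y\<bar> \<le> L * \<bar>x - y\<bar>"
  shows "\<exists>A>0. AE \<omega> in M. \<forall>\<^sub>F n in sequentially.
    \<bar>\<Sum>s<n. g (R (1 + int s) 1 \<omega>) - (\<integral>\<omega>. g (R 0 1 \<omega>) \<partial>M)\<bar> \<le> A * (sqrt (real n) * ell q n)"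
proof -
  interpret G: lipschitz_functional M \<epsilon> \<mu> a \<alpha> g K L q \<beta>
    by unfold_locales (use g q \<beta> summable_\<beta> in auto)
  have "\<exists>A>0. AE \<omega> in M. \<forall>\<^sub>F k in sequentially. \<forall>n\<le>2^k.
    \<bar>\<Sum>s<n. g (R (1 + int s) 1 \<omega>) - G.\<gamma>\<bar> \<le> A * (sqrt (2 ^ k) * block_rate q k)"
    by (rule G.AE_sum_rate) (use tail_sums in \<open>simp add: G.\<Theta>_def G.\<theta>_def\<close>)
  then obtain A where A: "A > 0" and *: "AE \<omega> in M. \<forall>\<^sub>F k in sequentially. \<forall>n\<le>2^k.
    \<bar>\<Sum>s<n. g (R (1 + int s) 1 \<omega>) - G.\<gamma>\<bar> \<le> A * (sqrt (2 ^ k) * block_rate q k)"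
    by blast
  have "AE \<omega> in M. \<forall>\<^sub>F n in sequentially.
    \<bar>\<Sum>s<n. g (R (1 + int s) 1 \<omega>) - G.\<gamma>\<bar> \<le> 16 * A * (sqrt (real n) * ell q n)"
    using * by eventually_elim (rule block_to_rate[OF _ A q])
  then show ?thesis using A unfolding G.\<gamma>_def by (intro exI[of _ "16 * A"]) auto
qed

text \<open>For one sample point, \<open>n\<close> times the error splits into the martingale
  increment, the Taylor remainders of \<open>F\<epsilon>\<close>, and \<open>x - \<xi>\<close> times
  the fluctuation of the summed densities. The last two are of order
  \<open>(ell q n)\<^sup>2\<close>, because
  \<open>\<bar>x - \<xi>\<bar> * sqrt n \<le> D * ell q n\<close>.\<close>

lemma emp_cdf_expansion:
  assumes emp: "\<And>x. real n * G x = mart n x \<omega> + (\<Sum>s<n. F\<epsilon> (x - R (1 + int s) 1 \<omega>))" and n: "n > 0"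
    and dens: "\<bar>\<Sum>s<n. f (\<xi> - R (1 + int s) 1 \<omega>) - fX \<xi>\<bar> \<le> A * (sqrt (real n) * ell q n)"
    and osc: "\<bar>mart n x \<omega> - mart n \<xi> \<omega>\<bar> \<le> A' * osc_rate q n"
    and x: "\<bar>x - \<xi>\<bar> \<le> D * ell q n / sqrt (real n)"
    and A: "A \<ge> 0" and e: "(ell q n)\<^sup>2 \<le> osc_rate q n"
    and D: "D \<ge> 0"
  shows "\<bar>G x - G \<xi> - (x - \<xi>) * fX \<xi>\<bar> \<le> (A' + B * D\<^sup>2 + D * A) * (osc_rate q n / real n)"
proof -
  let ?Y = "\<lambda>s. R (1 + int s) 1 \<omega>"
  define T where "T = (\<Sum>s<n. F\<epsilon> (x - ?Y s) - F\<epsilon> (\<xi> - ?Y s) - (x - \<xi>) * f (\<xi> - ?Y s))"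
  define U where "U = (\<Sum>s<n. f (\<xi> - ?Y s) - fX \<xi>)"
  have dec: "real n * (G x - G \<xi> - (x - \<xi>) * fX \<xi>) = (mart n x \<omega> - mart n \<xi> \<omega>) + T + (x - \<xi>) * U"
  proof -
    have T: "T = (\<Sum>s<n. F\<epsilon> (x - ?Y s)) - (\<Sum>s<n. F\<epsilon> (\<xi> - ?Y s)) - (x - \<xi>) * (\<Sum>s<n. f (\<xi> - ?Y s))"
      by (simp add: T_def sum_subtractf sum_distrib_left)
    have U: "U = (\<Sum>s<n. f (\<xi> - ?Y s)) - real n * fX \<xi>" by (simp add: U_def sum_subtractf)
    have "real n * (G x - G \<xi> - (x - \<xi>) * fX \<xi>) = real n * G x - real n * G \<xi> - (x - \<xi>) * (real n * fX \<xi>)"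
      by (simp add: algebra_simps)
    also have "\<dots> = (mart n x \<omega> - mart n \<xi> \<omega>) + T + (x - \<xi>) * U"
      unfolding emp T U right_diff_distrib by simp
    finally show ?thesis .
  qed
  have xn: "\<bar>x - \<xi>\<bar> * sqrt (real n) \<le> D * ell q n"
    using x n by (simp add: le_divide_eq)
  have "\<bar>T\<bar> \<le> (\<Sum>s<n. B * (x - \<xi>)\<^sup>2)"
    unfolding T_def
  proof (rule order_trans[OF sum_abs], rule sum_mono)
    fix s
    show "\<bar>F\<epsilon> (x - ?Y s) - F\<epsilon> (\<xi> - ?Y s) - (x - \<xi>) * f (\<xi> - ?Y s)\<bar> \<le> B * (x - \<xi>)\<^sup>2"
      using F\<epsilon>_expand[of "x - ?Y s" "\<xi> - ?Y s"] by simp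
  qed
  also have "\<dots> = B * (\<bar>x - \<xi>\<bar> * sqrt (real n))\<^sup>2" by (simp add: power_mult_distrib)
  also have "\<dots> \<le> B * (D * ell q n)\<^sup>2" using xn B_pos by (intro mult_left_mono power_mono) auto
  also have "\<dots> = B * D\<^sup>2 * (ell q n)\<^sup>2" by (simp add: power_mult_distrib)
  finally have T: "\<bar>T\<bar> \<le> B * D\<^sup>2 * (ell q n)\<^sup>2" .
  have "\<bar>(x - \<xi>) * U\<bar> \<le> \<bar>x - \<xi>\<bar> * (A * (sqrt (real n) * ell q n))"
    unfolding abs_mult U_def using dens by (intro mult_left_mono) auto
  also have "\<dots> = (\<bar>x - \<xi>\<bar> * sqrt (real n)) * (A * ell q n)" by simp
  also have "\<dots> \<le> (D * ell q n) * (A * ell q n)"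
  proof (rule mult_right_mono[OF xn])
    have "0 \<le> A * (sqrt (real n) * ell q n)" using dens by (rule order_trans[OF abs_ge_zero])
    then have "0 \<le> sqrt (real n) * (A * ell q n)" by (simp add: mult_ac)
    then show "0 \<le> A * ell q n" using n by (simp add: zero_le_mult_iff)
  qed
  also have "\<dots> = D * A * (ell q n)\<^sup>2" by (simp add: power2_eq_square)
  finally have U: "\<bar>(x - \<xi>) * U\<bar> \<le> D * A * (ell q n)\<^sup>2" .
  have c: "0 \<le> B * D\<^sup>2 + D * A" using B_pos D A by (intro add_nonneg_nonneg mult_nonneg_nonneg) auto
  have "real n * \<bar>G x - G \<xi> - (x - \<xi>) * fX \<xi>\<bar> = \<bar>real n * (G x - G \<xi> - (x - \<xi>) * fX \<xi>)\<bar>" by (simp add: abs_mult)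
  also have "\<dots> \<le> A' * osc_rate q n + (B * D\<^sup>2 + D * A) * (ell q n)\<^sup>2"
    unfolding dec distrib_right using osc T U by linarith
  also have "\<dots> \<le> A' * osc_rate q n + (B * D\<^sup>2 + D * A) * osc_rate q n"
    using c e by (intro add_left_mono mult_left_mono)
  also have "\<dots> = real n * ((A' + B * D\<^sup>2 + D * A) * (osc_rate q n / real n))"
    using n by (simp add: algebra_simps)
  finally show ?thesis using n by (simp only: mult_le_cancel_left_pos of_nat_0_less_iff)
qed

text \<open>Within \<open>2 * \<delta> n\<close> of \<open>\<xi>\<close> the empirical distribution
  function is affine with slope \<open>\<phi>\<close>, up to an error too small to prevent a
  crossing of \<open>p\<close> within \<open>\<delta> n\<close>; inverting the affine approximation
  gives the representation.\<close>

lemma quantile_bounds_and_bahadur: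
  "quantile_as_bounds M (\<lambda>i. R i 0) p q \<and> bahadur_representation M (\<lambda>i. R i 0) p q"
proof -
  let ?G = "\<lambda>n \<omega>. emp_cdf (\<lambda>i. R i 0) n \<omega>"
  let ?e = "\<lambda>n. sqrt (real n) * ell q n"
  define \<phi> where "\<phi> = fX \<xi>"
  have \<phi>: "\<phi> > 0" using fX_pos by (simp add: \<phi>_def \<xi>_def)
  have F\<xi>: "(\<integral>\<omega>. F\<epsilon> (\<xi> - R 0 1 \<omega>) \<partial>M) = p"
  proof -
    have "dist_fun M (R 0 0) \<xi> = p" unfolding \<xi>_def by (rule dist_fun_X_quantile[OF p])
    then show ?thesis unfolding dist_fun_X .
  qed
  have "\<bar>F\<epsilon> (\<xi> - x)\<bar> \<le> 1" for x using F\<epsilon>_bound[of "\<xi> - x"] by simp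
  moreover have "\<bar>F\<epsilon> (\<xi> - x) - F\<epsilon> (\<xi> - y)\<bar> \<le> B * \<bar>x - y\<bar>" for x y
    using F\<epsilon>_lip[of "\<xi> - x" "\<xi> - y"] by (simp add: abs_minus_commute)
  ultimately obtain A1 where A1: "A1 > 0" and cdf_rate: "AE \<omega> in M. \<forall>\<^sub>F n in sequentially.
    \<bar>\<Sum>s<n. F\<epsilon> (\<xi> - R (1 + int s) 1 \<omega>) - p\<bar> \<le> A1 * ?e n"
    using AE_functional_rate[of "\<lambda>x. F\<epsilon> (\<xi> - x)" 1 B] unfolding F\<xi> by blast
  have "\<bar>f (\<xi> - x)\<bar> \<le> B" for x using f_nonneg[of "\<xi> - x"] f_le[of "\<xi> - x"] by simp
  moreover have "\<bar>f (\<xi> - x) - f (\<xi> - y)\<bar> \<le> B * \<bar>x - y\<bar>" for x y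
    using f_lip[of "\<xi> - x" "\<xi> - y"] by (simp add: abs_minus_commute)
  ultimately obtain A2 where A2: "A2 > 0" and dens_rate: "AE \<omega> in M. \<forall>\<^sub>F n in sequentially.
    \<bar>\<Sum>s<n. f (\<xi> - R (1 + int s) 1 \<omega>) - fX \<xi>\<bar> \<le> A2 * ?e n"
    using AE_functional_rate[of "\<lambda>x. f (\<xi> - x)" B B] unfolding fX_def by blast
  obtain A3 where A3: "A3 > 0" and mart_rate: "AE \<omega> in M. \<forall>\<^sub>F n in sequentially. \<bar>mart n \<xi> \<omega>\<bar> \<le> A3 * ?e n"
    using AE_mart_rate[OF q] by blast
  \<comment> \<open>\<open>A1 + A3\<close> covers the deviation from \<open>p\<close> at
    \<open>\<xi>\<close>, and the extra \<open>1\<close> the linearization error, eventually below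
    \<open>ell q n / sqrt n\<close>.\<close>
  define C where "C = A1 + A3 + 1"
  have C: "C > 0" using A1 A3 by (simp add: C_def)
  \<comment> \<open>Twice the radius \<open>\<delta> n\<close>: the quantile, at most
    \<open>\<delta> n\<close> away, must lie strictly inside the window of linearization.\<close>
  define D where "D = 2 * C / \<phi>"
  have D: "D > 0" using C \<phi> by (simp add: D_def)
  obtain A4 where A4: "A4 > 0" and osc_rate: "AE \<omega> in M. \<forall>\<^sub>F n in sequentially. \<forall>x. \<bar>x - \<xi>\<bar> \<le> D * ell q n / sqrt (real n) \<longrightarrow>
    \<bar>mart n x \<omega> - mart n \<xi> \<omega>\<bar> \<le> A4 * osc_rate q n"
    using AE_mart_oscillation[OF q D] by blast
  define A5 where "A5 = A4 + B * D\<^sup>2 + D * A2"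
  have A5: "A5 > 0" unfolding A5_def using A4 B_pos D A2 by (intro add_pos_nonneg add_nonneg_nonneg mult_nonneg_nonneg) auto
  define \<delta> where "\<delta> n = C * ell q n / (\<phi> * sqrt (real n))" for n
  let ?good = "\<lambda>\<omega> n. n > 0 \<and> p \<le> ?G n \<omega> (\<xi> + \<delta> n) \<and> ?G n \<omega> (\<xi> - \<delta> n) < p \<and> \<bar>quantile (?G n \<omega>) p - \<xi>\<bar> \<le> \<delta> n \<and>
    \<bar>quantile (?G n \<omega>) p - (\<xi> + (p - ?G n \<omega> \<xi>) / \<phi>)\<bar> \<le> A5 * (osc_rate q n / real n) / \<phi>"
  have main: "AE \<omega> in M. \<forall>\<^sub>F n in sequentially. ?good \<omega> n"
    using cdf_rate dens_rate mart_rate osc_rate AE_emp_cdf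
  proof eventually_elim
    fix \<omega>
    assume c: "\<forall>\<^sub>F n in sequentially. \<bar>\<Sum>s<n. F\<epsilon> (\<xi> - R (1 + int s) 1 \<omega>) - p\<bar> \<le> A1 * ?e n"
      and d: "\<forall>\<^sub>F n in sequentially. \<bar>\<Sum>s<n. f (\<xi> - R (1 + int s) 1 \<omega>) - fX \<xi>\<bar> \<le> A2 * ?e n"
      and m: "\<forall>\<^sub>F n in sequentially. \<bar>mart n \<xi> \<omega>\<bar> \<le> A3 * ?e n"
      and o: "\<forall>\<^sub>F n in sequentially. \<forall>x. \<bar>x - \<xi>\<bar> \<le> D * ell q n / sqrt (real n) \<longrightarrow> \<bar>mart n x \<omega> - mart n \<xi> \<omega>\<bar> \<le> A4 * osc_rate q n"
      and emp: "\<forall>n x. real n * ?G n \<omega> x = mart n x \<omega> + (\<Sum>s<n. F\<epsilon> (x - R (1 + int s) 1 \<omega>))"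
    \<comment> \<open>After division by \<open>n\<close> this says that the linearization error is
      below \<open>h\<close>.\<close>
    have sm: "\<forall>\<^sub>F n in sequentially. osc_rate q n < (1 / A5) * ?e n"
      using A5 by (intro osc_rate_small) simp
    show "\<forall>\<^sub>F n in sequentially. ?good \<omega> n"
      using c d m o sm eventually_ell_pos[of q] ell_square_le_osc_rate[of q] eventually_gt_at_top[of 0]
    proof eventually_elim
      fix n :: nat
      assume c: "\<bar>\<Sum>s<n. F\<epsilon> (\<xi> - R (1 + int s) 1 \<omega>) - p\<bar> \<le> A1 * ?e n"
        and d: "\<bar>\<Sum>s<n. f (\<xi> - R (1 + int s) 1 \<omega>) - fX \<xi>\<bar> \<le> A2 * ?e n"
        and m: "\<bar>mart n \<xi> \<omega>\<bar> \<le> A3 * ?e n"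
        and o: "\<forall>x. \<bar>x - \<xi>\<bar> \<le> D * ell q n / sqrt (real n) \<longrightarrow> \<bar>mart n x \<omega> - mart n \<xi> \<omega>\<bar> \<le> A4 * osc_rate q n"
        and sm: "osc_rate q n < (1 / A5) * ?e n" and e: "0 < ell q n" and e2: "(ell q n)\<^sup>2 \<le> osc_rate q n" and n: "0 < n"
      let ?g = "?G n \<omega>"
      define h where "h = ell q n / sqrt (real n)"
      have h: "h > 0" using e n by (simp add: h_def)
      have eh: "?e n = real n * h"
        using n by (simp add: h_def field_simps)
      have \<delta>1: "\<delta> n = C * h / \<phi>" by (simp add: \<delta>_def h_def)
      have "2 * \<delta> n = D * h" by (simp add: \<delta>1 D_def)
      then have "2 * \<delta> n = D * ell q n / sqrt (real n)" by (simp add: h_def)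
      moreover have "\<delta> n > 0" unfolding \<delta>1 using \<phi> C h by (intro divide_pos_pos mult_pos_pos)
      moreover have "\<delta> n * \<phi> = C * h" unfolding \<delta>1 using \<phi> by simp
      ultimately have \<delta>: "\<delta> n > 0" "2 * \<delta> n = D * ell q n / sqrt (real n)" "\<delta> n * \<phi> = C * h" by auto
      let ?E = "A5 * (osc_rate q n / real n)"
      have E: "?E < h"
        using sm A5 n unfolding eh by (simp add: field_simps)
      have lin: "\<bar>?g x - ?g \<xi> - (x - \<xi>) * \<phi>\<bar> \<le> ?E" if "\<bar>x - \<xi>\<bar> \<le> 2 * \<delta> n" for x
        unfolding A5_def \<phi>_def using that emp n d o e2 A2 D \<delta>(2)
        by (intro emp_cdf_expansion[where \<omega>=\<omega> and n=n and D=D]) auto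
      have "real n * \<bar>?g \<xi> - p\<bar> = \<bar>mart n \<xi> \<omega> + (\<Sum>s<n. F\<epsilon> (\<xi> - R (1 + int s) 1 \<omega>) - p)\<bar>"
      proof -
        have "real n * (?g \<xi> - p) = mart n \<xi> \<omega> + (\<Sum>s<n. F\<epsilon> (\<xi> - R (1 + int s) 1 \<omega>) - p)"
          using emp by (simp add: sum_subtractf right_diff_distrib)
        then show ?thesis by (metis abs_mult abs_of_nat)
      qed
      also have "\<dots> \<le> A3 * ?e n + A1 * ?e n" using c m by linarith
      also have "\<dots> = real n * ((A1 + A3) * h)" unfolding eh by (simp add: algebra_simps)
      finally have cen: "\<bar>?g \<xi> - p\<bar> \<le> (A1 + A3) * h" using n by (simp only: mult_le_cancel_left_pos of_nat_0_less_iff)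
      have Ch: "C * h = (A1 + A3) * h + h" by (simp add: C_def distrib_right)
      have up: "p \<le> ?g (\<xi> + \<delta> n)"
        using lin[of "\<xi> + \<delta> n"] cen E Ch \<delta> by (simp add: abs_le_iff)
      have low: "?g (\<xi> - \<delta> n) < p"
        using lin[of "\<xi> - \<delta> n"] cen E Ch \<delta> by (simp add: abs_le_iff)
      have br: "\<bar>quantile ?g p - \<xi>\<bar> \<le> \<delta> n"
        using quantile_bracket[OF mono_emp_cdf low up] by linarith
      have "\<bar>quantile ?g p - (\<xi> + (p - ?g \<xi>) / \<phi>)\<bar> \<le> ?E / \<phi>"
        by (rule quantile_linearization[OF mono_emp_cdf up low \<phi>, of "2 * \<delta> n"]) (use \<delta> br lin in auto)
      then show "n > 0 \<and> p \<le> ?g (\<xi> + \<delta> n) \<and> ?g (\<xi> - \<delta> n) < p \<and> \<bar>quantile ?g p - \<xi>\<bar> \<le> \<delta> n \<and>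
        \<bar>quantile ?g p - (\<xi> + (p - ?g \<xi>) / \<phi>)\<bar> \<le> ?E / \<phi>"
        using n up low br by blast
    qed
  qed
  have 1: "quantile_as_bounds M (\<lambda>i. R i 0) p q"
    unfolding quantile_as_bounds_def Let_def cont_density_X \<xi>_def[symmetric] \<phi>_def[symmetric] \<delta>_def[symmetric]
  proof (intro exI conjI)
    show "AE \<omega> in M. \<forall>\<^sub>F n in sequentially. p \<le> ?G n \<omega> (\<xi> + C * ell q n / (\<phi> * sqrt (real n))) \<and>
      ?G n \<omega> (\<xi> - C * ell q n / (\<phi> * sqrt (real n))) \<le> p \<and>
      \<bar>quantile (?G n \<omega>) p - \<xi>\<bar> \<le> C * ell q n / (\<phi> * sqrt (real n))"
      using main unfolding \<delta>_def by eventually_elim (auto elim!: eventually_mono)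
  qed (rule C)
  have 2: "bahadur_representation M (\<lambda>i. R i 0) p q"
    unfolding bahadur_representation_def Let_def cont_density_X \<xi>_def[symmetric] \<phi>_def[symmetric] bigo_as_def
    using main
  proof eventually_elim
    fix \<omega>
    assume m: "\<forall>\<^sub>F n in sequentially. ?good \<omega> n"
    show "(\<lambda>n. quantile (?G n \<omega>) p - (\<xi> + (p - ?G n \<omega> \<xi>) / \<phi>))
      \<in> O(\<lambda>n. real n powr (- 3/4) * sqrt (ln (ln (real n))) * sqrt (ell q n))"
    proof (rule bigoI)
      show "\<forall>\<^sub>F n in sequentially. norm (quantile (?G n \<omega>) p - (\<xi> + (p - ?G n \<omega> \<xi>) / \<phi>))
        \<le> A5 / \<phi> * norm (real n powr (- 3/4) * sqrt (ln (ln (real n))) * sqrt (ell q n))"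
        using m
      proof eventually_elim
        fix n assume h: "?good \<omega> n"
        have rate: "osc_rate q n / real n = real n powr (- 3/4) * sqrt (ln (ln (real n))) * sqrt (ell q n)"
          by (rule osc_rate_div) (use h in blast)
        have "\<bar>quantile (?G n \<omega>) p - (\<xi> + (p - ?G n \<omega> \<xi>) / \<phi>)\<bar> \<le> A5 * (osc_rate q n / real n) / \<phi>"
          using h by blast
        also have "\<dots> = A5 / \<phi> * (osc_rate q n / real n)" by simp
        also have "\<dots> \<le> A5 / \<phi> * \<bar>osc_rate q n / real n\<bar>"
          using A5 \<phi> by (intro mult_left_mono abs_ge_self) auto
        finally show "norm (quantile (?G n \<omega>) p - (\<xi> + (p - ?G n \<omega> \<xi>) / \<phi>))
          \<le> A5 / \<phi> * norm (real n powr (- 3/4) * sqrt (ln (ln (real n))) * sqrt (ell q n))"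
          unfolding real_norm_def rate .
      qed
    qed
  qed
  show ?thesis using 1 2 by blast
qed

end
end

text \<open>In (a), summability stands beside the rate because \<open>suminf\<close> of a divergent
  series is a default value, on which a growth bound says nothing. The exponent
  \<open>min (\<alpha> / q) 1\<close> is the largest \<open>\<beta>\<close> with
  \<open>\<beta> \<le> 1\<close> and \<open>\<beta> * q \<le> \<alpha>\<close>.\<close>

theorem theorem1:
  fixes M :: "'w measure"
    and \<epsilon> :: "int \<Rightarrow> 'w \<Rightarrow> real"
    and f\<epsilon> :: "real \<Rightarrow> real"
    and a :: "nat \<Rightarrow> real"
    and X :: "int \<Rightarrow> 'w \<Rightarrow> real"
    and p \<alpha> :: real
  defines "X \<equiv> lin_proc a \<epsilon>"
  assumes "prob_space M"
    and "prob_space.indep_vars M (\<lambda>_. borel) \<epsilon> UNIV"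
    and "\<And>x. 0 \<le> f\<epsilon> x"
    and "\<And>k. distributed M lborel (\<epsilon> k) (\<lambda>x. ennreal (f\<epsilon> x))"
    and "\<And>x. f\<epsilon> differentiable (at x)"
    and "a 0 = 1"
    and "\<And>k. AE \<omega> in M. summable (\<lambda>i. a i * \<epsilon> (k - int i) \<omega>)"
    and "0 < p" and "p < 1"
    and "bdd_above (range (\<lambda>x. f\<epsilon> x + \<bar>deriv f\<epsilon> x\<bar>))"
    and "cont_density M (X 0) (quantile (dist_fun M (X 0)) p) > 0"
    and "\<alpha> > 0"
    and "\<And>k. integrable M (\<lambda>\<omega>. \<bar>\<epsilon> k \<omega>\<bar> powr \<alpha>)"
  shows "(\<forall>q>2. summable (\<lambda>i. \<bar>a i\<bar> powr min (\<alpha> / q) 1) \<and>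
            (\<lambda>n. \<Sum>i. \<bar>a (n + i)\<bar> powr min (\<alpha> / q) 1) \<in> O(\<lambda>n. ln (real n) powr (- 1 / q))
          \<longrightarrow> quantile_as_bounds M X p q \<and> bahadur_representation M X p q)
       \<and> (summable (\<lambda>i. \<bar>a (Suc i)\<bar> powr min (\<alpha> / 2) 1)
          \<longrightarrow> quantile_as_bounds M X p 2 \<and> bahadur_representation M X p 2)"
proof -
  define \<mu> where "\<mu> = density lborel (\<lambda>x. ennreal (f\<epsilon> x))"
  obtain B0 where B0: "\<And>x. f\<epsilon> x + \<bar>deriv f\<epsilon> x\<bar> \<le> B0"
    using assms(11) unfolding bdd_above_def by auto
  \<comment> \<open>A positive constant that bounds the density and its derivative separately, as
    both summands are nonnegative.\<close>
  define B where "B = \<bar>B0\<bar> + 1"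
  have fB: "f\<epsilon> x \<le> B" and dB: "\<bar>deriv f\<epsilon> x\<bar> \<le> B" for x
    using B0[of x] assms(4)[of x] abs_ge_zero[of "deriv f\<epsilon> x"] unfolding B_def by linarith+
  have lip: "\<bar>f\<epsilon> x - f\<epsilon> y\<bar> \<le> B * \<bar>x - y\<bar>" for x y
  proof -
    have "norm (f\<epsilon> x - f\<epsilon> y) \<le> B * norm (x - y)"
    proof (rule field_differentiable_bound[of UNIV f\<epsilon> "deriv f\<epsilon>"])
      show "(f\<epsilon> has_field_derivative deriv f\<epsilon> z) (at z within UNIV)" for z
        using assms(6)[of z] by (simp add: DERIV_deriv_iff_real_differentiable)
    qed (use dB in auto)
    then show ?thesis by simp
  qed
  have law: "distr M borel (\<epsilon> k) = \<mu>" for k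
  proof -
    have "distr M borel (\<epsilon> k) = distr M lborel (\<epsilon> k)" by (intro distr_cong) auto
    then show ?thesis using assms(5)[of k] by (simp add: distributed_distr_eq_density \<mu>_def)
  qed
  interpret prob_space M by fact
  interpret innovations M \<epsilon> \<mu> by unfold_locales (use assms(3) law in auto)
  have mom: "integrable \<mu> (\<lambda>e. \<bar>e\<bar> powr \<alpha>)"
  proof -
    have "integrable (distr M borel (\<epsilon> 0)) (\<lambda>e. \<bar>e\<bar> powr \<alpha>)"
      using assms(14)[of 0] by (subst integrable_distr_eq) auto
    then show ?thesis unfolding law .
  qed
  interpret unit_linear_process M \<epsilon> \<mu> a \<alpha> f\<epsilon> B
    by unfold_locales (use assms(4,7,8,13) mom fB lip in \<open>auto simp: \<mu>_def B_def\<close>)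
  have X: "X = (\<lambda>i. R i 0)" by (simp add: X_def fun_eq_iff lin_proc_def R_def)
  have fX_pos: "fX (quantile (dist_fun M (R 0 0)) p) > 0"
    using assms(12) unfolding X cont_density_X .
  have \<beta>: "0 < min (\<alpha> / q) 1" "min (\<alpha> / q) 1 \<le> 1" "min (\<alpha> / q) 1 * q \<le> \<alpha>" if "q \<ge> 2" for q
  proof -
    have "min (\<alpha> / q) 1 * q \<le> \<alpha> / q * q" using that by (intro mult_right_mono) auto
    then show "min (\<alpha> / q) 1 * q \<le> \<alpha>" using that by simp
  qed (use that assms(13) in auto)
  have a: "quantile_as_bounds M X p q \<and> bahadur_representation M X p q"
    if q: "q > 2" and s: "summable (\<lambda>i. \<bar>a i\<bar> powr min (\<alpha> / q) 1)"
      and O: "(\<lambda>n. \<Sum>i. \<bar>a (n + i)\<bar> powr min (\<alpha> / q) 1) \<in> O(\<lambda>n. ln (real n) powr (- 1 / q))" for q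
    unfolding X
  proof (rule quantile_bounds_and_bahadur[OF assms(9,10)])
    show "2 \<le> q" using q by simp
    then show "0 < min (\<alpha> / q) 1" "min (\<alpha> / q) 1 \<le> 1" "min (\<alpha> / q) 1 * q \<le> \<alpha>" by (rule \<beta>)+
    show "summable (\<lambda>j. \<bar>a (Suc j)\<bar> powr min (\<alpha> / q) 1)" using s by (subst summable_Suc_iff)
    obtain c where c: "c > 0" "\<forall>\<^sub>F n in sequentially. norm (\<Sum>i. \<bar>a (n + i)\<bar> powr min (\<alpha> / q) 1) \<le> c * norm (ln (real n) powr (- 1 / q))"
      using landau_o.bigE[OF O] by blast
    \<comment> \<open>The q-th power turns the rate \<open>ln n powr (- 1 / q)\<close> into
      \<open>1 / ln n\<close>; the shift by one in the coefficients is absorbed by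
      \<open>ln J \<le> ln (Suc J)\<close>.\<close>
    have "\<forall>\<^sub>F J in sequentially. (\<Sum>j. \<bar>a (Suc (J + j))\<bar> powr min (\<alpha> / q) 1) powr q \<le> c powr q / ln (real J)"
      using eventually_sequentially_Suc[THEN iffD2, OF c(2)] eventually_gt_at_top[of 1]
    proof eventually_elim
      fix J :: nat
      assume h: "norm (\<Sum>i. \<bar>a (Suc J + i)\<bar> powr min (\<alpha> / q) 1) \<le> c * norm (ln (real (Suc J)) powr (- 1 / q))" and J: "1 < J"
      have l: "0 < ln (real J)" "ln (real J) \<le> ln (real (Suc J))" "0 < ln (real (Suc J))" using J by auto
      let ?t = "\<Sum>j. \<bar>a (Suc (J + j))\<bar> powr min (\<alpha> / q) 1"
      have "summable (\<lambda>j. \<bar>a (Suc (J + j))\<bar> powr min (\<alpha> / q) 1)"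
        using s summable_iff_shift[of "\<lambda>i. \<bar>a i\<bar> powr min (\<alpha> / q) 1" "Suc J"] by (simp add: add.commute)
      then have "0 \<le> ?t" by (intro suminf_nonneg) auto
      moreover have "?t \<le> c * ln (real (Suc J)) powr (- 1 / q)" using h by simp
      ultimately have "?t powr q \<le> (c * ln (real (Suc J)) powr (- 1 / q)) powr q"
        using q by (intro powr_mono2) auto
      also have "\<dots> = c powr q * ln (real (Suc J)) powr (-1)" using q by (simp add: powr_mult powr_powr)
      also have "\<dots> = c powr q / ln (real (Suc J))" using l by (simp add: powr_minus divide_inverse)
      also have "\<dots> \<le> c powr q / ln (real J)" using l by (intro divide_left_mono mult_pos_pos) auto
      finally show "?t powr q \<le> c powr q / ln (real J)" .
    qed
    then show "\<exists>c. \<forall>\<^sub>F J in sequentially. (\<Sum>j. \<bar>a (Suc (J + j))\<bar> powr min (\<alpha> / q) 1) powr q \<le> c / ln (real J)" ..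
  qed (rule fX_pos)
  have b: "quantile_as_bounds M X p 2 \<and> bahadur_representation M X p 2"
    if s: "summable (\<lambda>i. \<bar>a (Suc i)\<bar> powr min (\<alpha> / 2) 1)"
    unfolding X by (rule quantile_bounds_and_bahadur[OF assms(9,10) _ \<beta> s _ fX_pos]) auto
  show ?thesis using a b by auto
qed

end
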